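(* The generalized Weierstrass semigroup of $\mathcal{X}$ at $\mathbf{Q}=(Q_1,\ldots,Q_m)$ can be written as $$\widehat{H}(\mathbf{Q})=\{\mathrm{lub}(\beta^1,\ldots,\beta^m)\ :\ \beta^1,\ldots,\beta^m\in\Gamma(\mathbf{Q})\}.$$
   Context: Let $\mathbb{F}$ be a finite field and $\mathcal{X}$ a projective, non-singular, geometrically irreducible algebraic curve over $\mathbb{F}$ with function field $\mathbb{F}(\mathcal{X})$. Let $m\geq 2$ and let $\mathbf{Q}=(Q_1,\ldots,Q_m)$ be an $m$-tuple of pairwise distinct $\mathbb{F}$-rational points of $\mathcal{X}$. Standing assumption: $\#\mathbb{F}\geq m$. Put $I=\{1,\ldots,m\}$. Let $R_{\mathbf{Q}}$ be the ring of functions of $\mathcal{X}$ that are regular outside $\{Q_1,\ldots,Q_m\}$. For $f\in R_{\mathbf{Q}}\setminus\{0\}$ put $\rho_{\mathbf{Q}}(f)=(-v_{Q_1}(f),\ldots,-v_{Q_m}(f))\in\mathbb{Z}^m$, where $v_{Q_i}$ is the valuation at $Q_i$. The generalized Weierstrass semigroup is $\widehat{H}(\mathbf{Q})=\{\rho_{\mathbf{Q}}(f): f\in R_{\mathbf{Q}}\setminus\{0\}\}\subseteq\mathbb{Z}^m$. For $\alpha\in\mathbb{Z}^m$ and a non-empty $J\subsetneq I$, set $\nabla_J(\alpha)=\{\beta\in\widehat{H}(\mathbf{Q}): \beta_j=\alpha_j\ \forall j\in J,\ \beta_i<\alpha_i\ \forall i\in I\setminus J\}$. An element $\alpha\in\widehat{H}(\mathbf{Q})$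 is absolute maximal if $\nabla_J(\alpha)=\emptyset$ for every non-empty $J\subsetneq I$; $\Gamma(\mathbf{Q})$ is the set of absolute maximal elements of $\widehat{H}(\mathbf{Q})$. For $\beta^1,\ldots,\beta^s\in\mathbb{Z}^m$, $\mathrm{lub}(\beta^1,\ldots,\beta^s)\in\mathbb{Z}^m$ denotes their coordinatewise maximum, i.e. its $j$-th coordinate is $\max\{\beta^1_j,\ldots,\beta^s_j\}$. *)

theory Defs
  imports
    "HOL-Analysis.Cartesian_Space"
    "HOL-Algebra.Algebra"
    "HOL-Algebra.Algebraic_Closure_Type"
    "HOL-Library.Poly_Mapping"
begin

text \<open>
  If \<open>'n\<close> has \<open>n + 1\<close> elements, \<open>('b, 'n) proj\<close> is the set of points of projective \<open>n\<close>-space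
  over the field \<open>'b\<close>, with homogeneous coordinates indexed by \<open>'n\<close>.
\<close>

quotient_type (overloaded) ('b, 'n) proj = "'b::field ^ 'n::finite" /
  partial: "\<lambda>x y. x \<noteq> 0 \<and> y \<noteq> 0 \<and> (\<exists>c. c \<noteq> 0 \<and> y = c *s x)"
  morphisms rep_proj pt
proof (rule part_equivpI)
  show "\<exists>x::'b^'n. x \<noteq> 0 \<and> x \<noteq> 0 \<and> (\<exists>c. c \<noteq> 0 \<and> x = c *s x)"
    by (rule exI[of _ "\<chi> i. 1"]) (auto simp: vec_eq_iff intro!: exI[of _ 1])
  show "symp (\<lambda>x y::'b^'n. x \<noteq> 0 \<and> y \<noteq> 0 \<and> (\<exists>c. c \<noteq> 0 \<and> y = c *s x))"
  proof (rule sympI, elim conjE exE, intro conjI)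
    fix x y :: "'b^'n" and c
    assume "c \<noteq> 0" "y = c *s x"
    then show "\<exists>c. c \<noteq> 0 \<and> x = c *s y"
      by (intro exI[of _ "inverse c"]) (auto simp: vec_eq_iff)
  qed auto
  show "transp (\<lambda>x y::'b^'n. x \<noteq> 0 \<and> y \<noteq> 0 \<and> (\<exists>c. c \<noteq> 0 \<and> y = c *s x))"
    by (rule transpI) (auto simp: vector_smult_assoc)
qed

type_synonym ('b, 'n) mpoly = "('n \<Rightarrow>\<^sub>0 nat) \<Rightarrow>\<^sub>0 'b"

definition mp_eval :: "('b::field, 'n::finite) mpoly \<Rightarrow> 'b ^ 'n \<Rightarrow> 'b" where
  "mp_eval p x =
    (\<Sum>m\<in>Poly_Mapping.keys p. Poly_Mapping.lookup p m * (\<Prod>i\<in>UNIV. x $ i ^ Poly_Mapping.lookup m i))"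

definition mp_deriv :: "'n \<Rightarrow> ('b::field, 'n::finite) mpoly \<Rightarrow> ('b, 'n) mpoly" where
  "mp_deriv i p =
    (\<Sum>m\<in>Poly_Mapping.keys p.
      Poly_Mapping.single (m - Poly_Mapping.single i 1)
        (of_nat (Poly_Mapping.lookup m i) * Poly_Mapping.lookup p m))"

text \<open>The zero polynomial is a form of every degree.\<close>

definition form :: "nat \<Rightarrow> ('b::field, 'n::finite) mpoly \<Rightarrow> bool" where
  "form d p \<longleftrightarrow> (\<forall>m\<in>Poly_Mapping.keys p. (\<Sum>i\<in>UNIV. Poly_Mapping.lookup m i) = d)"

definition zero_at :: "('b::field, 'n::finite) mpoly \<Rightarrow> ('b, 'n) proj \<Rightarrow> bool" where
  "zero_at p P \<longleftrightarrow> (\<forall>x. x \<noteq> 0 \<and> pt x = P \<longrightarrow> mp_eval p x = 0)"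

definition zero_locus :: "('b::field, 'n::finite) mpoly set \<Rightarrow> ('b, 'n) proj set" where
  "zero_locus S = {P. \<forall>p\<in>S. zero_at p P}"

definition zariski_closed :: "('b::field, 'n::finite) proj set \<Rightarrow> bool" where
  "zariski_closed A \<longleftrightarrow> (\<exists>S. (\<forall>p\<in>S. \<exists>d. form d p) \<and> A = zero_locus S)"

definition to_ac_poly :: "('a::field, 'n::finite) mpoly \<Rightarrow> ('a alg_closure, 'n) mpoly" where
  "to_ac_poly p = Poly_Mapping.map to_ac p"

text \<open>
  A projective variety over the field \<open>'a\<close> is given by its set \<open>V\<close> of geometric points, i.e. of points
  over the algebraic closure of \<open>'a\<close>.
\<close>

definition closed_over_base :: "('a::field alg_closure, 'n::finite) proj set \<Rightarrow> bool" where
  "closed_over_base V \<longleftrightarrow>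
    (\<exists>S :: ('a, 'n) mpoly set. (\<forall>p\<in>S. \<exists>d. form d p) \<and> V = zero_locus (to_ac_poly ` S))"

definition geometrically_irreducible :: "('a::field alg_closure, 'n::finite) proj set \<Rightarrow> bool" where
  "geometrically_irreducible V \<longleftrightarrow>
    V \<noteq> {} \<and>
    (\<forall>A B. zariski_closed A \<and> zariski_closed B \<and> V \<subseteq> A \<union> B \<longrightarrow> V \<subseteq> A \<or> V \<subseteq> B)"

definition vanishing_ideal ::
    "('a::field alg_closure, 'n::finite) proj set \<Rightarrow> ('a, 'n) mpoly set" where
  "vanishing_ideal V = {p. \<forall>P\<in>V. zero_at (to_ac_poly p) P}"

definition fractions ::
    "('a::field alg_closure, 'n::finite) proj set \<Rightarrow> (('a, 'n) mpoly \<times> ('a, 'n) mpoly) set" where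
  "fractions V = {(g, h). (\<exists>d. form d g \<and> form d h) \<and> h \<notin> vanishing_ideal V}"

definition frac_rel ::
    "('a::field alg_closure, 'n::finite) proj set \<Rightarrow>
      ((('a, 'n) mpoly \<times> ('a, 'n) mpoly) \<times> (('a, 'n) mpoly \<times> ('a, 'n) mpoly)) set" where
  "frac_rel V = {((g, h), (g', h')). (g, h) \<in> fractions V \<and> (g', h') \<in> fractions V \<and>
     g * h' - g' * h \<in> vanishing_ideal V}"

definition frac ::
    "('a::field alg_closure, 'n::finite) proj set \<Rightarrow> ('a, 'n) mpoly \<Rightarrow> ('a, 'n) mpoly \<Rightarrow>
      (('a, 'n) mpoly \<times> ('a, 'n) mpoly) set" where
  "frac V g h = frac_rel V `` {(g, h)}"

definition function_field ::
    "('a::field alg_closure, 'n::finite) proj set \<Rightarrow> (('a, 'n) mpoly \<times> ('a, 'n) mpoly) set ring" where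
  "function_field V =
    \<lparr> carrier = fractions V // frac_rel V,
      monoid.mult = (\<lambda>A B. \<Union>(g, h)\<in>A. \<Union>(g', h')\<in>B. frac V (g * g') (h * h')),
      monoid.one = frac V 1 1,
      ring.zero = frac V 0 1,
      ring.add = (\<lambda>A B. \<Union>(g, h)\<in>A. \<Union>(g', h')\<in>B. frac V (g * h' + g' * h) (h * h')) \<rparr>"

definition constant_functions ::
    "('a::field alg_closure, 'n::finite) proj set \<Rightarrow> (('a, 'n) mpoly \<times> ('a, 'n) mpoly) set set" where
  "constant_functions V = range (\<lambda>c. frac V (Poly_Mapping.single 0 c) 1)"

text \<open>
  The dimension of a variety is the transcendence degree of its function field over the constants.
\<close>

definition one_dimensional :: "('a::field alg_closure, 'n::finite) proj set \<Rightarrow> bool" where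
  "one_dimensional V \<longleftrightarrow>
    (\<exists>t\<in>carrier (function_field V).
      ring.transcendental (function_field V) (constant_functions V) t \<and>
      (\<forall>f\<in>carrier (function_field V).
        ring.algebraic (function_field V)
          (generate_field (function_field V) (insert t (constant_functions V))) f))"

definition geom_irreducible_projective_curve ::
    "('a::field alg_closure, 'n::finite) proj set \<Rightarrow> bool" where
  "geom_irreducible_projective_curve V \<longleftrightarrow>
    closed_over_base V \<and> geometrically_irreducible V \<and> one_dimensional V"

definition gradient :: "('b::field, 'n::finite) mpoly \<Rightarrow> 'b ^ 'n \<Rightarrow> 'b ^ 'n" where
  "gradient p x = (\<chi> i. mp_eval (mp_deriv i p) x)"

text \<open>
  Jacobian criterion: at every geometric point the Jacobian matrix of the homogeneous ideal of the
  curve has rank \<open>n - 1\<close>, the codimension of the curve, where \<open>n + 1 = CARD('n)\<close>. The base field is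
  assumed perfect, so that this is non-singularity; the rank does not depend on the choice of
  homogeneous coordinates \<open>x\<close> of the point.
\<close>

definition nonsingular_curve :: "('a::field alg_closure, 'n::finite) proj set \<Rightarrow> bool" where
  "nonsingular_curve V \<longleftrightarrow>
    (\<forall>x. x \<noteq> 0 \<and> pt x \<in> V \<longrightarrow>
      vec.dim {gradient (to_ac_poly p) x | p. p \<in> vanishing_ideal V \<and> (\<exists>d. form d p)} + 2 = CARD('n))"

definition rational_points ::
    "('a::field alg_closure, 'n::finite) proj set \<Rightarrow> ('a alg_closure, 'n) proj set" where
  "rational_points V = {P \<in> V. \<exists>x :: 'a ^ 'n. x \<noteq> 0 \<and> P = pt (\<chi> i. to_ac (x $ i))}"

text \<open>
  For a geometric point \<open>P\<close>, this is the local ring (inside the function field over the base field)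
  of the closed point below \<open>P\<close>.
\<close>

definition local_ring ::
    "('a::field alg_closure, 'n::finite) proj set \<Rightarrow> ('a alg_closure, 'n) proj \<Rightarrow>
      (('a, 'n) mpoly \<times> ('a, 'n) mpoly) set ring" where
  "local_ring V P = (function_field V)
    \<lparr> carrier := {f \<in> carrier (function_field V). \<exists>(g, h)\<in>f. \<not> zero_at (to_ac_poly h) P} \<rparr>"

definition max_ideal ::
    "('a::field alg_closure, 'n::finite) proj set \<Rightarrow> ('a alg_closure, 'n) proj \<Rightarrow>
      (('a, 'n) mpoly \<times> ('a, 'n) mpoly) set set" where
  "max_ideal V P = {f \<in> carrier (function_field V).
     \<exists>(g, h)\<in>f. \<not> zero_at (to_ac_poly h) P \<and> zero_at (to_ac_poly g) P}"

definition uniformizer ::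
    "('a::field alg_closure, 'n::finite) proj set \<Rightarrow> ('a alg_closure, 'n) proj \<Rightarrow>
      (('a, 'n) mpoly \<times> ('a, 'n) mpoly) set \<Rightarrow> bool" where
  "uniformizer V P t \<longleftrightarrow>
    t \<in> carrier (local_ring V P) \<and> max_ideal V P = PIdl\<^bsub>local_ring V P\<^esub> t"

text \<open>The value is only meaningful for \<open>f \<noteq> 0\<close>.\<close>

definition valuation ::
    "('a::field alg_closure, 'n::finite) proj set \<Rightarrow> ('a alg_closure, 'n) proj \<Rightarrow>
      (('a, 'n) mpoly \<times> ('a, 'n) mpoly) set \<Rightarrow> int" where
  "valuation V P f = (THE k. \<exists>t u. uniformizer V P t \<and> u \<in> Units (local_ring V P) \<and>
     f = t [^]\<^bsub>function_field V\<^esub> k \<otimes>\<^bsub>function_field V\<^esub> u)"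

definition regular_outside ::
    "('a::field alg_closure, 'n::finite) proj set \<Rightarrow> ('m::finite \<Rightarrow> ('a alg_closure, 'n) proj) \<Rightarrow>
      (('a, 'n) mpoly \<times> ('a, 'n) mpoly) set set" where
  "regular_outside V Q =
    {f \<in> carrier (function_field V). \<forall>P\<in>V - range Q. f \<in> carrier (local_ring V P)}"

definition pole_vector ::
    "('a::field alg_closure, 'n::finite) proj set \<Rightarrow> ('m::finite \<Rightarrow> ('a alg_closure, 'n) proj) \<Rightarrow>
      (('a, 'n) mpoly \<times> ('a, 'n) mpoly) set \<Rightarrow> int ^ 'm" where
  "pole_vector V Q f = (\<chi> i. - valuation V (Q i) f)"

definition gen_weierstrass_semigroup ::
    "('a::field alg_closure, 'n::finite) proj set \<Rightarrow> ('m::finite \<Rightarrow> ('a alg_closure, 'n) proj) \<Rightarrow>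
      (int ^ 'm) set" where
  "gen_weierstrass_semigroup V Q =
    pole_vector V Q ` (regular_outside V Q - {\<zero>\<^bsub>function_field V\<^esub>})"

definition nabla ::
    "('a::field alg_closure, 'n::finite) proj set \<Rightarrow> ('m::finite \<Rightarrow> ('a alg_closure, 'n) proj) \<Rightarrow>
      'm set \<Rightarrow> int ^ 'm \<Rightarrow> (int ^ 'm) set" where
  "nabla V Q J \<alpha> = {\<beta> \<in> gen_weierstrass_semigroup V Q.
     (\<forall>j\<in>J. \<beta> $ j = \<alpha> $ j) \<and> (\<forall>i\<in>UNIV - J. \<beta> $ i < \<alpha> $ i)}"

definition absolute_maximal ::
    "('a::field alg_closure, 'n::finite) proj set \<Rightarrow> ('m::finite \<Rightarrow> ('a alg_closure, 'n) proj) \<Rightarrow>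
      (int ^ 'm) set" where
  "absolute_maximal V Q = {\<alpha> \<in> gen_weierstrass_semigroup V Q.
     \<forall>J. J \<noteq> {} \<and> J \<subset> UNIV \<longrightarrow> nabla V Q J \<alpha> = {}}"

definition lub :: "('s::finite \<Rightarrow> int ^ 'm::finite) \<Rightarrow> int ^ 'm" where
  "lub \<beta> = (\<chi> j. Max (range (\<lambda>k. \<beta> k $ j)))"

end

theory Submission
  imports Defs
begin

text \<open>
  Let \<open>R\<close> be the ring of functions regular outside the points \<open>Q\<^sub>i\<close>, and
  let \<open>F\<close> be the finite base field. Four properties of \<open>R\<close> and of the valuations \<open>v\<^sub>i\<close> carry the
  combinatorial part (locale \<open>pole_order_space\<close>): \<open>R\<close> is a vector space over \<open>F\<close>; the \<open>v\<^sub>i\<close> are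
  ultrametric; the residue field at each \<open>Q\<^sub>i\<close> is \<open>F\<close>, so that two functions with the same pole
  order at \<open>Q\<^sub>i\<close> have a combination \<open>f - c g\<close> with a smaller one; and no nonzero function in \<open>R\<close>
  vanishes at all \<open>Q\<^sub>i\<close>.

  Least upper bounds stay in the semigroup (\<open>H_max\<close>): \<open>f - c g\<close> has at \<open>Q\<^sub>j\<close> the larger of the two
  pole orders for all but at most one value of \<open>c\<close>, and unless the poles of \<open>g\<close> dominate those of
  \<open>f\<close>, some \<open>j\<close> excludes no value at all, so a good \<open>c\<close> exists as soon as \<open>F\<close> has at least as many
  elements as there are points. Conversely, let \<open>\<alpha>\<close> lie in the semigroup and fix an index \<open>i\<close>. The functions
  whose poles are bounded by \<open>\<alpha>\<close> form a finite set (\<open>finite_L\<close>), so among the elements \<open>\<beta> \<le> \<alpha>\<close> of the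
  semigroup with \<open>\<beta>\<^sub>i = \<alpha>\<^sub>i\<close> there is one of minimal coordinate sum. It is absolute maximal
  (\<open>maximal_below\<close>): an element of some \<open>\<nabla>\<^sub>J(\<beta>)\<close> is itself a smaller candidate if \<open>i \<in> J\<close>, and
  cancelling a leading coefficient against it produces one if \<open>i \<notin> J\<close>. Then \<open>\<alpha>\<close> is the least upper
  bound of these \<open>\<beta>\<close>, one for each \<open>i\<close>.

  The geometry serves to establish the four properties. The function field is realised inside a
  field \<open>E\<close> that contains a generic point \<open>\<xi>\<close> of the curve: a form vanishes on the curve exactly if
  it vanishes at \<open>\<xi>\<close> (\<open>generic_point_exists\<close>). Functions become quotients \<open>g(\<xi>) / h(\<xi>)\<close> of elements
  of \<open>E\<close>, and local rings become subrings of \<open>E\<close>. Two facts remain.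

  First, a function that is regular everywhere and vanishes somewhere is zero
  (\<open>regular_everywhere_zero_somewhere\<close>). Otherwise \<open>1/f\<close> is transcendental over \<open>F\<close>, the
  specialisation \<open>1/f \<mapsto> 0\<close> extends to a valuation ring of \<open>E\<close> with values in the algebraic closure
  (\<open>place_extension\<close>), and the images of the homogeneous coordinates of \<open>\<xi>\<close> form a point of the curve
  at which \<open>f\<close> cannot be regular.

  Second, the local ring at a nonsingular rational point is a discrete valuation ring
  (\<open>local_ring_dvr\<close>). By the Jacobian criterion the linear terms of the equations of the curve leave
  one direction in the cotangent space, so the maximal ideal is principal by Nakayama's lemma, with
  generator \<open>t\<close>. A nonzero function divisible by every power of \<open>t\<close> would be algebraically
  independent of \<open>t\<close>; but two functions on a curve are always algebraically dependent, which over a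
  finite field follows by counting (\<open>alg_dependent_of_algebraic\<close>).
\<close>

\<comment> \<open>\<open>$\<close> denotes vector components only.\<close>
no_notation fps_nth (infixl "$" 75)

section \<open>Evaluation of polynomials\<close>

abbreviation cf :: "('n, 'b::zero) poly_mapping \<Rightarrow> 'n \<Rightarrow> 'b" where
  "cf \<equiv> Poly_Mapping.lookup"

abbreviation supp :: "('n, 'b::zero) poly_mapping \<Rightarrow> 'n set" where
  "supp \<equiv> Poly_Mapping.keys"

definition monom_at :: "'e::comm_ring_1 ^ 'n::finite \<Rightarrow> ('n \<Rightarrow>\<^sub>0 nat) \<Rightarrow> 'e" where
  "monom_at x m = (\<Prod>i\<in>UNIV. x $ i ^ cf m i)"

text \<open>
  The coefficients are moved by \<open>\<iota>\<close>, so that one polynomial over the base field can be evaluated at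
  rational points (\<open>\<iota>\<close> the identity), at geometric points (\<open>\<iota> = to_ac\<close>) and at a generic point.
\<close>

definition poly_at :: "('a::field \<Rightarrow> 'e::comm_ring_1) \<Rightarrow> 'e ^ 'n::finite \<Rightarrow> ('a, 'n) mpoly \<Rightarrow> 'e" where
  "poly_at \<iota> x p = (\<Sum>m\<in>supp p. \<iota> (cf p m) * monom_at x m)"

locale field_embedding =
  fixes \<iota> :: "'a::field \<Rightarrow> 'e::field"
  assumes emb_add: "\<iota> (a + b) = \<iota> a + \<iota> b"
    and emb_mult: "\<iota> (a * b) = \<iota> a * \<iota> b"
    and emb_1 [simp]: "\<iota> 1 = 1"
begin

lemma emb_0 [simp]: "\<iota> 0 = 0"
proof -
  have "\<iota> 0 + \<iota> 0 = \<iota> 0 + 0" using emb_add[of 0 0] by simp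
  then show ?thesis by (simp only: add_left_cancel)
qed

lemma emb_minus: "\<iota> (- a) = - \<iota> a"
  using emb_add[of a "- a"] by (simp add: eq_neg_iff_add_eq_0 add.commute)

lemma emb_diff: "\<iota> (a - b) = \<iota> a - \<iota> b"
  using emb_add[of a "- b"] by (simp add: emb_minus)

lemma emb_eq_0_iff [simp]: "\<iota> a = 0 \<longleftrightarrow> a = 0"
proof
  assume "\<iota> a = 0"
  show "a = 0"
  proof (rule ccontr)
    assume "a \<noteq> 0"
    then have "\<iota> (a * inverse a) = 1" by simp
    then show False using \<open>\<iota> a = 0\<close> by (simp only: emb_mult) simp
  qed
qed simp

lemma emb_eq_iff [simp]: "\<iota> a = \<iota> b \<longleftrightarrow> a = b"
  using emb_diff[of a b] emb_eq_0_iff[of "a - b"] by auto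

lemma emb_inverse: "\<iota> (inverse a) = inverse (\<iota> a)"
proof (cases "a = 0")
  case False
  then have "\<iota> a * \<iota> (inverse a) = 1" by (simp flip: emb_mult)
  then show ?thesis by (metis inverse_unique)
qed simp

lemma emb_divide: "\<iota> (a / b) = \<iota> a / \<iota> b"
  by (simp add: divide_inverse emb_mult emb_inverse)

lemma emb_power: "\<iota> (a ^ k) = \<iota> a ^ k"
  by (induction k) (simp_all add: emb_mult)

lemma emb_of_nat: "\<iota> (of_nat k) = of_nat k"
  by (induction k) (simp_all add: emb_add)

lemma emb_sum: "\<iota> (\<Sum>i\<in>A. f i) = (\<Sum>i\<in>A. \<iota> (f i))"
  by (induction A rule: infinite_finite_induct) (simp_all add: emb_add)

lemma emb_prod: "\<iota> (\<Prod>i\<in>A. f i) = (\<Prod>i\<in>A. \<iota> (f i))"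
  by (induction A rule: infinite_finite_induct) (simp_all add: emb_mult)

end

lemma field_embedding_id: "field_embedding (\<lambda>x. x)"
  by unfold_locales simp_all

lemma field_embedding_to_ac: "field_embedding to_ac"
  by unfold_locales simp_all

lemma monom_at_0 [simp]: "monom_at x 0 = 1"
  by (simp add: monom_at_def)

lemma monom_at_add: "monom_at x (m + m') = monom_at x m * monom_at x m'"
  by (simp add: monom_at_def Poly_Mapping.lookup_add power_add prod.distrib)

lemma monom_at_single: "monom_at x (Poly_Mapping.single i k) = x $ i ^ k"
proof -
  have "monom_at x (Poly_Mapping.single i k) = (\<Prod>j\<in>UNIV. if j = i then x $ i ^ k else 1)"
    unfolding monom_at_def by (rule prod.cong) (auto simp: Poly_Mapping.lookup_single)
  then show ?thesis by simp
qed

lemma monom_at_smult: "monom_at (c *s x) m = c ^ (\<Sum>i\<in>UNIV. cf m i) * monom_at x m"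
  by (simp add: monom_at_def power_mult_distrib prod.distrib power_sum)

lemma mpoly_eq_sum_monomials: "p = (\<Sum>m\<in>supp p. Poly_Mapping.single m (cf p m))"
  by (rule poly_mapping_eqI)
    (auto simp: Poly_Mapping.lookup_sum Poly_Mapping.lookup_single when_def in_keys_iff)

lemma mp_eval_eq_poly_at: "mp_eval p x = poly_at (\<lambda>c. c) x p"
  by (simp add: mp_eval_def poly_at_def monom_at_def)

lemma cf_to_ac_poly: "cf (to_ac_poly p) m = to_ac (cf p m)"
  by (simp add: to_ac_poly_def Poly_Mapping.map.rep_eq when_def)

lemma supp_to_ac_poly: "supp (to_ac_poly p) = supp p"
  by (auto simp: in_keys_iff cf_to_ac_poly)

lemma mp_eval_to_ac_poly: "mp_eval (to_ac_poly p) x = poly_at to_ac x p"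
  by (simp add: mp_eval_def poly_at_def monom_at_def supp_to_ac_poly cf_to_ac_poly)

lemma form_to_ac_poly: "form d (to_ac_poly p) \<longleftrightarrow> form d p"
  by (simp add: form_def supp_to_ac_poly)

context field_embedding
begin

lemma poly_at_superset:
  assumes "finite S" "supp p \<subseteq> S"
  shows "poly_at \<iota> x p = (\<Sum>m\<in>S. \<iota> (cf p m) * monom_at x m)"
  unfolding poly_at_def by (rule sum.mono_neutral_left) (use assms in \<open>auto simp: in_keys_iff\<close>)

lemma poly_at_0 [simp]: "poly_at \<iota> x 0 = 0"
  by (simp add: poly_at_def)

lemma poly_at_single: "poly_at \<iota> x (Poly_Mapping.single m c) = \<iota> c * monom_at x m"
  by (subst poly_at_superset[of "{m}"]) simp_all

lemma poly_at_1 [simp]: "poly_at \<iota> x 1 = 1"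
  using poly_at_single[of x 0 1] by simp

lemma poly_at_const [simp]: "poly_at \<iota> x (Poly_Mapping.single 0 c) = \<iota> c"
  by (simp add: poly_at_single)

lemma poly_at_add: "poly_at \<iota> x (p + q) = poly_at \<iota> x p + poly_at \<iota> x q"
proof -
  have "supp (p + q) \<subseteq> supp p \<union> supp q" by (rule Poly_Mapping.keys_add)
  then show ?thesis
    by (simp add: poly_at_superset[of "supp p \<union> supp q"] Poly_Mapping.lookup_add emb_add
        distrib_right sum.distrib)
qed

lemma poly_at_uminus: "poly_at \<iota> x (- p) = - poly_at \<iota> x p"
  using poly_at_add[of x p "- p"] by (simp add: eq_neg_iff_add_eq_0 add.commute)

lemma poly_at_diff: "poly_at \<iota> x (p - q) = poly_at \<iota> x p - poly_at \<iota> x q"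
  using poly_at_add[of x p "- q"] by (simp add: poly_at_uminus)

lemma poly_at_sum: "poly_at \<iota> x (\<Sum>i\<in>A. f i) = (\<Sum>i\<in>A. poly_at \<iota> x (f i))"
  by (induction A rule: infinite_finite_induct) (simp_all add: poly_at_add)

lemma poly_at_mult: "poly_at \<iota> x (p * q) = poly_at \<iota> x p * poly_at \<iota> x q"
proof -
  have "p * q = (\<Sum>m\<in>supp p. Poly_Mapping.single m (cf p m)) *
      (\<Sum>m\<in>supp q. Poly_Mapping.single m (cf q m))"
    by (simp flip: mpoly_eq_sum_monomials)
  then show ?thesis
    by (simp add: sum_product poly_at_sum Poly_Mapping.mult_single poly_at_single monom_at_add
        emb_mult poly_at_def[of \<iota> x p] poly_at_def[of \<iota> x q] ac_simps)
qed

lemma poly_at_power: "poly_at \<iota> x (p ^ k) = poly_at \<iota> x p ^ k"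
  by (induction k) (simp_all add: poly_at_mult)

lemma poly_at_prod: "poly_at \<iota> x (\<Prod>i\<in>A. f i) = (\<Prod>i\<in>A. poly_at \<iota> x (f i))"
  by (induction A rule: infinite_finite_induct) (simp_all add: poly_at_mult)

lemma poly_at_smult:
  assumes "form d p"
  shows "poly_at \<iota> (c *s x) p = c ^ d * poly_at \<iota> x p"
  unfolding poly_at_def sum_distrib_left
  by (rule sum.cong) (use assms in \<open>auto simp: monom_at_smult form_def\<close>)

lemma poly_at_emb: "poly_at \<iota> (\<chi> i. \<iota> (a $ i)) p = \<iota> (poly_at (\<lambda>c. c) a p)"
  by (simp add: poly_at_def emb_sum emb_mult monom_at_def emb_prod emb_power)

end

definition mvar :: "'n::finite \<Rightarrow> ('a::field, 'n) mpoly" where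
  "mvar i = Poly_Mapping.single (Poly_Mapping.single i 1) 1"

lemma (in field_embedding) poly_at_mvar [simp]: "poly_at \<iota> x (mvar i) = x $ i"
  by (simp add: mvar_def poly_at_single monom_at_single)

subsection \<open>Forms\<close>

lemma form_0 [simp]: "form d 0"
  by (simp add: form_def)

lemma form_1 [simp]: "form 0 1"
  by (simp add: form_def)

lemma form_const [simp]: "form 0 (Poly_Mapping.single 0 c)"
  by (cases "c = 0") (simp_all add: form_def)

lemma form_mvar [simp]: "form 1 (mvar i :: ('a::field, 'n::finite) mpoly)"
proof -
  have "(\<Sum>j\<in>UNIV. cf (Poly_Mapping.single i (1::nat)) j) = (\<Sum>j\<in>UNIV. if j = i then 1 else 0)"
    by (rule sum.cong) (auto simp: Poly_Mapping.lookup_single)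
  then show ?thesis by (simp add: form_def mvar_def)
qed

lemma form_add: "form d p \<Longrightarrow> form d q \<Longrightarrow> form d (p + q)"
  unfolding form_def using Poly_Mapping.keys_add[of p q] by blast

lemma form_uminus: "form d p \<Longrightarrow> form d (- p)"
  by (simp add: form_def in_keys_iff)

lemma form_diff: "form d p \<Longrightarrow> form d q \<Longrightarrow> form d (p - q)"
  using form_add[of d p "- q"] form_uminus[of d q] by simp

lemma form_mult: "form d p \<Longrightarrow> form e q \<Longrightarrow> form (d + e) (p * q)"
  unfolding form_def
proof
  fix m assume *: "\<forall>m\<in>supp p. (\<Sum>i\<in>UNIV. cf m i) = d" "\<forall>m\<in>supp q. (\<Sum>i\<in>UNIV. cf m i) = e"
    and "m \<in> supp (p * q)"
  then obtain m1 m2 where "m = m1 + m2" "m1 \<in> supp p" "m2 \<in> supp q"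
    using Poly_Mapping.keys_mult[of p q] by blast
  then show "(\<Sum>i\<in>UNIV. cf m i) = d + e"
    using * by (simp add: Poly_Mapping.lookup_add sum.distrib)
qed

lemma form_cmult: "form d p \<Longrightarrow> form d (Poly_Mapping.single 0 c * p)"
  using form_mult[OF form_const] by fastforce

lemma form_power: "form d p \<Longrightarrow> form (k * d) (p ^ k)"
  by (induction k) (simp_all add: form_mult)

lemma form_mvar_power [simp]: "form d (mvar i ^ d)"
  using form_power[OF form_mvar[of i], of d] by simp

subsection \<open>Subrings and partial homomorphisms\<close>

text \<open>
  Subrings are sets in an ambient ring that is a type. A homomorphism on a subring \<open>A\<close> is a total
  function about which nothing is required outside \<open>A\<close>.
\<close>

definition subring_of :: "'e::comm_ring_1 set \<Rightarrow> bool" where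
  "subring_of A \<longleftrightarrow> 1 \<in> A \<and> (\<forall>x\<in>A. \<forall>y\<in>A. x - y \<in> A \<and> x * y \<in> A)"

lemma
  assumes "subring_of A"
  shows subring_one: "1 \<in> A" and subring_zero: "0 \<in> A"
    and subring_diff: "x \<in> A \<Longrightarrow> y \<in> A \<Longrightarrow> x - y \<in> A"
    and subring_mult: "x \<in> A \<Longrightarrow> y \<in> A \<Longrightarrow> x * y \<in> A"
    and subring_uminus: "x \<in> A \<Longrightarrow> - x \<in> A"
    and subring_add: "x \<in> A \<Longrightarrow> y \<in> A \<Longrightarrow> x + y \<in> A"
proof -
  show d: "x - y \<in> A" and "x * y \<in> A" if "x \<in> A" "y \<in> A" for x y
    using assms that unfolding subring_of_def by auto
  show 1: "1 \<in> A" using assms unfolding subring_of_def by auto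
  show 0: "0 \<in> A" using d[OF 1 1] by simp
  show u: "- x \<in> A" if "x \<in> A" for x using d[OF 0 that] by simp
  show "x + y \<in> A" if "x \<in> A" "y \<in> A" for x y using d[OF that(1) u[OF that(2)]] by simp
qed

lemma subring_sum: "subring_of A \<Longrightarrow> (\<And>i. i \<in> S \<Longrightarrow> f i \<in> A) \<Longrightarrow> (\<Sum>i\<in>S. f i) \<in> A"
  by (induction S rule: infinite_finite_induct) (simp_all add: subring_zero subring_add)

lemma subring_prod: "subring_of A \<Longrightarrow> (\<And>i. i \<in> S \<Longrightarrow> f i \<in> A) \<Longrightarrow> (\<Prod>i\<in>S. f i) \<in> A"
  by (induction S rule: infinite_finite_induct) (simp_all add: subring_one subring_mult)

lemma subring_power: "subring_of A \<Longrightarrow> x \<in> A \<Longrightarrow> x ^ k \<in> A"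
  by (induction k) (simp_all add: subring_one subring_mult)

definition hom_on :: "'e::comm_ring_1 set \<Rightarrow> ('e \<Rightarrow> 'f::comm_ring_1) \<Rightarrow> bool" where
  "hom_on A \<phi> \<longleftrightarrow> subring_of A \<and> \<phi> 1 = 1 \<and>
    (\<forall>x\<in>A. \<forall>y\<in>A. \<phi> (x + y) = \<phi> x + \<phi> y \<and> \<phi> (x * y) = \<phi> x * \<phi> y)"

lemma
  assumes "hom_on A \<phi>"
  shows hom_on_subring: "subring_of A"
    and hom_on_one: "\<phi> 1 = 1"
    and hom_on_add: "x \<in> A \<Longrightarrow> y \<in> A \<Longrightarrow> \<phi> (x + y) = \<phi> x + \<phi> y"
    and hom_on_mult: "x \<in> A \<Longrightarrow> y \<in> A \<Longrightarrow> \<phi> (x * y) = \<phi> x * \<phi> y"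
    and hom_on_zero: "\<phi> 0 = 0"
    and hom_on_uminus: "x \<in> A \<Longrightarrow> \<phi> (- x) = - \<phi> x"
    and hom_on_diff: "x \<in> A \<Longrightarrow> y \<in> A \<Longrightarrow> \<phi> (x - y) = \<phi> x - \<phi> y"
proof -
  show s: "subring_of A" and "\<phi> 1 = 1" using assms by (auto simp: hom_on_def)
  show a: "\<phi> (x + y) = \<phi> x + \<phi> y" and "\<phi> (x * y) = \<phi> x * \<phi> y" if "x \<in> A" "y \<in> A" for x y
    using assms that by (auto simp: hom_on_def)
  show 0: "\<phi> 0 = 0" using a[OF subring_zero subring_zero] s by simp
  show u: "\<phi> (- x) = - \<phi> x" if "x \<in> A" for x
    using a[OF that subring_uminus[OF s that]] 0 by (simp add: eq_neg_iff_add_eq_0 add.commute)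
  show "\<phi> (x - y) = \<phi> x - \<phi> y" if "x \<in> A" "y \<in> A" for x y
    using a[OF that(1) subring_uminus[OF s that(2)]] u[OF that(2)] by simp
qed

lemma hom_on_sum:
  "hom_on A \<phi> \<Longrightarrow> (\<And>i. i \<in> S \<Longrightarrow> f i \<in> A) \<Longrightarrow> \<phi> (\<Sum>i\<in>S. f i) = (\<Sum>i\<in>S. \<phi> (f i))"
  by (induction S rule: infinite_finite_induct)
    (simp_all add: hom_on_zero hom_on_add subring_sum hom_on_subring)

lemma hom_on_prod:
  "hom_on A \<phi> \<Longrightarrow> (\<And>i. i \<in> S \<Longrightarrow> f i \<in> A) \<Longrightarrow> \<phi> (\<Prod>i\<in>S. f i) = (\<Prod>i\<in>S. \<phi> (f i))"
  by (induction S rule: infinite_finite_induct)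
    (simp_all add: hom_on_one hom_on_mult subring_prod hom_on_subring)

lemma hom_on_power: "hom_on A \<phi> \<Longrightarrow> x \<in> A \<Longrightarrow> \<phi> (x ^ k) = \<phi> x ^ k"
  by (induction k) (simp_all add: hom_on_one hom_on_mult subring_power hom_on_subring)

lemma monom_at_in_subring:
  fixes x :: "'e::comm_ring_1 ^ 'n::finite"
  shows "subring_of A \<Longrightarrow> (\<And>i. x $ i \<in> A) \<Longrightarrow> monom_at x m \<in> A"
  by (auto simp: monom_at_def intro!: subring_prod subring_power)

lemma poly_at_in_subring:
  fixes x :: "'e::comm_ring_1 ^ 'n::finite"
  shows "subring_of A \<Longrightarrow> range \<iota> \<subseteq> A \<Longrightarrow> (\<And>i. x $ i \<in> A) \<Longrightarrow> poly_at \<iota> x p \<in> A"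
  by (auto simp: poly_at_def intro!: subring_sum subring_mult monom_at_in_subring)

lemma hom_on_poly_at:
  fixes x :: "'e::comm_ring_1 ^ 'n::finite"
  assumes "hom_on A \<phi>" "range \<iota> \<subseteq> A" "\<And>i. x $ i \<in> A"
  shows "\<phi> (poly_at \<iota> x p) = poly_at (\<lambda>c. \<phi> (\<iota> c)) (\<chi> i. \<phi> (x $ i)) p"
proof -
  note A = hom_on_subring[OF assms(1)]
  have "\<iota> c \<in> A" for c using assms(2) by auto
  then show ?thesis
    using assms unfolding poly_at_def
    by (simp add: hom_on_sum hom_on_mult A subring_mult monom_at_in_subring)
      (simp add: monom_at_def hom_on_prod hom_on_power A subring_power)
qed

subsection \<open>Taylor expansion\<close>

definition ideal_in :: "'e::comm_ring_1 set \<Rightarrow> 'e set \<Rightarrow> bool" where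
  "ideal_in A J \<longleftrightarrow> subring_of A \<and> J \<subseteq> A \<and> 0 \<in> J \<and> (\<forall>u\<in>J. \<forall>v\<in>J. u + v \<in> J) \<and>
    (\<forall>u\<in>A. \<forall>v\<in>J. u * v \<in> J)"

lemma
  assumes "ideal_in A J"
  shows ideal_in_subring: "subring_of A" and ideal_in_subset: "J \<subseteq> A" and ideal_in_zero: "0 \<in> J"
    and ideal_in_add: "u \<in> J \<Longrightarrow> v \<in> J \<Longrightarrow> u + v \<in> J"
    and ideal_in_mult: "a \<in> A \<Longrightarrow> v \<in> J \<Longrightarrow> a * v \<in> J"
    and ideal_in_uminus: "u \<in> J \<Longrightarrow> - u \<in> J"
    and ideal_in_diff: "u \<in> J \<Longrightarrow> v \<in> J \<Longrightarrow> u - v \<in> J"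
proof -
  show A: "subring_of A" and "J \<subseteq> A" and "0 \<in> J"
    and a: "\<And>u v. u \<in> J \<Longrightarrow> v \<in> J \<Longrightarrow> u + v \<in> J"
    and m: "\<And>a v. a \<in> A \<Longrightarrow> v \<in> J \<Longrightarrow> a * v \<in> J"
    using assms by (auto simp: ideal_in_def)
  show u: "- u \<in> J" if "u \<in> J" for u
    using m[OF subring_uminus[OF A subring_one[OF A]] that] by simp
  show "u - v \<in> J" if "u \<in> J" "v \<in> J" for u v
    using a[OF that(1) u[OF that(2)]] by simp
qed

lemma ideal_in_sum: "ideal_in A J \<Longrightarrow> (\<And>i. i \<in> S \<Longrightarrow> f i \<in> J) \<Longrightarrow> (\<Sum>i\<in>S. f i) \<in> J"
  by (induction S rule: infinite_finite_induct) (simp_all add: ideal_in_zero ideal_in_add)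

text \<open>
  The product rule: when each factor \<open>f i\<close> equals \<open>g i + g' i * y i\<close> modulo \<open>J\<close> and all products
  \<open>y i * y j\<close> lie in \<open>J\<close>, expanding the product leaves only the terms of degree at most one in \<open>y\<close>.
\<close>

lemma prod_taylor:
  fixes f g g' y :: "'n \<Rightarrow> 'e::comm_ring_1"
  assumes J: "ideal_in A J" and "finite S"
    and "\<And>i. i \<in> S \<Longrightarrow> f i \<in> A \<and> g i \<in> A \<and> g' i \<in> A \<and> y i \<in> A"
    and "\<And>i. i \<in> S \<Longrightarrow> f i - g i - g' i * y i \<in> J"
    and "\<And>i j. i \<in> S \<Longrightarrow> j \<in> S \<Longrightarrow> y i * y j \<in> J"
  shows "(\<Prod>i\<in>S. f i) - (\<Prod>i\<in>S. g i) - (\<Sum>i\<in>S. g' i * (\<Prod>j\<in>S - {i}. g j) * y i) \<in> J"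
  using assms(2-)
proof (induction S rule: finite_induct)
  case empty
  then show ?case using ideal_in_zero[OF J] by simp
next
  case (insert k S)
  note A = ideal_in_subring[OF J]
  define P where "P = (\<Prod>i\<in>S. f i)"
  define G where "G = (\<Prod>i\<in>S. g i)"
  define T where "T = (\<Sum>i\<in>S. g' i * (\<Prod>j\<in>S - {i}. g j) * y i)"
  have IH: "P - G - T \<in> J"
    unfolding P_def G_def T_def by (rule insert.IH) (use insert.prems in auto)
  have S: "(\<Sum>i\<in>S. g' i * (\<Prod>j\<in>insert k S - {i}. g j) * y i) = g k * T"
    unfolding T_def sum_distrib_left
  proof (rule sum.cong)
    fix i assume "i \<in> S"
    then have "insert k S - {i} = insert k (S - {i})" using insert.hyps by auto
    then show "g' i * (\<Prod>j\<in>insert k S - {i}. g j) * y i = g k * (g' i * (\<Prod>j\<in>S - {i}. g j) * y i)"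
      using insert.hyps by (simp add: ac_simps)
  qed simp
  have kS: "insert k S - {k} = S" using insert.hyps by auto
  have T: "T * y k \<in> J"
    unfolding T_def sum_distrib_right
  proof (rule ideal_in_sum[OF J])
    fix i assume "i \<in> S"
    then have "(g' i * (\<Prod>j\<in>S - {i}. g j)) * (y i * y k) \<in> J"
      using insert.prems(1) insert.prems(3)[of i k]
      by (intro ideal_in_mult[OF J, of _ "y i * y k"] subring_mult[OF A] subring_prod[OF A])
        simp_all
    then show "g' i * (\<Prod>j\<in>S - {i}. g j) * y i * y k \<in> J" by (simp add: ac_simps)
  qed
  have P: "P \<in> A" unfolding P_def using insert.prems by (intro subring_prod[OF A]) auto
  have "(\<Prod>i\<in>insert k S. f i) - (\<Prod>i\<in>insert k S. g i)
      - (\<Sum>i\<in>insert k S. g' i * (\<Prod>j\<in>insert k S - {i}. g j) * y i)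
    = f k * P - g k * G - g' k * G * y k - g k * T"
    unfolding sum.insert[OF insert.hyps] prod.insert[OF insert.hyps] S kS P_def[symmetric]
      G_def[symmetric] by (simp only: diff_diff_eq add.assoc)
  also have "\<dots> = P * (f k - g k - g' k * y k) + (g k + g' k * y k) * (P - G - T) + g' k * (T * y k)"
    by (simp add: algebra_simps)
  also have "\<dots> \<in> J"
    using insert.prems T IH P
    by (intro ideal_in_add[OF J] ideal_in_mult[OF J, of _ "f k - g k - g' k * y k"]
        ideal_in_mult[OF J, of _ "P - G - T"] ideal_in_mult[OF J, of _ "T * y k"]
        subring_add[OF A] subring_mult[OF A]) auto
  finally show ?case .
qed

text \<open>
  For \<open>k = 0\<close> the exponent \<open>k - 1\<close> is truncated, which is harmless because of the factor \<open>of_nat k\<close>.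
\<close>

lemma power_taylor:
  assumes J: "ideal_in A J" and "a \<in> A" "y \<in> A" "y * y \<in> J"
  shows "(a + y) ^ k - a ^ k - of_nat k * a ^ (k - 1) * y \<in> J"
proof (induction k)
  case (Suc k)
  note A = ideal_in_subring[OF J]
  define c Z B n where "c = of_nat k * a ^ (k - 1)" and "Z = (a + y) ^ k" and "B = a ^ k"
    and "n = (of_nat k :: 'a)"
  have c: "c * a = n * B" unfolding c_def n_def B_def by (cases k) (simp_all add: ac_simps)
  have on: "of_nat i \<in> A" for i :: nat
    by (induction i) (auto intro: subring_zero[OF A] subring_one[OF A] subring_add[OF A])
  have "(a + y) ^ Suc k - a ^ Suc k - of_nat (Suc k) * a ^ (Suc k - 1) * y
    = (a + y) * Z - a * B - (1 + n) * B * y"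
    by (simp add: Z_def B_def n_def)
  also have "\<dots> = (a + y) * (Z - B - c * y) + c * (y * y)"
    using arg_cong[OF c, of "\<lambda>t. t * y"] by (simp add: algebra_simps)
  also have "\<dots> \<in> J"
    using assms Suc on unfolding Z_def B_def n_def c_def
    by (intro ideal_in_add[OF J] ideal_in_mult[OF J, of _ "y * y"]
        ideal_in_mult[OF J, of "a + y"] subring_add[OF A] subring_mult[OF A]
        subring_power[OF A])
  finally show ?case .
qed (simp add: ideal_in_zero[OF J])

text \<open>
  The factor \<open>of_nat (cf m j)\<close> stands on both sides because the truncated subtraction of exponents is
  only meaningful when the exponent of the variable \<open>j\<close> is positive.
\<close>

lemma monom_at_deriv:
  "of_nat (cf m j) * monom_at a (m - Poly_Mapping.single j 1) =
    of_nat (cf m j) * a $ j ^ (cf m j - 1) * (\<Prod>i\<in>UNIV - {j}. a $ i ^ cf m i)"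
proof -
  have "monom_at a (m - Poly_Mapping.single j 1) =
      a $ j ^ (cf m j - 1) * (\<Prod>i\<in>UNIV - {j}. a $ i ^ cf (m - Poly_Mapping.single j 1) i)"
    unfolding monom_at_def by (subst prod.remove[of _ j]) (simp_all add: Poly_Mapping.lookup_minus)
  also have "(\<Prod>i\<in>UNIV - {j}. a $ i ^ cf (m - Poly_Mapping.single j 1) i) =
      (\<Prod>i\<in>UNIV - {j}. a $ i ^ cf m i)"
    by (rule prod.cong) (auto simp: Poly_Mapping.lookup_minus Poly_Mapping.lookup_single)
  finally show ?thesis by (simp add: ac_simps)
qed

context field_embedding
begin

lemma poly_at_mp_deriv:
  "poly_at \<iota> x (mp_deriv j p) =
    (\<Sum>m\<in>supp p. \<iota> (cf p m) * (of_nat (cf m j) * monom_at x (m - Poly_Mapping.single j 1)))"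
  by (simp add: mp_deriv_def poly_at_sum poly_at_single emb_mult emb_of_nat ac_simps)

text \<open>
  The form of Taylor's formula that serves both purposes below: with \<open>J\<close> generated by the \<open>y j\<close> it says
  that a polynomial vanishing at \<open>a\<close> takes at \<open>a + y\<close> a value in \<open>J\<close>, and with \<open>J\<close> the product of the
  maximal ideal and the \<open>y j\<close> it extracts the linear term.
\<close>

lemma poly_taylor:
  fixes x a y :: "'e ^ 'n::finite"
  assumes J: "ideal_in A J" and "range \<iota> \<subseteq> A" and x: "x = a + y"
    and "\<And>i. a $ i \<in> A" "\<And>i. y $ i \<in> A" "\<And>i j. y $ i * y $ j \<in> J"
  shows "poly_at \<iota> x p - poly_at \<iota> a p - (\<Sum>j\<in>UNIV. poly_at \<iota> a (mp_deriv j p) * y $ j) \<in> J"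
proof -
  note A = ideal_in_subring[OF J]
  have on: "of_nat k \<in> A" for k :: nat
    by (induction k) (auto intro: subring_zero[OF A] subring_one[OF A] subring_add[OF A])
  have mon: "monom_at x m - monom_at a m
      - (\<Sum>j\<in>UNIV. of_nat (cf m j) * monom_at a (m - Poly_Mapping.single j 1) * y $ j) \<in> J" for m
    unfolding monom_at_deriv unfolding monom_at_def
    using assms(4-6) power_taylor[OF J assms(4) assms(5) assms(6)] unfolding x
    by (intro prod_taylor[OF J])
      (auto intro!: subring_power[OF A] subring_mult[OF A] subring_add[OF A] on)
  have "poly_at \<iota> x p - poly_at \<iota> a p - (\<Sum>j\<in>UNIV. poly_at \<iota> a (mp_deriv j p) * y $ j)
    = (\<Sum>m\<in>supp p. \<iota> (cf p m) * (monom_at x m - monom_at a m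
      - (\<Sum>j\<in>UNIV. of_nat (cf m j) * monom_at a (m - Poly_Mapping.single j 1) * y $ j)))"
    unfolding poly_at_mp_deriv unfolding poly_at_def sum_distrib_right
    by (subst sum.swap)
      (simp add: right_diff_distrib sum_subtractf sum_distrib_left mult.assoc)
  also have "\<dots> \<in> J"
    using assms(2) by (intro ideal_in_sum[OF J] ideal_in_mult[OF J] mon) auto
  finally show ?thesis .
qed

lemma euler_form:
  fixes a :: "'e ^ 'n::finite"
  assumes "form d p"
  shows "(\<Sum>j\<in>UNIV. a $ j * poly_at \<iota> a (mp_deriv j p)) = of_nat d * poly_at \<iota> a p"
proof -
  have *: "(\<Sum>j\<in>UNIV. a $ j * (of_nat (cf m j) * monom_at a (m - Poly_Mapping.single j 1))) =
      of_nat (\<Sum>j\<in>UNIV. cf m j) * monom_at a m" for m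
    unfolding of_nat_sum sum_distrib_right
  proof (rule sum.cong)
    fix j
    have 1: "a $ j * (of_nat (cf m j) * (a $ j ^ (cf m j - 1) * w)) =
        of_nat (cf m j) * (a $ j ^ cf m j * w)" for w
      by (cases "cf m j") (simp_all add: ac_simps)
    have 2: "monom_at a m = a $ j ^ cf m j * (\<Prod>i\<in>UNIV - {j}. a $ i ^ cf m i)"
      unfolding monom_at_def by (rule prod.remove) simp_all
    show "a $ j * (of_nat (cf m j) * monom_at a (m - Poly_Mapping.single j 1)) =
        of_nat (cf m j) * monom_at a m"
      unfolding monom_at_deriv 2 mult.assoc by (rule 1)
  qed simp
  have "(\<Sum>j\<in>UNIV. a $ j * poly_at \<iota> a (mp_deriv j p)) =
      (\<Sum>m\<in>supp p. \<iota> (cf p m) *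
        (\<Sum>j\<in>UNIV. a $ j * (of_nat (cf m j) * monom_at a (m - Poly_Mapping.single j 1))))"
  proof -
    have "(\<Sum>j\<in>UNIV. a $ j * poly_at \<iota> a (mp_deriv j p)) =
        (\<Sum>j\<in>UNIV. \<Sum>m\<in>supp p. \<iota> (cf p m) *
          (a $ j * (of_nat (cf m j) * monom_at a (m - Poly_Mapping.single j 1))))"
      unfolding poly_at_mp_deriv sum_distrib_left
      by (rule sum.cong[OF refl], rule sum.cong[OF refl], rule mult.left_commute)
    then show ?thesis by (subst (asm) sum.swap) (simp only: sum_distrib_left)
  qed
  also have "\<dots> = (\<Sum>m\<in>supp p. \<iota> (cf p m) * (of_nat d * monom_at a m))"
    unfolding * by (rule sum.cong) (use assms in \<open>auto simp: form_def simp del: of_nat_sum\<close>)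
  finally show ?thesis by (simp add: poly_at_def sum_distrib_left ac_simps)
qed

end

section \<open>Pole orders on a vector space of functions\<close>

text \<open>
  All that the combinatorial argument has to know about functions with poles at finitely many rational
  points: a vector space \<open>R\<close> over a finite field and valuations \<open>v i\<close> with residue field equal to that
  field. A value \<open>v i 0\<close> has no meaning, whence the conditions \<open>f \<noteq> 0\<close>. The last assumption is the one
  global input; it says that a nonzero function cannot have a zero at each of the points.
\<close>

locale pole_order_space = field_embedding \<iota> for \<iota> :: "'a::{field,finite} \<Rightarrow> 'e::field" +
  fixes R :: "'e set" and v :: "'m::finite \<Rightarrow> 'e \<Rightarrow> int"
  assumes R_diff: "f \<in> R \<Longrightarrow> g \<in> R \<Longrightarrow> f - g \<in> R"
    and R_scale: "f \<in> R \<Longrightarrow> \<iota> c * f \<in> R"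
    and v_add: "f \<in> R \<Longrightarrow> g \<in> R \<Longrightarrow> f \<noteq> 0 \<Longrightarrow> g \<noteq> 0 \<Longrightarrow> f + g \<noteq> 0 \<Longrightarrow>
      min (v i f) (v i g) \<le> v i (f + g)"
    and v_scale: "f \<in> R \<Longrightarrow> f \<noteq> 0 \<Longrightarrow> c \<noteq> 0 \<Longrightarrow> v i (\<iota> c * f) = v i f"
    and residue: "f \<in> R \<Longrightarrow> g \<in> R \<Longrightarrow> f \<noteq> 0 \<Longrightarrow> g \<noteq> 0 \<Longrightarrow> v i f = v i g \<Longrightarrow>
      \<exists>c. c \<noteq> 0 \<and> (f - \<iota> c * g = 0 \<or> v i f < v i (f - \<iota> c * g))"
    and no_common_zero: "f \<in> R \<Longrightarrow> \<forall>i. 1 \<le> v i f \<Longrightarrow> f = 0"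
begin

definition poles :: "'e \<Rightarrow> int ^ 'm" where
  "poles f = (\<chi> i. - v i f)"

lemma poles_nth [simp]: "poles f $ i = - v i f"
  by (simp add: poles_def)

definition H :: "(int ^ 'm) set" where
  "H = poles ` (R - {0})"

lemma v_minus: "f \<in> R \<Longrightarrow> f \<noteq> 0 \<Longrightarrow> v i (- f) = v i f"
  using v_scale[of f "-1" i] by (simp add: emb_minus)

lemma R_minus: "f \<in> R \<Longrightarrow> - f \<in> R"
  using R_scale[of f "-1"] by (simp add: emb_minus)

lemma R_add: "f \<in> R \<Longrightarrow> g \<in> R \<Longrightarrow> f + g \<in> R"
  using R_diff[of f "- g"] R_minus[of g] by simp

lemma v_add_eq:
  assumes "f \<in> R" "g \<in> R" "f \<noteq> 0" "g \<noteq> 0" "v i f < v i g"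
  shows "f + g \<noteq> 0" "v i (f + g) = v i f"
proof -
  show nz: "f + g \<noteq> 0"
  proof
    assume "f + g = 0"
    then have "f = - g" by (simp add: eq_neg_iff_add_eq_0)
    then show False using assms v_minus[of g i] by simp
  qed
  have "min (v i (f + g)) (v i (- g)) \<le> v i ((f + g) + - g)"
    using assms nz by (intro v_add) (auto intro: R_add R_minus)
  then show "v i (f + g) = v i f"
    using assms nz v_minus[of g i] v_add[of f g i] by (simp add: min_def split: if_splits)
qed

lemma v_comb_eq:
  assumes "f \<in> R" "g \<in> R" "f \<noteq> 0" "g \<noteq> 0"
  shows "v i f < v i g \<Longrightarrow> f - \<iota> c * g \<noteq> 0 \<and> v i (f - \<iota> c * g) = v i f"
    and "v i g < v i f \<Longrightarrow> c \<noteq> 0 \<Longrightarrow> f - \<iota> c * g \<noteq> 0 \<and> v i (f - \<iota> c * g) = v i g"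
proof -
  assume *: "v i f < v i g"
  show "f - \<iota> c * g \<noteq> 0 \<and> v i (f - \<iota> c * g) = v i f"
  proof (cases "c = 0")
    case False
    then show ?thesis
      using * assms v_add_eq[of f "\<iota> (- c) * g" i] v_scale[of g "- c" i] R_scale[of g "- c"]
      by (simp add: emb_minus)
  qed (use assms in simp)
next
  assume *: "v i g < v i f" and c: "c \<noteq> 0"
  then show "f - \<iota> c * g \<noteq> 0 \<and> v i (f - \<iota> c * g) = v i g"
    using * assms v_add_eq[of "\<iota> (- c) * g" f i] v_scale[of g "- c" i] R_scale[of g "- c"]
    by (simp add: emb_minus)
qed

lemma v_comb_ge:
  assumes "f \<in> R" "g \<in> R" "f \<noteq> 0 \<Longrightarrow> k \<le> v i f" "g \<noteq> 0 \<Longrightarrow> k \<le> v i g" "f - \<iota> c * g \<noteq> 0"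
  shows "k \<le> v i (f - \<iota> c * g)"
proof (cases "f = 0 \<or> g = 0 \<or> c = 0")
  case True
  then show ?thesis
    using assms v_scale[of g "- c" i] by (auto simp: emb_minus)
next
  case False
  then show ?thesis
    using assms v_add[of f "\<iota> (- c) * g" i] v_scale[of g "- c" i] R_scale[of g "- c"]
    by (simp add: emb_minus min_def split: if_splits)
qed

text \<open>
  The pole order of \<open>f - \<iota> c * g\<close> at the point \<open>j\<close> is the larger one of those of \<open>f\<close> and \<open>g\<close> unless \<open>c\<close>
  is one particular value: \<open>0\<close> if \<open>g\<close> has the larger pole, and the quotient of the leading coefficients
  if the poles agree. If \<open>f\<close> has the larger pole, every \<open>c\<close> is good. So either \<open>\<beta>\<close> dominates \<open>\<alpha>\<close>, or at
  most \<open>CARD('m) - 1\<close> values of \<open>c\<close> have to be avoided.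
\<close>

lemma H_max:
  assumes card: "CARD('m) \<le> CARD('a)" and "\<alpha> \<in> H" "\<beta> \<in> H"
  shows "(\<chi> j. max (\<alpha> $ j) (\<beta> $ j)) \<in> H"
proof -
  obtain f g where f: "f \<in> R" "f \<noteq> 0" "\<alpha> = poles f" and g: "g \<in> R" "g \<noteq> 0" "\<beta> = poles g"
    using assms(2,3) by (auto simp: H_def)
  show ?thesis
  proof (cases "\<exists>j. v j f < v j g")
    case False
    then have "(\<chi> j. max (\<alpha> $ j) (\<beta> $ j)) = \<beta>"
      using f g by (auto simp: vec_eq_iff not_less max_def)
    then show ?thesis using assms(3) by simp
  next
    case True
    then obtain j0 where j0: "v j0 f < v j0 g" by blast
    have "\<exists>b. \<forall>c. c \<noteq> b \<longrightarrow> f - \<iota> c * g \<noteq> 0 \<and> v j (f - \<iota> c * g) = min (v j f) (v j g)" for j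
    proof (cases "v j f" "v j g" rule: linorder_cases)
      case less
      then show ?thesis using v_comb_eq(1)[OF f(1) g(1) f(2) g(2)] by simp
    next
      case greater
      then show ?thesis
        using v_comb_eq(2)[OF f(1) g(1) f(2) g(2)] by (intro exI[of _ 0]) simp
    next
      case equal
      then obtain b where b: "b \<noteq> 0" "f - \<iota> b * g = 0 \<or> v j f < v j (f - \<iota> b * g)"
        using residue f g by blast
      have "f - \<iota> c * g \<noteq> 0 \<and> v j (f - \<iota> c * g) = v j g" if "c \<noteq> b" for c
      proof -
        have eq: "f - \<iota> c * g = (f - \<iota> b * g) - \<iota> (c - b) * g"
          by (simp add: emb_diff algebra_simps)
        show ?thesis
        proof (cases "f - \<iota> b * g = 0")
          case True
          then show ?thesis
            using that g v_scale[of g "b - c" j] unfolding eq by (simp add: emb_diff algebra_simps)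
        next
          case False
          then show ?thesis
            unfolding eq using that f g b equal by (intro v_comb_eq(2)) (auto intro: R_diff R_scale)
        qed
      qed
      then show ?thesis using equal by auto
    qed
    \<comment> \<open>\<open>b j\<close> is the exceptional value at the point \<open>j\<close>; any value serves where there is none.\<close>
    then obtain b where b: "\<And>j c. c \<noteq> b j \<Longrightarrow>
        f - \<iota> c * g \<noteq> 0 \<and> v j (f - \<iota> c * g) = min (v j f) (v j g)"
      by metis
    have "card (b ` (UNIV - {j0})) < CARD('a)"
    proof -
      have "card (b ` (UNIV - {j0})) \<le> card (UNIV - {j0})" by (rule card_image_le) simp
      also have "\<dots> < CARD('m)" by (rule psubset_card_mono) auto
      finally show ?thesis using card by simp
    qed
    then have "b ` (UNIV - {j0}) \<noteq> UNIV" by (metis less_irrefl)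
    then obtain c where c: "c \<notin> b ` (UNIV - {j0})" by blast
    have "f - \<iota> c * g \<noteq> 0 \<and> v j (f - \<iota> c * g) = min (v j f) (v j g)" for j
    proof (cases "j = j0")
      case True
      then show ?thesis using v_comb_eq(1)[OF f(1) g(1) f(2) g(2) j0] j0 by simp
    next
      case False
      then show ?thesis using b[of c j] c by blast
    qed
    then have "(\<chi> j. max (\<alpha> $ j) (\<beta> $ j)) = poles (f - \<iota> c * g)" and "f - \<iota> c * g \<noteq> 0"
      using f g by (auto simp: vec_eq_iff)
    moreover have "f - \<iota> c * g \<in> R" using f g by (intro R_diff R_scale)
    ultimately show ?thesis unfolding H_def by (metis Diff_iff empty_iff image_eqI insert_iff)
  qed
qed

lemma lub_in_H:
  fixes \<beta> :: "'s::finite \<Rightarrow> int ^ 'm"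
  assumes card: "CARD('m) \<le> CARD('a)" and \<beta>: "\<And>k. \<beta> k \<in> H"
  shows "lub \<beta> \<in> H"
proof -
  have "(\<chi> j. Max ((\<lambda>k. \<beta> k $ j) ` K)) \<in> H" if "finite K" "K \<noteq> {}" for K
    using that
  proof (induction K rule: finite_ne_induct)
    case (singleton k)
    then show ?case using \<beta>[of k] by (simp add: vec_lambda_eta)
  next
    case (insert k K)
    then show ?case using H_max[OF card \<beta>[of k] insert.IH] by simp
  qed
  from this[of UNIV] show ?thesis by (simp add: lub_def)
qed

text \<open>
  The counterpart of a Riemann-Roch space: poles bounded by \<open>\<alpha>\<close>.
\<close>

definition L :: "int ^ 'm \<Rightarrow> 'e set" where
  "L \<alpha> = {f \<in> R. f \<noteq> 0 \<longrightarrow> (\<forall>i. poles f $ i \<le> \<alpha> $ i)}"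

text \<open>
  Lowering the bound at one point by \<open>1\<close> costs at most a factor \<open>CARD('a)\<close> in the number of functions:
  all functions attaining the old bound there agree up to a scalar, modulo functions satisfying the new
  bound. Once all bounds are negative, only the zero function is left.
\<close>

lemma finite_L: "finite (L \<alpha>)"
proof (induction "\<Sum>i\<in>UNIV. nat (\<alpha> $ i + 1)" arbitrary: \<alpha> rule: less_induct)
  case less
  show ?case
  proof (cases "\<exists>i. 0 \<le> \<alpha> $ i")
    case False
    have "f = 0" if f: "f \<in> L \<alpha>" for f
    proof (rule ccontr)
      assume "f \<noteq> 0"
      then have "1 \<le> v i f" for i
        using f False by (auto simp: L_def not_le dest!: spec[of _ i])
      then show False using no_common_zero f \<open>f \<noteq> 0\<close> by (simp add: L_def)
    qed
    then have "L \<alpha> \<subseteq> {0}" by blast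
    then show ?thesis using finite_subset by blast
  next
    case True
    then obtain i where i: "0 \<le> \<alpha> $ i" by blast
    define \<alpha>' where "\<alpha>' = (\<chi> k. if k = i then \<alpha> $ k - 1 else \<alpha> $ k)"
    have "(\<Sum>k\<in>UNIV. nat (\<alpha>' $ k + 1)) < (\<Sum>k\<in>UNIV. nat (\<alpha> $ k + 1))"
      by (rule sum_strict_mono_ex1) (use i in \<open>auto simp: \<alpha>'_def intro!: exI[of _ i]\<close>)
    then have fin: "finite (L \<alpha>')" by (rule less)
    show ?thesis
    proof (cases "L \<alpha> \<subseteq> L \<alpha>'")
      case True
      then show ?thesis using fin finite_subset by blast
    next
      case False
      then obtain g where g: "g \<in> L \<alpha>" "g \<notin> L \<alpha>'" by blast
      have top: "f \<noteq> 0 \<and> - v i f = \<alpha> $ i" if fL: "f \<in> L \<alpha>" "f \<notin> L \<alpha>'" for f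
      proof -
        have "f \<noteq> 0" using that by (auto simp: L_def)
        obtain k where k: "\<not> poles f $ k \<le> \<alpha>' $ k" using fL unfolding L_def by blast
        moreover have "poles f $ k \<le> \<alpha> $ k" using that \<open>f \<noteq> 0\<close> by (auto simp: L_def)
        ultimately have "k = i" by (auto simp: \<alpha>'_def split: if_splits)
        with k \<open>poles f $ k \<le> \<alpha> $ k\<close> \<open>f \<noteq> 0\<close> show ?thesis by (auto simp: \<alpha>'_def)
      qed
      have "f \<in> (\<lambda>(c, h). h + \<iota> c * g) ` (UNIV \<times> L \<alpha>')" if f: "f \<in> L \<alpha>" for f
      proof (cases "f \<in> L \<alpha>'")
        case True
        then show ?thesis by (intro image_eqI[of _ _ "(0, f)"]) auto
      next
        case False
        have R: "f \<in> R" "g \<in> R" using f g by (auto simp: L_def)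
        then obtain c where c: "c \<noteq> 0" "f - \<iota> c * g = 0 \<or> v i f < v i (f - \<iota> c * g)"
          using residue[of f g i] top[OF f False] top[OF g] by auto
        have "- \<alpha> $ k \<le> v k (f - \<iota> c * g)" if "f - \<iota> c * g \<noteq> 0" for k
        proof (rule v_comb_ge[OF R _ _ that])
          show "- \<alpha> $ k \<le> v k f" if "f \<noteq> 0"
            using f that unfolding L_def by (simp add: minus_le_iff)
          show "- \<alpha> $ k \<le> v k g" if "g \<noteq> 0"
            using g that unfolding L_def by (simp add: minus_le_iff)
        qed
        note bound = this
        have "poles (f - \<iota> c * g) $ k \<le> \<alpha>' $ k" if "f - \<iota> c * g \<noteq> 0" for k
          using c(2) top[OF f False] bound[OF that, of k] that by (simp add: \<alpha>'_def)
        then have "f - \<iota> c * g \<in> L \<alpha>'"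
          using R by (auto simp: L_def R_diff R_scale simp del: poles_nth)
        then show ?thesis by (intro image_eqI[of _ _ "(c, f - \<iota> c * g)"]) auto
      qed
      then have "L \<alpha> \<subseteq> (\<lambda>(c, h). h + \<iota> c * g) ` (UNIV \<times> L \<alpha>')" by blast
      then show ?thesis by (rule finite_subset) (use fin in simp)
    qed
  qed
qed

definition maximal :: "int ^ 'm \<Rightarrow> bool" where
  "maximal \<beta> \<longleftrightarrow> \<beta> \<in> H \<and> (\<forall>J. J \<noteq> {} \<and> J \<subset> UNIV \<longrightarrow>
    (\<nexists>\<gamma>. \<gamma> \<in> H \<and> (\<forall>j\<in>J. \<gamma> $ j = \<beta> $ j) \<and> (\<forall>k\<in>UNIV - J. \<gamma> $ k < \<beta> $ k)))"

text \<open>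
  Any element \<open>\<beta>\<close> of the finite set \<open>T\<close> with minimal coordinate sum will do. An element \<open>\<gamma>\<close> of
  \<open>\<nabla>\<^sub>J(\<beta>)\<close> with \<open>i \<in> J\<close> lies in \<open>T\<close> and has a smaller sum. If \<open>i \<notin> J\<close>, cancelling the leading
  coefficient at a point \<open>j \<in> J\<close> lowers the \<open>j\<close>-th pole order, raises none, and preserves the \<open>i\<close>-th
  one, because there the subtracted function has the smaller pole.
\<close>

lemma maximal_below:
  assumes "\<alpha> \<in> H"
  shows "\<exists>\<beta>. maximal \<beta> \<and> (\<forall>j. \<beta> $ j \<le> \<alpha> $ j) \<and> \<beta> $ i = \<alpha> $ i"
proof -
  define T where "T = {\<beta> \<in> H. (\<forall>j. \<beta> $ j \<le> \<alpha> $ j) \<and> \<beta> $ i = \<alpha> $ i}"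
  have "T \<subseteq> poles ` L \<alpha>" by (auto simp: T_def H_def L_def)
  then have "finite T" using finite_L finite_surj by blast
  moreover have "\<alpha> \<in> T" using assms by (simp add: T_def)
  ultimately obtain \<beta> where \<beta>: "\<beta> \<in> T"
    and min: "\<And>\<gamma>. \<gamma> \<in> T \<Longrightarrow> (\<Sum>j\<in>UNIV. \<beta> $ j) \<le> (\<Sum>j\<in>UNIV. \<gamma> $ j)"
    using arg_min_if_finite[of T "\<lambda>\<gamma>. \<Sum>j\<in>UNIV. \<gamma> $ j"] by (metis empty_iff not_less)
  have no: False if "\<gamma> \<in> H" "\<gamma> $ i = \<beta> $ i" "\<And>j. \<gamma> $ j \<le> \<beta> $ j" "\<gamma> $ k < \<beta> $ k" for \<gamma> k
  proof -
    have "\<gamma> \<in> T" using that \<beta> by (auto simp: T_def intro: order_trans)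
    moreover have "(\<Sum>j\<in>UNIV. \<gamma> $ j) < (\<Sum>j\<in>UNIV. \<beta> $ j)"
      by (rule sum_strict_mono_ex1) (use that in auto)
    ultimately show False using min by force
  qed
  have "maximal \<beta>"
    unfolding maximal_def
  proof (intro conjI allI impI notI)
    show "\<beta> \<in> H" using \<beta> by (simp add: T_def)
    fix J :: "'m set" assume J: "J \<noteq> {} \<and> J \<subset> UNIV"
      and "\<exists>\<gamma>. \<gamma> \<in> H \<and> (\<forall>j\<in>J. \<gamma> $ j = \<beta> $ j) \<and> (\<forall>k\<in>UNIV - J. \<gamma> $ k < \<beta> $ k)"
    then obtain \<gamma> where \<gamma>: "\<gamma> \<in> H" "\<And>j. j \<in> J \<Longrightarrow> \<gamma> $ j = \<beta> $ j" "\<And>k. k \<notin> J \<Longrightarrow> \<gamma> $ k < \<beta> $ k"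
      by blast
    have le: "\<gamma> $ k \<le> \<beta> $ k" for k using \<gamma>(2,3)[of k] by (cases "k \<in> J") auto
    show False
    proof (cases "i \<in> J")
      case True
      obtain k where "k \<notin> J" using J by blast
      then show False using no[of \<gamma> k] \<gamma> True le by blast
    next
      case False
      obtain j where j: "j \<in> J" using J by blast
      obtain f g where f: "f \<in> R" "f \<noteq> 0" "\<beta> = poles f" and g: "g \<in> R" "g \<noteq> 0" "\<gamma> = poles g"
        using \<gamma>(1) \<open>\<beta> \<in> H\<close> by (auto simp: H_def)
      have "v j f = v j g" using \<gamma>(2)[OF j] f g by simp
      then obtain c where c: "c \<noteq> 0" "f - \<iota> c * g = 0 \<or> v j f < v j (f - \<iota> c * g)"
        using residue f g by blast
      have i: "f - \<iota> c * g \<noteq> 0 \<and> v i (f - \<iota> c * g) = v i f"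
        using v_comb_eq(1)[OF f(1) g(1) f(2) g(2), of i] \<gamma>(3)[OF False] f g by simp
      have ge: "v k f \<le> v k (f - \<iota> c * g)" for k
        by (rule v_comb_ge) (use f g i le[of k] in auto)
      have "poles (f - \<iota> c * g) \<in> H"
        unfolding H_def using f(1) g(1) i by (intro imageI DiffI R_diff R_scale) auto
      then show False
        by (rule no[of _ j]) (use i ge c f in auto)
    qed
  qed
  then show ?thesis using \<beta> by (auto simp: T_def)
qed

theorem H_eq_lubs:
  assumes card: "CARD('m) \<le> CARD('a)"
  shows "H = {lub \<beta> | \<beta> :: 'm \<Rightarrow> int ^ 'm. \<forall>k. maximal (\<beta> k)}"
proof (intro equalityI subsetI)
  fix \<alpha> assume "\<alpha> \<in> H"
  have "\<forall>i. \<exists>\<beta>. maximal \<beta> \<and> (\<forall>j. \<beta> $ j \<le> \<alpha> $ j) \<and> \<beta> $ i = \<alpha> $ i"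
    using maximal_below[OF \<open>\<alpha> \<in> H\<close>] by blast
  from choice[OF this] obtain \<beta>
    where \<beta>: "\<forall>i. maximal (\<beta> i) \<and> (\<forall>j. \<beta> i $ j \<le> \<alpha> $ j) \<and> \<beta> i $ i = \<alpha> $ i" ..
  have "Max (range (\<lambda>k. \<beta> k $ j)) = \<alpha> $ j" for j
    by (rule Max_eqI) (use \<beta> in \<open>auto intro!: range_eqI[of _ _ j]\<close>)
  then have "\<alpha> = lub \<beta>" by (simp add: lub_def vec_eq_iff)
  then show "\<alpha> \<in> {lub \<beta> | \<beta> :: 'm \<Rightarrow> int ^ 'm. \<forall>k. maximal (\<beta> k)}" using \<beta> by blast
next
  fix \<alpha> assume "\<alpha> \<in> {lub \<beta> | \<beta> :: 'm \<Rightarrow> int ^ 'm. \<forall>k. maximal (\<beta> k)}"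
  then show "\<alpha> \<in> H" using lub_in_H[OF card] by (auto simp: maximal_def)
qed

end

section \<open>Algebraic dependence over a finite field\<close>

context field_embedding
begin

text \<open>
  The span of the family \<open>b i\<close>, \<open>i \<in> S\<close>, over the image of the base field. Its cardinality is what the
  counting argument below estimates.
\<close>

definition lin :: "('i \<Rightarrow> 'e) \<Rightarrow> 'i set \<Rightarrow> 'e set" where
  "lin b S = {\<Sum>i\<in>S. \<iota> (c i) * b i | c. True}"

lemma linI: "(\<Sum>i\<in>S. \<iota> (c i) * b i) \<in> lin b S"
  by (auto simp: lin_def)

lemma lin_add: "x \<in> lin b S \<Longrightarrow> y \<in> lin b S \<Longrightarrow> x + y \<in> lin b S"
proof -
  assume "x \<in> lin b S" "y \<in> lin b S"
  then obtain c d where "x = (\<Sum>i\<in>S. \<iota> (c i) * b i)" "y = (\<Sum>i\<in>S. \<iota> (d i) * b i)"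
    by (auto simp: lin_def)
  then have "x + y = (\<Sum>i\<in>S. \<iota> (c i + d i) * b i)"
    by (simp add: emb_add distrib_right sum.distrib)
  then show ?thesis using linI by metis
qed

lemma lin_scale: "x \<in> lin b S \<Longrightarrow> \<iota> a * x \<in> lin b S"
proof -
  assume "x \<in> lin b S"
  then obtain c where "x = (\<Sum>i\<in>S. \<iota> (c i) * b i)" by (auto simp: lin_def)
  then have "\<iota> a * x = (\<Sum>i\<in>S. \<iota> (a * c i) * b i)"
    by (simp add: emb_mult sum_distrib_left mult.assoc)
  then show ?thesis using linI by metis
qed

lemma lin_zero: "0 \<in> lin b S"
  using linI[of "\<lambda>_. 0" b S] by simp

lemma lin_minus: "x \<in> lin b S \<Longrightarrow> - x \<in> lin b S"
  using lin_scale[of x b S "-1"] by (simp add: emb_minus)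

lemma lin_sum: "(\<And>i. i \<in> S \<Longrightarrow> f i \<in> lin b T) \<Longrightarrow> (\<Sum>i\<in>S. f i) \<in> lin b T"
  by (induction S rule: infinite_finite_induct) (simp_all add: lin_zero lin_add)

lemma lin_base: "finite S \<Longrightarrow> i \<in> S \<Longrightarrow> b i \<in> lin b S"
proof -
  assume "finite S" "i \<in> S"
  then have "(\<Sum>j\<in>S. \<iota> (if j = i then 1 else 0) * b j) = b i"
    by (simp add: if_distrib[of \<iota>] if_distrib[of "\<lambda>x. x * _"] cong: if_cong)
  then show ?thesis using linI[of "\<lambda>j. if j = i then 1 else 0" b S] by simp
qed

lemma lin_mult:
  assumes "x \<in> lin b S" "y \<in> lin b' S'"
    and "\<And>i j. i \<in> S \<Longrightarrow> j \<in> S' \<Longrightarrow> b i * b' j \<in> lin b'' S''"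
  shows "x * y \<in> lin b'' S''"
proof -
  obtain c d where "x = (\<Sum>i\<in>S. \<iota> (c i) * b i)" "y = (\<Sum>i\<in>S'. \<iota> (d i) * b' i)"
    using assms(1,2) by (auto simp: lin_def)
  then have "x * y = (\<Sum>i\<in>S. \<Sum>j\<in>S'. \<iota> (c i) * (\<iota> (d j) * (b i * b' j)))"
    by (simp add: sum_product ac_simps)
  also have "\<dots> \<in> lin b'' S''"
    using assms(3) by (intro lin_sum lin_scale)
  finally show ?thesis .
qed

lemma lin_mult_left:
  assumes "x \<in> lin b S" and "\<And>i. i \<in> S \<Longrightarrow> t * b i \<in> lin b'' S''"
  shows "t * x \<in> lin b'' S''"
proof -
  obtain c where "x = (\<Sum>i\<in>S. \<iota> (c i) * b i)" using assms(1) by (auto simp: lin_def)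
  then have "t * x = (\<Sum>i\<in>S. \<iota> (c i) * (t * b i))"
    by (simp add: sum_distrib_left ac_simps)
  also have "\<dots> \<in> lin b'' S''" using assms(2) by (intro lin_sum lin_scale)
  finally show ?thesis .
qed

lemma card_lin:
  assumes "finite S" "finite (UNIV :: 'a set)"
  shows "finite (lin b S)" "card (lin b S) \<le> CARD('a) ^ card S"
proof -
  have sub: "lin b S \<subseteq> (\<lambda>c. \<Sum>i\<in>S. \<iota> (c i) * b i) ` (S \<rightarrow>\<^sub>E UNIV)"
  proof
    fix x assume "x \<in> lin b S"
    then obtain c where c: "x = (\<Sum>i\<in>S. \<iota> (c i) * b i)" by (auto simp: lin_def)
    show "x \<in> (\<lambda>c. \<Sum>i\<in>S. \<iota> (c i) * b i) ` (S \<rightarrow>\<^sub>E UNIV)"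
      by (rule image_eqI[of _ _ "restrict c S"]) (auto simp: c)
  qed
  have fin: "finite (S \<rightarrow>\<^sub>E (UNIV :: 'a set))"
    using assms by (intro finite_PiE) auto
  have "card (S \<rightarrow>\<^sub>E (UNIV :: 'a set)) = CARD('a) ^ card S"
    using assms by (simp add: card_funcsetE)
  then show "card (lin b S) \<le> CARD('a) ^ card S"
    using surj_card_le[OF fin sub] by simp
  show "finite (lin b S)" by (rule finite_surj[OF fin sub])
qed

text \<open>
  \<open>f\<close> is a zero of a nonzero polynomial with coefficients in the ring generated by \<open>s\<close>. The coefficients
  are polynomials in \<open>s\<close> whose degrees have the common bound \<open>e\<close>.
\<close>

definition algebraic_over_gen :: "'e \<Rightarrow> 'e \<Rightarrow> bool" where
  "algebraic_over_gen s f \<longleftrightarrow> (\<exists>r e a. (\<forall>i. a i \<in> lin (\<lambda>l. s ^ l) {..e}) \<and> a r \<noteq> 0 \<and>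
    (\<Sum>i\<le>r. a i * f ^ i) = 0)"

definition alg_dependent :: "'e \<Rightarrow> 'e \<Rightarrow> bool" where
  "alg_dependent f g \<longleftrightarrow> (\<exists>c D i0 j0. i0 \<le> D \<and> j0 \<le> D \<and> c i0 j0 \<noteq> 0 \<and>
    (\<Sum>i\<le>D. \<Sum>j\<le>D. \<iota> (c i j) * (f ^ i * g ^ j)) = 0)"

text \<open>
  A special case of the exchange property of algebraic dependence, proved by counting. Let \<open>c\<close> be the
  product of the leading coefficients of the equations of \<open>f\<close> and \<open>g\<close> over the ring generated by \<open>s\<close>.
  Multiplication by \<open>c * f\<close> or \<open>c * g\<close> reduces the exponents of \<open>f\<close> and \<open>g\<close> below the degrees \<open>r1\<close> and
  \<open>r2\<close> of these equations, at the price of raising the degree in \<open>s\<close> by at most \<open>e\<close>. So all products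
  \<open>c ^ (2 * D) * f ^ i * g ^ j\<close> with \<open>i, j \<le> D\<close> lie in a space \<open>W\<close> whose dimension grows linearly in \<open>D\<close>,
  while their number grows quadratically. For large \<open>D\<close> two different combinations of them coincide by
  the pigeonhole principle.
\<close>

lemma alg_dependent_of_algebraic:
  assumes fin: "finite (UNIV :: 'a set)"
    and f: "algebraic_over_gen s f" and g: "algebraic_over_gen s g"
  shows "alg_dependent f g"
proof -
  obtain r1 e1 a1 where 1: "\<And>i. a1 i \<in> lin (\<lambda>l. s ^ l) {..e1}" "a1 r1 \<noteq> 0"
    "(\<Sum>i\<le>r1. a1 i * f ^ i) = 0"
    using f unfolding algebraic_over_gen_def by blast
  obtain r2 e2 a2 where 2: "\<And>i. a2 i \<in> lin (\<lambda>l. s ^ l) {..e2}" "a2 r2 \<noteq> 0"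
    "(\<Sum>i\<le>r2. a2 i * g ^ i) = 0"
    using g unfolding algebraic_over_gen_def by blast
  have r: "0 < r1" "0 < r2"
    using 1(2,3) 2(2,3) by (auto intro: gr0I)
  have top1: "a1 r1 * f ^ r1 = (\<Sum>i<r1. - (a1 i * f ^ i))"
    using 1(3) by (simp add: sum_negf eq_neg_iff_add_eq_0 add.commute flip: lessThan_Suc_atMost)
  have top2: "a2 r2 * g ^ r2 = (\<Sum>i<r2. - (a2 i * g ^ i))"
    using 2(3) by (simp add: sum_negf eq_neg_iff_add_eq_0 add.commute flip: lessThan_Suc_atMost)
  define I where "I k = {..k} \<times> {..<r1} \<times> {..<r2}" for k :: nat
  define b where "b = (\<lambda>(l, i, j). s ^ l * f ^ i * g ^ j)"
  define W where "W k = lin b (I k)" for k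
  have finI: "finite (I k)" for k by (simp add: I_def)
  have base: "s ^ l * f ^ i * g ^ j \<in> W k" if "l \<le> k" "i < r1" "j < r2" for l i j k
    using lin_base[OF finI, of "(l, i, j)" k b] that by (simp add: W_def I_def b_def)
  have poly: "u * w \<in> W (k + e)" if "u \<in> lin (\<lambda>l. s ^ l) {..e}" "w \<in> W k" for u w e k
    unfolding W_def
  proof (rule lin_mult[OF that(1) that(2)[unfolded W_def]])
    fix l p assume "l \<in> {..e}" "p \<in> I k"
    then obtain l' i j where p: "p = (l', i, j)" "l' \<le> k" "i < r1" "j < r2" and "l \<le> e"
      by (auto simp: I_def)
    have "s ^ l * b p = s ^ (l' + l) * f ^ i * g ^ j"
      by (simp add: p b_def power_add ac_simps)
    then show "s ^ l * b p \<in> lin b (I (k + e))"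
      using base[of "l' + l" "k + e" i j] p \<open>l \<le> e\<close> by (simp add: W_def)
  qed
  have F: "a1 r1 * f * w \<in> W (k + e1)" if "w \<in> W k" for w k
    unfolding W_def
  proof (rule lin_mult_left[OF that[unfolded W_def]])
    fix p assume "p \<in> I k"
    then obtain l i j where p: "p = (l, i, j)" "l \<le> k" "i < r1" "j < r2" by (auto simp: I_def)
    show "a1 r1 * f * b p \<in> lin b (I (k + e1))"
    proof (cases "Suc i < r1")
      case True
      have eq: "a1 r1 * f * b p = a1 r1 * (s ^ l * f ^ Suc i * g ^ j)"
        by (simp add: p b_def ac_simps)
      show ?thesis
        unfolding eq W_def[symmetric] by (intro poly[OF 1(1)] base) (use p True in auto)
    next
      case False
      then have "Suc i = r1" using p by simp
      then have "a1 r1 * f * b p = a1 r1 * f ^ r1 * (s ^ l * g ^ j)"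
        by (auto simp: p b_def ac_simps)
      also have "\<dots> = (\<Sum>i<r1. - (a1 i * (s ^ l * f ^ i * g ^ j)))"
        unfolding top1 sum_distrib_right by (rule sum.cong) (simp_all add: ac_simps)
      also have "\<dots> \<in> W (k + e1)"
        unfolding W_def
        by (intro lin_sum lin_minus poly[OF 1(1), unfolded W_def] base[unfolded W_def]) (use p in auto)
      finally show ?thesis by (simp add: W_def)
    qed
  qed
  have G: "a2 r2 * g * w \<in> W (k + e2)" if "w \<in> W k" for w k
    unfolding W_def
  proof (rule lin_mult_left[OF that[unfolded W_def]])
    fix p assume "p \<in> I k"
    then obtain l i j where p: "p = (l, i, j)" "l \<le> k" "i < r1" "j < r2" by (auto simp: I_def)
    show "a2 r2 * g * b p \<in> lin b (I (k + e2))"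
    proof (cases "Suc j < r2")
      case True
      have eq: "a2 r2 * g * b p = a2 r2 * (s ^ l * f ^ i * g ^ Suc j)"
        by (simp add: p b_def ac_simps)
      show ?thesis
        unfolding eq W_def[symmetric] by (intro poly[OF 2(1)] base) (use p True in auto)
    next
      case False
      then have "Suc j = r2" using p by simp
      then have "a2 r2 * g * b p = a2 r2 * g ^ r2 * (s ^ l * f ^ i)"
        by (auto simp: p b_def ac_simps)
      also have "\<dots> = (\<Sum>j<r2. - (a2 j * (s ^ l * f ^ i * g ^ j)))"
        unfolding top2 sum_distrib_right by (rule sum.cong) (simp_all add: ac_simps)
      also have "\<dots> \<in> W (k + e2)"
        unfolding W_def
        by (intro lin_sum lin_minus poly[OF 2(1), unfolded W_def] base[unfolded W_def]) (use p in auto)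
      finally show ?thesis by (simp add: W_def)
    qed
  qed
  define c where "c = a1 r1 * a2 r2"
  define e where "e = e1 + e2"
  have c0: "c \<noteq> 0" using 1 2 by (simp add: c_def)
  have cw: "c * w \<in> W (k + e)" if "w \<in> W k" for w k
    using poly[OF 1(1) poly[OF 2(1) that]] by (simp add: c_def e_def ac_simps)
  have cf: "c * f * w \<in> W (k + e)" if "w \<in> W k" for w k
    using poly[OF 2(1) F[OF that]] by (simp add: c_def e_def ac_simps)
  have cg: "c * g * w \<in> W (k + e)" if "w \<in> W k" for w k
    using poly[OF 1(1) G[OF that]] by (simp add: c_def e_def ac_simps)
  have one: "1 \<in> W 0" using base[of 0 0 0 0] r by simp
  have pf: "c ^ i * f ^ i \<in> W (i * e)" for i
  proof (induction i)
    case (Suc i)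
    then show ?case using cf[OF Suc] by (simp add: ac_simps)
  qed (simp add: one)
  have pg: "c ^ (i + j) * (f ^ i * g ^ j) \<in> W ((i + j) * e)" for i j
  proof (induction j)
    case (Suc j)
    then show ?case using cg[OF Suc] by (simp add: ac_simps)
  qed (simp add: pf)
  have pc: "c ^ k * w \<in> W (n + k * e)" if "w \<in> W n" for w k n
  proof (induction k)
    case (Suc k)
    then show ?case using cw[OF Suc] by (simp add: ac_simps)
  qed (simp add: that)
  \<comment> \<open>Large enough that \<open>(D + 1)\<^sup>2\<close> exceeds \<open>(2 * D * e + 1) * r1 * r2\<close>, the number of generators of \<open>W (2 * D * e)\<close>.\<close>
  define D where "D = 2 * e * (r1 * r2) + r1 * r2"
  have all: "c ^ (2 * D) * (f ^ i * g ^ j) \<in> W (2 * D * e)" if "i \<le> D" "j \<le> D" for i j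
  proof -
    have "c ^ (2 * D) = c ^ (2 * D - (i + j)) * c ^ (i + j)"
      using that by (simp flip: power_add)
    moreover have "(i + j) * e + (2 * D - (i + j)) * e = 2 * D * e"
      using that by (simp flip: distrib_right)
    ultimately show ?thesis
      using pc[OF pg[of i j], of "2 * D - (i + j)"] by (simp add: mult.assoc)
  qed
  define S where "S = {..D} \<times> {..D}"
  define M where "M x = (\<Sum>(i, j)\<in>S. \<iota> (x (i, j)) * (c ^ (2 * D) * (f ^ i * g ^ j)))"
    for x :: "nat \<times> nat \<Rightarrow> 'a"
  have "M ` (S \<rightarrow>\<^sub>E UNIV) \<subseteq> W (2 * D * e)"
    unfolding M_def W_def
    by (auto intro!: lin_sum lin_scale all[unfolded W_def] simp: S_def)
  then have "card (M ` (S \<rightarrow>\<^sub>E UNIV)) \<le> card (W (2 * D * e))"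
    unfolding W_def by (rule card_mono[OF card_lin(1)[OF finI fin]])
  also have "\<dots> \<le> CARD('a) ^ card (I (2 * D * e))"
    unfolding W_def by (rule card_lin(2)[OF finI fin])
  also have "\<dots> < CARD('a) ^ card S"
  proof (rule power_strict_increasing)
    have "1 \<le> r1 * r2" using r by (simp add: Suc_le_eq)
    then have "1 \<le> D" unfolding D_def by linarith
    then have "1 * (r1 * r2) \<le> D * (r1 * r2)" by (rule mult_right_mono) simp
    then have "(2 * D * e + 1) * (r1 * r2) \<le> D * (2 * e * (r1 * r2) + r1 * r2)"
      by (simp add: algebra_simps)
    also have "\<dots> = D * D" by (simp add: D_def)
    also have "D * D < Suc D * Suc D" by simp
    finally show "card (I (2 * D * e)) < card S"
      by (simp add: I_def S_def card_cartesian_product)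
    have "card {0, 1 :: 'a} \<le> CARD('a)" using fin by (intro card_mono) auto
    then show "1 < CARD('a)" by simp
  qed
  also have "CARD('a) ^ card S = card (S \<rightarrow>\<^sub>E (UNIV :: 'a set))"
    by (simp add: card_funcsetE S_def)
  finally have "\<not> inj_on M (S \<rightarrow>\<^sub>E UNIV)"
    by (metis card_image less_irrefl)
  then obtain x y where xy: "x \<in> S \<rightarrow>\<^sub>E UNIV" "y \<in> S \<rightarrow>\<^sub>E UNIV" "x \<noteq> y" "M x = M y"
    by (auto simp: inj_on_def)
  then obtain i0 j0 where ij: "(i0, j0) \<in> S" "x (i0, j0) \<noteq> y (i0, j0)"
    by (metis PiE_ext surj_pair)
  define d where "d i j = x (i, j) - y (i, j)" for i j
  have "M x - M y = c ^ (2 * D) * (\<Sum>(i, j)\<in>S. \<iota> (d i j) * (f ^ i * g ^ j))"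
    unfolding M_def sum_distrib_left sum_subtractf[symmetric]
    by (rule sum.cong) (auto simp: d_def emb_diff algebra_simps)
  then have "(\<Sum>(i, j)\<in>S. \<iota> (d i j) * (f ^ i * g ^ j)) = 0" using xy(4) c0 by simp
  then have "(\<Sum>i\<le>D. \<Sum>j\<le>D. \<iota> (d i j) * (f ^ i * g ^ j)) = 0"
    by (simp add: S_def sum.cartesian_product)
  then show ?thesis
    unfolding alg_dependent_def using ij by (intro exI[of _ d] exI[of _ D] exI[of _ i0] exI[of _ j0])
      (auto simp: S_def d_def)
qed

end

section \<open>Discrete valuation rings inside a field\<close>

text \<open>
  A local ring \<open>A\<close> in a field whose maximal ideal \<open>M\<close> is generated by \<open>t\<close> and whose residue field is the
  base field. In place of a Noetherian hypothesis, every element of \<open>A\<close> is assumed to be algebraically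
  dependent on \<open>t\<close>; this is what keeps a nonzero element from being divisible by all powers of \<open>t\<close>.
\<close>

locale dvr = field_embedding \<iota> for \<iota> :: "'a::field \<Rightarrow> 'e::field" +
  fixes A M :: "'e set" and t :: 'e
  assumes sub: "subring_of A"
    and const: "\<iota> c \<in> A"
    and M_eq: "M = (\<lambda>x. t * x) ` A"
    and t_nz: "t \<noteq> 0"
    and t_in: "t \<in> A"
    and one_notin: "1 \<notin> M"
    and inverse_in: "x \<in> A \<Longrightarrow> x \<notin> M \<Longrightarrow> inverse x \<in> A"
    and residue_const: "x \<in> A \<Longrightarrow> \<exists>c. x - \<iota> c \<in> M"
    and dependent: "x \<in> A \<Longrightarrow> alg_dependent x t"
begin

definition is_unit :: "'e \<Rightarrow> bool" where
  "is_unit u \<longleftrightarrow> u \<in> A \<and> u \<notin> M"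

definition K :: "'e set" where
  "K = {x / y | x y. x \<in> A \<and> y \<in> A \<and> y \<noteq> 0}"

definition val :: "'e \<Rightarrow> int" where
  "val x = (THE k. \<exists>u. is_unit u \<and> x = t powi k * u)"

lemma M_iff: "x \<in> M \<longleftrightarrow> (\<exists>y\<in>A. x = t * y)"
  using M_eq by auto

lemma M_ideal: "ideal_in A M"
  unfolding ideal_in_def
proof (intro conjI ballI)
  show "M \<subseteq> A" using subring_mult[OF sub t_in] by (auto simp: M_eq)
  show "0 \<in> M" unfolding M_eq using subring_zero[OF sub] by (intro image_eqI[of _ _ 0]) auto
  show "u + v \<in> M" if uv: "u \<in> M" "v \<in> M" for u v
  proof -
    obtain x y where "u = t * x" "v = t * y" "x \<in> A" "y \<in> A" using uv by (auto simp: M_eq)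
    then show ?thesis
      unfolding M_eq by (intro image_eqI[of _ _ "x + y"]) (auto simp: distrib_left subring_add[OF sub])
  qed
  show "a * v \<in> M" if av: "a \<in> A" "v \<in> M" for a v
  proof -
    obtain y where "v = t * y" "y \<in> A" using av by (auto simp: M_eq)
    then show ?thesis
      unfolding M_eq using av
      by (intro image_eqI[of _ _ "a * y"]) (auto simp: subring_mult[OF sub])
  qed
qed (rule sub)

lemma const_notin: "c \<noteq> 0 \<Longrightarrow> \<iota> c \<notin> M"
proof
  assume "c \<noteq> 0" "\<iota> c \<in> M"
  then have "\<iota> (inverse c) * \<iota> c \<in> M" by (intro ideal_in_mult[OF M_ideal] const)
  then show False using one_notin \<open>c \<noteq> 0\<close> by (simp flip: emb_mult)
qed

lemma unit_const: "c \<noteq> 0 \<Longrightarrow> is_unit (\<iota> c)"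
  by (simp add: is_unit_def const const_notin)

lemma unit_nz: "is_unit u \<Longrightarrow> u \<noteq> 0"
  using ideal_in_zero[OF M_ideal] by (auto simp: is_unit_def)

lemma unit_inverse:
  assumes "is_unit u"
  shows "is_unit (inverse u)"
proof -
  have "u \<in> A" "inverse u \<in> A" using assms inverse_in by (auto simp: is_unit_def)
  moreover have "inverse u \<notin> M"
    using ideal_in_mult[OF M_ideal \<open>u \<in> A\<close>, of "inverse u"] one_notin unit_nz[OF assms] by auto
  ultimately show ?thesis by (simp add: is_unit_def)
qed

lemma unit_mult:
  assumes "is_unit u" "is_unit w"
  shows "is_unit (u * w)"
proof -
  have "u * w \<notin> M"
  proof
    assume "u * w \<in> M"
    then have "inverse u * (u * w) \<in> M"
      using unit_inverse[OF assms(1)] by (intro ideal_in_mult[OF M_ideal, of _ "u * w"])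
        (auto simp: is_unit_def)
    then show False using assms unit_nz[OF assms(1)] by (simp add: is_unit_def flip: mult.assoc)
  qed
  then show ?thesis using assms by (auto simp: is_unit_def subring_mult[OF sub])
qed

text \<open>
  A polynomial expression in \<open>z\<close> equals its lowest term up to a multiple of \<open>z\<close>.
\<close>

lemma factor_lowest_power:
  assumes z: "z \<in> A" and q: "\<And>i. q i \<in> A" and low: "\<And>i. i < i1 \<Longrightarrow> q i = 0" and "i1 \<le> D"
  shows "\<exists>w\<in>A. (\<Sum>i\<le>D. q i * z ^ i) = z ^ i1 * (q i1 + z * w)"
proof
  let ?w = "\<Sum>i\<in>{Suc i1..D}. q i * z ^ (i - Suc i1)"
  show "?w \<in> A" by (intro subring_sum[OF sub] subring_mult[OF sub] subring_power[OF sub] z q)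
  have "(\<Sum>i\<le>D. q i * z ^ i) = (\<Sum>i\<in>{i1..D}. q i * z ^ i)"
    by (rule sum.mono_neutral_right) (use low in auto)
  also have "\<dots> = q i1 * z ^ i1 + (\<Sum>i\<in>{Suc i1..D}. q i * z ^ i)"
    using \<open>i1 \<le> D\<close> by (rule sum.atLeast_Suc_atMost)
  also have "(\<Sum>i\<in>{Suc i1..D}. q i * z ^ i) = z ^ i1 * (z * ?w)"
    unfolding sum_distrib_left
  proof (rule sum.cong)
    fix i assume "i \<in> {Suc i1..D}"
    then have "z ^ i = z ^ i1 * (z * z ^ (i - Suc i1))"
      by (simp flip: power_add power_Suc)
    then show "q i * z ^ i = z ^ i1 * (z * (q i * z ^ (i - Suc i1)))" by (simp add: ac_simps)
  qed simp
  finally show "(\<Sum>i\<le>D. q i * z ^ i) = z ^ i1 * (q i1 + z * ?w)"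
    by (simp add: algebra_simps)
qed

text \<open>
  In a relation between \<open>x\<close> and \<open>t\<close>, take the lowest power \<open>x ^ i1\<close> that occurs, and in its coefficient
  the lowest power \<open>t ^ j1\<close>. Dividing by \<open>x ^ i1\<close> shows that \<open>t ^ j1\<close>, times a unit, is a multiple of
  \<open>x\<close>. If \<open>x\<close> is divisible by \<open>t ^ Suc j1\<close>, this makes a nonzero constant a multiple of \<open>t\<close>.
\<close>

lemma not_infinitely_divisible:
  assumes x: "x \<in> A" "x \<noteq> 0"
  shows "\<exists>k. \<forall>y\<in>A. x \<noteq> t ^ k * y"
proof (rule ccontr)
  assume "\<not> ?thesis"
  then have div: "\<And>k. \<exists>y\<in>A. x = t ^ k * y" by blast
  obtain c D i0 j0 where c: "i0 \<le> D" "j0 \<le> D" "c i0 j0 \<noteq> 0"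
    and rel: "(\<Sum>i\<le>D. \<Sum>j\<le>D. \<iota> (c i j) * (x ^ i * t ^ j)) = 0"
    using dependent[OF x(1)] unfolding alg_dependent_def by blast
  define P where "P i \<longleftrightarrow> (\<exists>j\<le>D. c i j \<noteq> 0)" for i
  define i1 where "i1 = (LEAST i. P i)"
  have "P i0" using c by (auto simp: P_def)
  then have i1: "P i1" "i1 \<le> i0" unfolding i1_def by (rule LeastI, rule Least_le)
  have low: "\<not> P i" if "i < i1" for i using that not_less_Least unfolding i1_def by blast
  define j1 where "j1 = (LEAST j. c i1 j \<noteq> 0)"
  obtain j where j: "j \<le> D" "c i1 j \<noteq> 0" using i1 by (auto simp: P_def)
  then have j1: "c i1 j1 \<noteq> 0" "j1 \<le> j" unfolding j1_def by (rule_tac LeastI, simp, rule_tac Least_le)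
  have lowj: "c i1 j = 0" if "j < j1" for j using that not_less_Least unfolding j1_def by blast
  define q where "q i = (\<Sum>j\<le>D. \<iota> (c i j) * t ^ j)" for i
  have qA: "q i \<in> A" for i
    unfolding q_def by (intro subring_sum[OF sub] subring_mult[OF sub] subring_power[OF sub] const t_in)
  have "(\<Sum>i\<le>D. q i * x ^ i) = 0"
    using rel by (simp add: q_def sum_distrib_left ac_simps)
  moreover obtain w where w: "w \<in> A" "(\<Sum>i\<le>D. q i * x ^ i) = x ^ i1 * (q i1 + x * w)"
  proof -
    have "q i = 0" if "i < i1" for i
      unfolding q_def by (rule sum.neutral) (use low[OF that] in \<open>auto simp: P_def\<close>)
    then show thesis
      using factor_lowest_power[OF x(1), of q i1 D] qA i1(2) c(1) that by auto
  qed
  ultimately have qx: "q i1 = - (x * w)"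
    using x(2) by (simp add: eq_neg_iff_add_eq_0)
  obtain w' where w': "w' \<in> A" "q i1 = t ^ j1 * (\<iota> (c i1 j1) + t * w')"
    using factor_lowest_power[OF t_in, of "\<lambda>j. \<iota> (c i1 j)" j1 D] const lowj j1(2) j(1)
    by (auto simp: q_def)
  obtain y where y: "y \<in> A" "x = t ^ Suc j1 * y" using div by blast
  have "t ^ j1 * (\<iota> (c i1 j1) + t * w') = t ^ j1 * (t * (- (y * w)))"
    using qx w' y by (simp add: ac_simps)
  then have "\<iota> (c i1 j1) + t * w' = t * (- (y * w))"
    using t_nz by (simp only: mult_cancel_left power_eq_0_iff) simp
  then have "\<iota> (c i1 j1) = t * (- (y * w) - w')" by (simp add: algebra_simps)
  moreover have "- (y * w) - w' \<in> A"
    using y w w' by (intro subring_diff[OF sub] subring_uminus[OF sub] subring_mult[OF sub])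
  ultimately have "\<iota> (c i1 j1) \<in> M" by (auto simp: M_eq)
  then show False using const_notin j1(1) by blast
qed

lemma decompose_nat:
  assumes x: "x \<in> A" "x \<noteq> 0"
  shows "\<exists>k u. is_unit u \<and> x = t ^ k * u"
proof -
  define k where "k = (LEAST k. \<forall>y\<in>A. x \<noteq> t ^ k * y)"
  have k: "\<forall>y\<in>A. x \<noteq> t ^ k * y"
    unfolding k_def using not_infinitely_divisible[OF x] by (rule LeastI_ex)
  have "k \<noteq> 0"
  proof
    assume "k = 0"
    then have "\<forall>y\<in>A. x \<noteq> y" using k by simp
    then show False using x(1) by blast
  qed
  then obtain l where l: "k = Suc l" by (cases k) auto
  then have "\<not> (\<forall>y\<in>A. x \<noteq> t ^ l * y)"
    using not_less_Least[of l "\<lambda>k. \<forall>y\<in>A. x \<noteq> t ^ k * y"] by (simp add: k_def)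
  then obtain u where u: "u \<in> A" "x = t ^ l * u" by blast
  have "u \<notin> M"
  proof
    assume "u \<in> M"
    then obtain y where "y \<in> A" "u = t * y" by (auto simp: M_eq)
    then show False using k u l by (auto simp: ac_simps)
  qed
  then show ?thesis using u unfolding is_unit_def by blast
qed

lemma decompose:
  assumes "x \<in> K" "x \<noteq> 0"
  shows "\<exists>k u. is_unit u \<and> x = t powi k * u"
proof -
  obtain y z where yz: "y \<in> A" "z \<in> A" "z \<noteq> 0" "x = y / z" "y \<noteq> 0"
    using assms by (auto simp: K_def)
  obtain k u where ku: "is_unit u" "y = t ^ k * u" using decompose_nat yz by blast
  obtain l w where lw: "is_unit w" "z = t ^ l * w" using decompose_nat yz by blast
  have "x = t powi (int k - int l) * (u * inverse w)"
    using yz ku lw t_nz by (simp add: power_int_diff field_simps)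
  then show ?thesis using unit_mult unit_inverse ku lw by blast
qed

lemma exponent_unique:
  assumes "is_unit u" "is_unit w" "t powi k * u = t powi l * w"
  shows "k = l"
proof -
  have no: False if "k < l" "is_unit u" "is_unit w" "t powi k * u = t powi l * w" for k l u w
  proof -
    have "l = k + int (Suc (nat (l - k - 1)))" using that(1) by simp
    then have "t powi l = t powi k * t ^ Suc (nat (l - k - 1))"
      using t_nz by (metis power_int_add power_int_of_nat)
    then have "t powi k * u = t powi k * (t * (t ^ nat (l - k - 1) * w))"
      using that(4) by (simp add: ac_simps)
    then have "u = t * (t ^ nat (l - k - 1) * w)" using t_nz by simp
    moreover have "t ^ nat (l - k - 1) * w \<in> A"
      using that(3) t_in by (auto simp: is_unit_def intro!: subring_mult[OF sub] subring_power[OF sub])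
    ultimately show False using that(2) unfolding is_unit_def M_iff by blast
  qed
  then show ?thesis using assms by (metis linorder_neqE)
qed

lemma val_eq: "is_unit u \<Longrightarrow> x = t powi k * u \<Longrightarrow> val x = k"
  unfolding val_def using exponent_unique by blast

lemma val_decompose:
  assumes "x \<in> K" "x \<noteq> 0"
  obtains u where "is_unit u" "x = t powi (val x) * u"
  using decompose[OF assms] val_eq by metis

lemma val_ge_iff:
  assumes "x \<in> K" "x \<noteq> 0"
  shows "k \<le> val x \<longleftrightarrow> (\<exists>y\<in>A. x = t powi k * y)"
proof
  assume "k \<le> val x"
  obtain u where u: "is_unit u" "x = t powi (val x) * u" by (rule val_decompose[OF assms])
  have "val x = k + int (nat (val x - k))" using \<open>k \<le> val x\<close> by simp
  then have "t powi val x = t powi k * t ^ nat (val x - k)"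
    using t_nz by (metis power_int_add power_int_of_nat)
  then have "x = t powi k * (t ^ nat (val x - k) * u)" using u by (simp add: ac_simps)
  moreover have "t ^ nat (val x - k) * u \<in> A"
    using u t_in by (auto simp: is_unit_def intro!: subring_mult[OF sub] subring_power[OF sub])
  ultimately show "\<exists>y\<in>A. x = t powi k * y" by blast
next
  assume "\<exists>y\<in>A. x = t powi k * y"
  then obtain y where y: "y \<in> A" "x = t powi k * y" by blast
  then obtain n u where u: "is_unit u" "y = t ^ n * u" using decompose_nat[of y] assms(2) by auto
  have "x = t powi (k + int n) * u" using y u t_nz by (simp add: power_int_add ac_simps)
  then have "val x = k + int n" using val_eq u(1) by blast
  then show "k \<le> val x" by simp
qed

lemma one_le_val: "x \<in> K \<Longrightarrow> x \<noteq> 0 \<Longrightarrow> 1 \<le> val x \<longleftrightarrow> x \<in> M"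
  using val_ge_iff[of x 1] by (simp add: M_iff)

lemma val_add:
  assumes "x \<in> K" "y \<in> K" "x + y \<in> K" "x \<noteq> 0" "y \<noteq> 0" "x + y \<noteq> 0"
  shows "min (val x) (val y) \<le> val (x + y)"
proof -
  define k where "k = min (val x) (val y)"
  have "k \<le> val x" "k \<le> val y" by (simp_all add: k_def)
  then obtain x' y' where "x' \<in> A" "x = t powi k * x'" "y' \<in> A" "y = t powi k * y'"
    using val_ge_iff[OF assms(1,4), of k] val_ge_iff[OF assms(2,5), of k] by blast
  then have "x + y = t powi k * (x' + y') \<and> x' + y' \<in> A"
    by (simp add: distrib_left subring_add[OF sub])
  then have "k \<le> val (x + y)"
    using val_ge_iff[OF assms(3,6), of k] by blast
  then show ?thesis by (simp add: k_def)
qed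

lemma val_scale:
  assumes "x \<in> K" "x \<noteq> 0" "c \<noteq> 0"
  shows "val (\<iota> c * x) = val x"
proof -
  obtain u where u: "is_unit u" "x = t powi (val x) * u" by (rule val_decompose[OF assms(1,2)])
  show ?thesis
    by (rule val_eq[OF unit_mult[OF unit_const[OF assms(3)] u(1)]])
      (subst u(2), simp add: ac_simps)
qed

text \<open>
  The quotient of the residues of the unit parts of \<open>x\<close> and \<open>y\<close> is the constant that cancels the leading
  coefficient.
\<close>

lemma val_residue:
  assumes "x \<in> K" "y \<in> K" "x \<noteq> 0" "y \<noteq> 0" "val x = val y" "\<And>c. x - \<iota> c * y \<in> K"
  shows "\<exists>c. c \<noteq> 0 \<and> (x - \<iota> c * y = 0 \<or> val x < val (x - \<iota> c * y))"
proof -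
  obtain u where u: "is_unit u" "x = t powi (val x) * u" by (rule val_decompose[OF assms(1,3)])
  obtain w where w: "is_unit w" "y = t powi (val x) * w"
    using val_decompose[OF assms(2,4)] unfolding assms(5) by blast
  obtain a b where a: "u - \<iota> a \<in> M" and b: "w - \<iota> b \<in> M"
    using residue_const u(1) w(1) unfolding is_unit_def by blast
  have ab: "a \<noteq> 0" "b \<noteq> 0"
    using a b u(1) w(1) unfolding is_unit_def by (metis diff_zero emb_0)+
  define c where "c = a / b"
  have "u - \<iota> c * w = (u - \<iota> a) - \<iota> c * (w - \<iota> b)"
    using ab by (simp add: right_diff_distrib c_def flip: emb_mult)
  also have "\<dots> \<in> M"
    by (rule ideal_in_diff[OF M_ideal a ideal_in_mult[OF M_ideal const b]])
  finally obtain z where z: "z \<in> A" "u - \<iota> c * w = t * z" by (auto simp: M_eq)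
  have "x - \<iota> c * y = t powi (val x) * (u - \<iota> c * w)"
    by (subst u(2), subst w(2)) (simp add: algebra_simps)
  also have "\<dots> = t powi (val x + 1) * z" using z t_nz by (simp add: power_int_add ac_simps)
  finally have "x - \<iota> c * y \<noteq> 0 \<Longrightarrow> val x + 1 \<le> val (x - \<iota> c * y)"
    using val_ge_iff[OF assms(6)[of c], of "val x + 1"] z(1) by blast
  moreover have "c \<noteq> 0" using ab by (simp add: c_def)
  ultimately show ?thesis by fastforce
qed

end

section \<open>Extension of places\<close>

text \<open>
  A homomorphism from a subring is encoded by its graph, a single-valued subring of the product, so that
  extension of homomorphisms is inclusion and unions of chains are upper bounds for Zorn's lemma.
\<close>

definition hom_graph :: "('e::field \<times> 'f::field) set \<Rightarrow> bool" where
  "hom_graph G \<longleftrightarrow> (1, 1) \<in> G \<and> (\<forall>x u w. (x, u) \<in> G \<longrightarrow> (x, w) \<in> G \<longrightarrow> u = w) \<and>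
    (\<forall>x u y w. (x, u) \<in> G \<longrightarrow> (y, w) \<in> G \<longrightarrow> (x - y, u - w) \<in> G \<and> (x * y, u * w) \<in> G)"

lemma hom_graph_of:
  assumes "hom_on A \<phi>"
  shows "hom_graph ((\<lambda>x. (x, \<phi> x)) ` A)"
  unfolding hom_graph_def
  using assms subring_one subring_diff subring_mult hom_on_subring[OF assms]
  by (auto simp: hom_on_one hom_on_diff hom_on_mult image_iff)

lemma hom_on_of_graph:
  assumes "hom_graph G"
  shows "hom_on (Domain G) (\<lambda>x. THE u. (x, u) \<in> G)"
    and "(x, u) \<in> G \<Longrightarrow> (THE u. (x, u) \<in> G) = u"
proof -
  show the: "(THE u. (x, u) \<in> G) = u" if "(x, u) \<in> G" for x u
    using assms that by (intro the_equality) (auto simp: hom_graph_def)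
  have one: "(1, 1) \<in> G" using assms by (auto simp: hom_graph_def)
  have diff: "(x - y, u - w) \<in> G" and mult: "(x * y, u * w) \<in> G"
    if "(x, u) \<in> G" "(y, w) \<in> G" for x y u w
    using assms that by (auto simp: hom_graph_def)
  have add: "(x + y, u + w) \<in> G" if "(x, u) \<in> G" "(y, w) \<in> G" for x y u w
    using diff[OF that(1) diff[OF diff[OF one one] that(2)]] by simp
  show "hom_on (Domain G) (\<lambda>x. THE u. (x, u) \<in> G)"
    unfolding hom_on_def subring_of_def
  proof (intro conjI ballI)
    show "1 \<in> Domain G" using one by blast
    show "(THE u. (1, u) \<in> G) = 1" by (rule the[OF one])
    fix x y assume "x \<in> Domain G" "y \<in> Domain G"
    then obtain u w where xy: "(x, u) \<in> G" "(y, w) \<in> G" by blast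
    show "x - y \<in> Domain G" "x * y \<in> Domain G" using diff[OF xy] mult[OF xy] by blast+
    show "(THE u. (x + y, u) \<in> G) = (THE u. (x, u) \<in> G) + (THE u. (y, u) \<in> G)"
      by (simp only: the[OF add[OF xy]] the[OF xy(1)] the[OF xy(2)])
    show "(THE u. (x * y, u) \<in> G) = (THE u. (x, u) \<in> G) * (THE u. (y, u) \<in> G)"
      by (simp only: the[OF mult[OF xy]] the[OF xy(1)] the[OF xy(2)])
  qed
qed

text \<open>
  A homomorphism into an algebraically closed field that cannot be extended to a larger subring.
\<close>

locale maximal_place =
  fixes B :: "'e::field set" and \<phi> :: "'e \<Rightarrow> 'f::alg_closed_field"
  assumes hom: "hom_on B \<phi>"
    and maximal: "\<And>G. hom_graph G \<Longrightarrow> (\<And>x. x \<in> B \<Longrightarrow> (x, \<phi> x) \<in> G) \<Longrightarrow> (x, u) \<in> G \<Longrightarrow> x \<in> B"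
begin

lemmas sub = hom_on_subring[OF hom]

text \<open>
  A homomorphism extends to the fractions whose denominators have nonzero values, so a maximal one is
  already defined there.
\<close>

lemma unit_of_nonzero_value:
  assumes "s \<in> B" "\<phi> s \<noteq> 0"
  shows "inverse s \<in> B" "\<phi> (inverse s) = inverse (\<phi> s)"
proof -
  define G where "G = {(a / s, \<phi> a / \<phi> s) | a s. a \<in> B \<and> s \<in> B \<and> \<phi> s \<noteq> 0}"
  have nz: "s \<noteq> 0" if "\<phi> s \<noteq> 0" for s using that hom_on_zero[OF hom] by auto
  have "hom_graph G"
    unfolding hom_graph_def
  proof (intro conjI allI impI)
    show "(1, 1) \<in> G"
      unfolding G_def using subring_one[OF sub] hom_on_one[OF hom]
      by (auto intro!: exI[of _ 1])
    fix x u w assume "(x, u) \<in> G" "(x, w) \<in> G"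
    then obtain a s b t where *: "x = a / s" "u = \<phi> a / \<phi> s" "x = b / t" "w = \<phi> b / \<phi> t"
      "a \<in> B" "s \<in> B" "b \<in> B" "t \<in> B" "\<phi> s \<noteq> 0" "\<phi> t \<noteq> 0" unfolding G_def by blast
    then have "a * t = b * s" using nz by (simp add: frac_eq_eq)
    then have "\<phi> a * \<phi> t = \<phi> b * \<phi> s" using * hom_on_mult[OF hom] by metis
    then show "u = w" using * by (simp add: frac_eq_eq)
  next
    fix x u y w assume "(x, u) \<in> G" "(y, w) \<in> G"
    then obtain a s b t where *: "x = a / s" "u = \<phi> a / \<phi> s" "y = b / t" "w = \<phi> b / \<phi> t"
      "a \<in> B" "s \<in> B" "b \<in> B" "t \<in> B" "\<phi> s \<noteq> 0" "\<phi> t \<noteq> 0" unfolding G_def by blast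
    have st: "s * t \<in> B" "\<phi> (s * t) \<noteq> 0" "\<phi> (s * t) = \<phi> s * \<phi> t"
      using * by (auto simp: subring_mult[OF sub] hom_on_mult[OF hom])
    have "x - y = (a * t - b * s) / (s * t)" "u - w = \<phi> (a * t - b * s) / \<phi> (s * t)"
      using * nz by (simp_all add: hom_on_mult[OF hom] hom_on_diff[OF hom] subring_mult[OF sub]
          diff_frac_eq)
    then show "(x - y, u - w) \<in> G"
      unfolding G_def using st * subring_mult[OF sub] subring_diff[OF sub] by blast
    have "x * y = (a * b) / (s * t)" "u * w = \<phi> (a * b) / \<phi> (s * t)"
      using * by (simp_all add: hom_on_mult[OF hom])
    then show "(x * y, u * w) \<in> G"
      unfolding G_def using st * subring_mult[OF sub] by blast
  qed
  moreover have "(x, \<phi> x) \<in> G" if "x \<in> B" for x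
    unfolding G_def using that subring_one[OF sub] hom_on_one[OF hom]
    by (intro CollectI exI[of _ x] exI[of _ 1]) simp
  moreover have "(inverse s, inverse (\<phi> s)) \<in> G"
    unfolding G_def using assms subring_one[OF sub] hom_on_one[OF hom]
    by (intro CollectI exI[of _ 1] exI[of _ s]) (simp add: inverse_eq_divide)
  ultimately show inv: "inverse s \<in> B" by (rule maximal)
  have "\<phi> (s * inverse s) = 1" using nz[OF assms(2)] hom_on_one[OF hom] by simp
  then show "\<phi> (inverse s) = inverse (\<phi> s)"
    using hom_on_mult[OF hom assms(1) inv] by (metis inverse_unique)
qed

definition over_B :: "'e poly \<Rightarrow> bool" where
  "over_B p \<longleftrightarrow> (\<forall>i. coeff p i \<in> B)"

abbreviation red :: "'e poly \<Rightarrow> 'f poly" where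
  "red \<equiv> map_poly \<phi>"

lemma coeff_red: "coeff (red p) i = \<phi> (coeff p i)"
  by (rule coeff_map_poly) (rule hom_on_zero[OF hom])

lemma over_B_monom: "b \<in> B \<Longrightarrow> over_B (monom b k)"
  by (simp add: over_B_def subring_zero[OF sub])

lemma over_B_diff: "over_B p \<Longrightarrow> over_B q \<Longrightarrow> over_B (p - q)"
  by (simp add: over_B_def subring_diff[OF sub])

lemma over_B_mult: "over_B p \<Longrightarrow> over_B q \<Longrightarrow> over_B (p * q)"
  by (simp add: over_B_def coeff_mult subring_sum[OF sub] subring_mult[OF sub])

lemma red_monom: "red (monom b k) = monom (\<phi> b) k"
  by (rule poly_eqI) (simp add: coeff_red hom_on_zero[OF hom])

lemma red_diff: "over_B p \<Longrightarrow> over_B q \<Longrightarrow> red (p - q) = red p - red q"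
  by (rule poly_eqI) (simp add: coeff_red over_B_def hom_on_diff[OF hom])

lemma red_mult: "over_B p \<Longrightarrow> over_B q \<Longrightarrow> red (p * q) = red p * red q"
  by (rule poly_eqI)
    (simp add: coeff_red coeff_mult over_B_def hom_on_sum[OF hom] hom_on_mult[OF hom]
      subring_mult[OF sub])

text \<open>
  The assumption says that \<open>x \<mapsto> y\<close> respects all algebraic relations of \<open>x\<close> over \<open>B\<close>; then \<open>\<phi>\<close> extends
  to the ring generated by \<open>B\<close> and \<open>x\<close>.
\<close>

lemma extends_to_adjoined:
  assumes y: "\<And>p. over_B p \<Longrightarrow> poly p x = 0 \<Longrightarrow> poly (red p) y = 0"
  shows "x \<in> B"
proof -
  define G where "G = {(poly p x, poly (red p) y) | p. over_B p}"
  have "hom_graph G"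
    unfolding hom_graph_def
  proof (intro conjI allI impI)
    show "(1, 1) \<in> G"
      unfolding G_def using over_B_monom[OF subring_one[OF sub], of 0]
      by (auto intro!: exI[of _ "monom 1 0"] simp: red_monom hom_on_one[OF hom] poly_monom)
    fix u v w assume "(v, u) \<in> G" "(v, w) \<in> G"
    then obtain p q where *: "over_B p" "over_B q" "v = poly p x" "v = poly q x"
      "u = poly (red p) y" "w = poly (red q) y" by (auto simp: G_def)
    then have "poly (red (p - q)) y = 0" by (intro y) (auto intro: over_B_diff)
    then show "u = w" using * by (simp add: red_diff)
  next
    fix a u b w assume "(a, u) \<in> G" "(b, w) \<in> G"
    then obtain p q where *: "over_B p" "over_B q" "a = poly p x" "b = poly q x"
      "u = poly (red p) y" "w = poly (red q) y" by (auto simp: G_def)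
    then show "(a - b, u - w) \<in> G"
      unfolding G_def
      by (auto intro!: exI[of _ "p - q"] simp: red_diff over_B_diff)
    show "(a * b, u * w) \<in> G"
      unfolding G_def using *
      by (auto intro!: exI[of _ "p * q"] simp: red_mult over_B_mult)
  qed
  moreover have "(b, \<phi> b) \<in> G" if "b \<in> B" for b
    unfolding G_def using over_B_monom[OF that, of 0]
    by (auto intro!: exI[of _ "monom b 0"] simp: red_monom poly_monom)
  moreover have "(x, y) \<in> G"
    unfolding G_def using over_B_monom[OF subring_one[OF sub], of 1]
    by (auto intro!: exI[of _ "monom 1 1"] simp: red_monom hom_on_one[OF hom] poly_monom)
  ultimately show "x \<in> B" by (rule maximal)
qed

text \<open>
  \<open>1\<close> lies in the ideal that the kernel of \<open>\<phi>\<close> generates in the ring obtained by adjoining \<open>x\<close>,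
  as witnessed by a combination of degree at most \<open>n\<close>.
\<close>

definition small_rel :: "'e \<Rightarrow> nat \<Rightarrow> bool" where
  "small_rel x n \<longleftrightarrow> (\<exists>a. (\<forall>i. a i \<in> B \<and> \<phi> (a i) = 0) \<and> (\<Sum>i\<le>n. a i * x ^ i) = 1)"

text \<open>
  The reductions of the relations of \<open>x\<close> form an ideal over the field \<open>\<phi> ` B\<close>, generated by an element
  \<open>red q\<close> of least degree. A root of \<open>red q\<close> would be a common zero and allow an extension to \<open>x\<close>. As
  there is none, \<open>red q\<close> is a nonzero constant, and dividing \<open>q\<close> by its constant coefficient gives the
  relation.
\<close>

lemma small_rel_of_not_in:
  assumes x: "x \<notin> B"
  shows "\<exists>n. small_rel x n"
proof -
  define I where "I = {p. over_B p \<and> poly p x = 0}"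
  have "\<exists>p\<in>I. red p \<noteq> 0"
  proof (rule ccontr)
    assume "\<not> (\<exists>p\<in>I. red p \<noteq> 0)"
    then show False using extends_to_adjoined[of x 0] x by (auto simp: I_def)
  qed
  then obtain q where q: "q \<in> I" "red q \<noteq> 0"
    and min: "\<And>p. p \<in> I \<Longrightarrow> red p \<noteq> 0 \<Longrightarrow> degree (red q) \<le> degree (red p)"
    using exists_least_iff[of "\<lambda>n. \<exists>p\<in>I. red p \<noteq> 0 \<and> degree (red p) = n"]
    by (metis not_less)
  define d where "d = degree (red q)"
  define s where "s = coeff q d"
  have s: "s \<in> B" "\<phi> s = lead_coeff (red q)" "\<phi> s \<noteq> 0"
    using q by (auto simp: s_def d_def I_def over_B_def coeff_red simp flip: coeff_red)
  note s' = unit_of_nonzero_value[OF s(1,3)]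
  have "d = 0"
  proof (rule ccontr)
    assume "d \<noteq> 0"
    then obtain y where y: "poly (red q) y = 0"
      using alg_closed_imp_poly_has_root[of "red q"] by (auto simp: d_def)
    have "poly (red p) y = 0" if "p \<in> I" for p
      using that
    proof (induction "degree (red p)" arbitrary: p rule: less_induct)
      case less
      show ?case
      proof (cases "red p = 0")
        case False
        define e where "e = degree (red p)"
        have de: "d \<le> e" using min[OF less.prems False] by (simp add: d_def e_def)
        define m where "m = monom (coeff p e * inverse s) (e - d)"
        have b: "coeff p e * inverse s \<in> B"
          using less.prems s' by (intro subring_mult[OF sub]) (auto simp: I_def over_B_def)
        have m: "over_B m" unfolding m_def by (rule over_B_monom[OF b])
        have pq: "over_B p" "over_B q" using less.prems q by (auto simp: I_def)
        have mq: "over_B (m * q)" using m pq by (intro over_B_mult)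
        have r: "red (p - m * q) = red p - red m * red q"
          using pq m mq by (simp add: red_diff red_mult)
        have redm: "red m = monom (coeff (red p) e / coeff (red q) d) (e - d)"
          using pq s' s
          by (simp add: m_def red_monom hom_on_mult[OF hom] over_B_def coeff_red divide_inverse s_def)
        have I: "p - m * q \<in> I"
          using less.prems q pq mq by (auto simp: I_def over_B_diff)
        have "poly (red (p - m * q)) y = 0"
        proof (cases "red (p - m * q) = 0")
          case nz: False
          have "coeff (red (p - m * q)) e = 0"
          proof -
            have "coeff (red m * red q) e = (coeff (red p) e / coeff (red q) d) * coeff (red q) d"
              unfolding redm using de by (simp add: coeff_monom_mult)
            then show ?thesis
              unfolding r using s by (simp add: d_def)
          qed
          moreover have "degree (red (p - m * q)) \<le> e"
          proof -
            have "degree (red m * red q) \<le> (e - d) + d"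
              unfolding redm d_def
              by (intro order_trans[OF degree_mult_le] add_mono degree_monom_le order_refl)
            then show ?thesis
              unfolding r using de by (intro degree_diff_le) (auto simp: e_def)
          qed
          ultimately have "degree (red (p - m * q)) < e"
            using nz by (metis leading_coeff_0_iff order_le_less)
          then show ?thesis using less.hyps I by (simp add: e_def)
        qed simp
        then show ?thesis unfolding r using y by simp
      qed simp
    qed
    then have "x \<in> B" by (intro extends_to_adjoined[of x y]) (auto simp: I_def)
    then show False using x by blast
  qed
  have q0: "\<phi> (coeff q i) = 0" if "i \<noteq> 0" for i
    using \<open>d = 0\<close> that coeff_eq_0[of "red q" i] by (simp add: d_def coeff_red)
  have s0: "s = coeff q 0" "s \<noteq> 0" using \<open>d = 0\<close> s hom_on_zero[OF hom] by (auto simp: s_def)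
  define a where "a i = (if i = 0 then 0 else - inverse s * coeff q i)" for i
  have "a i \<in> B \<and> \<phi> (a i) = 0" for i
  proof (cases "i = 0")
    case False
    have u: "- inverse s \<in> B" "coeff q i \<in> B"
      using q s' by (auto simp: I_def over_B_def intro: subring_uminus[OF sub])
    have "a i = - inverse s * coeff q i" using False by (simp add: a_def)
    then show ?thesis
      using u subring_mult[OF sub u] hom_on_mult[OF hom u] q0[OF False]
      by (simp only: mult_zero_right simp_thms)
  qed (simp add: a_def hom_on_zero[OF hom] subring_zero[OF sub])
  moreover have "(\<Sum>i\<le>degree q. a i * x ^ i) = 1"
  proof -
    have 0: "(\<Sum>i\<le>degree q. coeff q i * x ^ i) = 0" using q by (simp add: I_def poly_altdef)
    have "(\<Sum>i\<le>degree q. a i * x ^ i) =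
        (\<Sum>i\<le>degree q. - inverse s * (coeff q i * x ^ i) + (if i = 0 then 1 else 0))"
      by (rule sum.cong) (use s0 in \<open>auto simp: a_def\<close>)
    also have "\<dots> = - inverse s * (\<Sum>i\<le>degree q. coeff q i * x ^ i) + 1"
      by (simp only: sum.distrib sum_distrib_left) simp
    also have "\<dots> = 1" using 0 by simp
    finally show ?thesis .
  qed
  ultimately show ?thesis unfolding small_rel_def by blast
qed

text \<open>
  The relation for \<open>inverse x\<close>, multiplied by \<open>x ^ n\<close>, expresses \<open>x ^ n\<close> by lower powers of \<open>x\<close>, with
  coefficients in the kernel of \<open>\<phi>\<close>, because \<open>1 - b 0\<close> is a unit. Substituting this for the top power
  shortens the relation for \<open>x\<close>.
\<close>

lemma small_rel_reduce:
  assumes "small_rel x n" "small_rel (inverse x) k" "k \<le> n" "x \<noteq> 0"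
  shows "0 < n \<and> small_rel x (n - 1)"
proof -
  obtain a where a: "\<And>i. a i \<in> B" "\<And>i. \<phi> (a i) = 0" "(\<Sum>i\<le>n. a i * x ^ i) = 1"
    using assms(1) by (auto simp: small_rel_def)
  obtain b where b: "\<And>i. b i \<in> B" "\<And>i. \<phi> (b i) = 0" "(\<Sum>i\<le>k. b i * inverse x ^ i) = 1"
    using assms(2) by (auto simp: small_rel_def)
  have "n \<noteq> 0"
  proof
    assume "n = 0"
    then have "a 0 = 1" using a(3) by simp
    then show False using a(2)[of 0] hom_on_one[OF hom] by simp
  qed
  define c where "c = inverse (1 - b 0)"
  have "\<phi> (1 - b 0) = 1"
    using b by (simp add: hom_on_diff[OF hom] hom_on_one[OF hom] subring_one[OF sub])
  then have c: "c \<in> B" "c * (1 - b 0) = 1"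
  proof -
    assume 1: "\<phi> (1 - b 0) = 1"
    then have "1 - b 0 \<noteq> 0" using hom_on_zero[OF hom] by (metis zero_neq_one)
    then show "c * (1 - b 0) = 1" by (simp add: c_def)
    show "c \<in> B"
      unfolding c_def
      by (rule unit_of_nonzero_value) (use 1 b in \<open>auto intro: subring_diff[OF sub] subring_one[OF sub]\<close>)
  qed
  have xn: "x ^ n = (\<Sum>i<n. if n - i \<le> k then c * b (n - i) * x ^ i else 0)"
  proof -
    have "1 - b 0 = (\<Sum>j=1..k. b j * inverse x ^ j)"
      using b(3) by (simp add: atMost_atLeast0 sum.atLeast_Suc_atMost eq_diff_eq add.commute diff_eq_eq)
    then have "x ^ n = c * (\<Sum>j=1..k. b j * inverse x ^ j) * x ^ n" using c by simp
    also have "\<dots> = (\<Sum>j=1..k. c * b j * x ^ (n - j))"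
      unfolding sum_distrib_left sum_distrib_right
    proof (rule sum.cong)
      fix j assume "j \<in> {1..k}"
      then have "x ^ n = x ^ (n - j) * x ^ j" using assms(3) by (simp flip: power_add)
      then show "c * (b j * inverse x ^ j) * x ^ n = c * b j * x ^ (n - j)"
        using assms(4) by (simp add: power_inverse)
    qed simp
    also have "\<dots> = (\<Sum>i\<in>{n - k..<n}. c * b (n - i) * x ^ i)"
      by (rule sum.reindex_bij_witness[of _ "\<lambda>i. n - i" "\<lambda>j. n - j"]) (use assms(3) in auto)
    also have "\<dots> = (\<Sum>i<n. if n - i \<le> k then c * b (n - i) * x ^ i else 0)"
      by (rule sum.mono_neutral_cong_left) auto
    finally show ?thesis .
  qed
  define a' where "a' i = a i + (if n - i \<le> k then a n * c * b (n - i) else 0)" for i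
  have "1 = (\<Sum>i<n. a i * x ^ i) + a n * x ^ n"
    using a(3) by (simp flip: lessThan_Suc_atMost)
  also have "\<dots> = (\<Sum>i<n. a' i * x ^ i)"
    unfolding xn sum_distrib_left sum.distrib[symmetric]
    by (rule sum.cong) (auto simp: a'_def algebra_simps)
  finally have "(\<Sum>i\<le>n - 1. a' i * x ^ i) = 1"
    using \<open>n \<noteq> 0\<close> by (simp flip: lessThan_Suc_atMost)
  moreover have "a' i \<in> B \<and> \<phi> (a' i) = 0" for i
    unfolding a'_def using a b c
    by (auto simp: hom_on_add[OF hom] hom_on_mult[OF hom] subring_add[OF sub] subring_mult[OF sub])
  ultimately show ?thesis using \<open>n \<noteq> 0\<close> unfolding small_rel_def by blast
qed

text \<open>
  If neither \<open>x\<close> nor its inverse were in \<open>B\<close>, both would satisfy relations as above, and these could be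
  shortened alternately without end.
\<close>

lemma valuation_ring: "x \<in> B \<or> inverse x \<in> B"
proof (rule ccontr)
  assume *: "\<not> (x \<in> B \<or> inverse x \<in> B)"
  then have "x \<noteq> 0" using subring_zero[OF sub] by auto
  have no: False if "small_rel x n" "small_rel (inverse x) k" for n k
    using that
  proof (induction "n + k" arbitrary: n k rule: less_induct)
    case less
    show ?case
    proof (cases "k \<le> n")
      case True
      then show ?thesis
        using small_rel_reduce[OF less.prems True \<open>x \<noteq> 0\<close>] less.hyps[of "n - 1" k] less.prems by simp
    next
      case False
      then show ?thesis
        using small_rel_reduce[of "inverse x" k n] \<open>x \<noteq> 0\<close> less.hyps[of n "k - 1"] less.prems by simp
    qed
  qed
  then show False using small_rel_of_not_in * by blast
qed

end

text \<open>
  Every homomorphism from a subring of a field into an algebraically closed field extends to a valuation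
  ring, and the extension vanishes exactly on the nonunits. It produces points of projective varieties
  over the algebraic closure and thereby takes the place of the Nullstellensatz.
\<close>

theorem place_extension:
  fixes \<phi> :: "'e::field \<Rightarrow> 'f::alg_closed_field"
  assumes "hom_on A \<phi>"
  shows "\<exists>B \<psi>. hom_on B \<psi> \<and> A \<subseteq> B \<and> (\<forall>x\<in>A. \<psi> x = \<phi> x) \<and>
    (\<forall>x\<in>B. \<psi> x \<noteq> 0 \<longrightarrow> inverse x \<in> B) \<and> (\<forall>x. x \<in> B \<or> inverse x \<in> B)"
proof -
  define G0 where "G0 = (\<lambda>x. (x, \<phi> x)) ` A"
  define S where "S = {G :: ('e \<times> 'f) set. hom_graph G \<and> G0 \<subseteq> G}"
  have "\<exists>M\<in>S. \<forall>G\<in>S. M \<subseteq> G \<longrightarrow> G = M"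
  proof (rule subset_Zorn_nonempty)
    show "S \<noteq> {}" using hom_graph_of[OF assms] by (auto simp: S_def G0_def)
    fix C assume C: "C \<noteq> {}" "subset.chain S C"
    have two: "\<exists>G\<in>C. p \<in> G \<and> q \<in> G" if "p \<in> \<Union>C" "q \<in> \<Union>C" for p q
      using C(2) that unfolding subset_chain_def by blast
    have CS: "hom_graph G" "G0 \<subseteq> G" if "G \<in> C" for G
      using C(2) that unfolding subset_chain_def S_def by auto
    show "\<Union>C \<in> S"
      unfolding S_def hom_graph_def
    proof (intro CollectI conjI allI impI)
      show "(1, 1) \<in> \<Union>C" using C(1) CS(1) unfolding hom_graph_def by blast
      show "G0 \<subseteq> \<Union>C" using C(1) CS(2) by blast
      fix x u w assume "(x, u) \<in> \<Union>C" "(x, w) \<in> \<Union>C"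
      then obtain G where "G \<in> C" "(x, u) \<in> G" "(x, w) \<in> G" using two by blast
      then show "u = w" using CS(1)[of G] unfolding hom_graph_def by blast
    next
      fix x u y w assume "(x, u) \<in> \<Union>C" "(y, w) \<in> \<Union>C"
      then obtain G where "G \<in> C" "(x, u) \<in> G" "(y, w) \<in> G" using two by blast
      then show "(x - y, u - w) \<in> \<Union>C" "(x * y, u * w) \<in> \<Union>C"
        using CS(1)[of G] unfolding hom_graph_def by blast+
    qed
  qed
  then obtain M where M: "hom_graph M" "G0 \<subseteq> M"
    and max: "\<And>G. hom_graph G \<Longrightarrow> G0 \<subseteq> G \<Longrightarrow> M \<subseteq> G \<Longrightarrow> G = M"
    by (auto simp: S_def)
  define \<psi> where "\<psi> = (\<lambda>x. THE u. (x, u) \<in> M)"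
  have graph: "(x, \<psi> x) \<in> M" if "x \<in> Domain M" for x
    using that hom_on_of_graph(2)[OF M(1)] unfolding \<psi>_def by blast
  have val: "\<psi> x = u" if "(x, u) \<in> M" for x u
    using hom_on_of_graph(2)[OF M(1) that] by (simp add: \<psi>_def)
  interpret maximal_place "Domain M" \<psi>
  proof
    show "hom_on (Domain M) \<psi>" unfolding \<psi>_def by (rule hom_on_of_graph[OF M(1)])
    fix G x u
    assume G: "hom_graph G" "\<And>x. x \<in> Domain M \<Longrightarrow> (x, \<psi> x) \<in> G" "(x, u) \<in> G"
    have "M \<subseteq> G" using G(2) val by auto
    then have "G = M" using max G(1) M(2) by blast
    then show "x \<in> Domain M" using G(3) by blast
  qed
  have "A \<subseteq> Domain M" "\<forall>x\<in>A. \<psi> x = \<phi> x"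
    using M(2) val by (auto simp: G0_def)
  then show ?thesis
    using hom unit_of_nonzero_value(1) valuation_ring by blast
qed

section \<open>An ultrapower\<close>

text \<open>
  In the order of filters, finer filters are smaller, so an ultrafilter is a minimal proper filter.
\<close>

lemma ultrafilter_below:
  assumes "F \<noteq> (bot :: 'x filter)"
  shows "\<exists>U. U \<noteq> bot \<and> U \<le> F \<and> (\<forall>P. eventually P U \<or> eventually (\<lambda>x. \<not> P x) U)"
proof -
  define A where "A = {U. U \<noteq> bot \<and> U \<le> F}"
  have "\<exists>m\<in>A. \<forall>a\<in>A. a \<le> m \<longrightarrow> a = m"
  proof (rule predicate_Zorn[of A "\<lambda>x y. y \<le> x", simplified])
    show "partial_order_on A (relation_of (\<lambda>x y. y \<le> x) A)"
      by (rule partial_order_on_relation_ofI) auto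
    fix C assume C: "C \<in> Chains (relation_of (\<lambda>x y. y \<le> x) A)"
    then have CA: "C \<subseteq> A" and tot: "\<And>x y. x \<in> C \<Longrightarrow> y \<in> C \<Longrightarrow> x \<le> y \<or> y \<le> x"
      by (auto simp: Chains_def relation_of_def)
    show "\<exists>u\<in>A. \<forall>a\<in>C. u \<le> a"
    proof (cases "C = {}")
      case True
      then show ?thesis using assms by (auto simp: A_def)
    next
      case False
      have least: "\<exists>m\<in>D. \<forall>x\<in>D. m \<le> x" if "finite D" "D \<noteq> {}" "D \<subseteq> C" for D
        using that
      proof (induction D rule: finite_ne_induct)
        case (insert x D)
        then obtain m where "m \<in> D" "\<forall>x\<in>D. m \<le> x" by auto
        moreover have "m \<le> x \<or> x \<le> m" using tot insert.prems \<open>m \<in> D\<close> by auto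
        ultimately show ?case by (metis insert_iff order_refl order_trans)
      qed auto
      have "Inf C \<noteq> bot"
      proof (rule Inf_filter_not_bot)
        fix D assume D: "D \<subseteq> C" "finite D"
        show "Inf D \<noteq> bot"
        proof (cases "D = {}")
          case True
          then have "Inf D = Orderings.top" by simp
          then show ?thesis using assms by (metis bot.extremum_unique top.extremum)
        next
          case False
          then obtain m where "m \<in> D" "\<forall>x\<in>D. m \<le> x" using least D by blast
          then have "Inf D = m" by (intro antisym) (auto intro: Inf_lower Inf_greatest)
          then show ?thesis using \<open>m \<in> D\<close> D CA by (auto simp: A_def)
        qed
      qed
      moreover have "Inf C \<le> F" using False CA by (auto simp: A_def intro: Inf_lower2)
      ultimately show ?thesis by (auto simp: A_def intro: Inf_lower)
    qed
  qed
  then obtain U where U: "U \<noteq> bot" "U \<le> F" and min: "\<And>W. W \<noteq> bot \<Longrightarrow> W \<le> F \<Longrightarrow> W \<le> U \<Longrightarrow> W = U"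
    by (auto simp: A_def)
  have "eventually P U \<or> eventually (\<lambda>x. \<not> P x) U" for P
  proof (rule disjCI)
    assume *: "\<not> eventually (\<lambda>x. \<not> P x) U"
    have "inf U (principal {x. P x}) \<noteq> bot"
      using * by (simp add: trivial_limit_def eventually_inf_principal)
    then have "inf U (principal {x. P x}) = U"
      by (rule min) (use U in \<open>auto intro: le_infI1\<close>)
    then have "U \<le> principal {x. P x}" by (metis inf_le2)
    then show "eventually P U" by (simp add: le_principal)
  qed
  then show ?thesis using U by blast
qed

text \<open>
  An ultrafilter on the subsets of a type that concentrates on the finite ones and, for every element,
  on those containing it.
\<close>

definition ufilter :: "'i set filter" where
  "ufilter = (SOME U. U \<noteq> bot \<and> U \<le> finite_subsets_at_top UNIV \<and>
    (\<forall>P. eventually P U \<or> eventually (\<lambda>x. \<not> P x) U))"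

lemma ufilter_not_bot: "(ufilter :: 'i set filter) \<noteq> bot"
  and ufilter_le: "ufilter \<le> finite_subsets_at_top (UNIV :: 'i set)"
  and ufilter_ultra: "eventually P (ufilter :: 'i set filter) \<or> eventually (\<lambda>T. \<not> P T) ufilter"
proof -
  have "\<exists>U. U \<noteq> bot \<and> U \<le> finite_subsets_at_top (UNIV :: 'i set) \<and>
      (\<forall>P. eventually P U \<or> eventually (\<lambda>x. \<not> P x) U)"
    by (rule ultrafilter_below) simp
  from someI_ex[OF this, folded ufilter_def]
  show "(ufilter :: 'i set filter) \<noteq> bot" "ufilter \<le> finite_subsets_at_top (UNIV :: 'i set)"
    "eventually P (ufilter :: 'i set filter) \<or> eventually (\<lambda>T. \<not> P T) ufilter"
    by blast+
qed

text \<open>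
  The ultrapower of a field over the index set of all subsets of \<open>'i\<close>. A family of field elements that
  depends on a finite set \<open>T\<close> represents a limit as \<open>T\<close> grows.
\<close>

quotient_type (overloaded) ('i, 'b) upower = "'i set \<Rightarrow> 'b::field" /
  "\<lambda>f g. eventually (\<lambda>T. f T = g T) ufilter"
  morphisms rep_upower cls
proof (rule equivpI)
  show "reflp (\<lambda>(f :: 'i set \<Rightarrow> 'b) g. eventually (\<lambda>T. f T = g T) ufilter)"
    by (simp add: reflp_def)
  show "symp (\<lambda>(f :: 'i set \<Rightarrow> 'b) g. eventually (\<lambda>T. f T = g T) ufilter)"
    by (simp add: symp_def eq_commute)
  show "transp (\<lambda>(f :: 'i set \<Rightarrow> 'b) g. eventually (\<lambda>T. f T = g T) ufilter)"
    unfolding transp_def by (intro allI impI, erule (1) eventually_elim2) simp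
qed

instantiation upower :: (type, field) field
begin

lift_definition zero_upower :: "('a, 'b) upower" is "\<lambda>_. 0" .
lift_definition one_upower :: "('a, 'b) upower" is "\<lambda>_. 1" .
lift_definition plus_upower :: "('a, 'b) upower \<Rightarrow> ('a, 'b) upower \<Rightarrow> ('a, 'b) upower"
  is "\<lambda>f g T. f T + g T" by (erule (1) eventually_elim2) simp
lift_definition minus_upower :: "('a, 'b) upower \<Rightarrow> ('a, 'b) upower \<Rightarrow> ('a, 'b) upower"
  is "\<lambda>f g T. f T - g T" by (erule (1) eventually_elim2) simp
lift_definition uminus_upower :: "('a, 'b) upower \<Rightarrow> ('a, 'b) upower"
  is "\<lambda>f T. - f T" by (erule eventually_mono) auto
lift_definition times_upower :: "('a, 'b) upower \<Rightarrow> ('a, 'b) upower \<Rightarrow> ('a, 'b) upower"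
  is "\<lambda>f g T. f T * g T" by (erule (1) eventually_elim2) simp
lift_definition inverse_upower :: "('a, 'b) upower \<Rightarrow> ('a, 'b) upower"
  is "\<lambda>f T. inverse (f T)" by (erule eventually_mono) auto
lift_definition divide_upower :: "('a, 'b) upower \<Rightarrow> ('a, 'b) upower \<Rightarrow> ('a, 'b) upower"
  is "\<lambda>f g T. f T / g T" by (erule (1) eventually_elim2) simp

instance
proof
  fix a b c :: "('a, 'b) upower"
  show "a * b * c = a * (b * c)" by transfer (simp add: mult.assoc)
  show "a * b = b * a" by transfer (simp add: mult.commute)
  show "1 * a = a" by transfer simp
  show "a + b + c = a + (b + c)" by transfer (simp add: add.assoc)
  show "a + b = b + a" by transfer (simp add: add.commute)
  show "0 + a = a" by transfer simp
  show "- a + a = 0" by transfer simp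
  show "a - b = a + - b" by transfer simp
  show "(a + b) * c = a * c + b * c" by transfer (simp add: distrib_right)
  show "(0 :: ('a, 'b) upower) \<noteq> 1" by transfer (simp add: ufilter_not_bot)
  show "inverse (0 :: ('a, 'b) upower) = 0" by transfer simp
  show "a div b = a * inverse b" by transfer (simp add: divide_inverse)
  assume "a \<noteq> 0"
  then show "inverse a * a = 1"
  proof transfer
    fix f :: "'a set \<Rightarrow> 'b"
    assume "\<not> eventually (\<lambda>T. f T = 0) ufilter"
    then have "eventually (\<lambda>T. f T \<noteq> 0) ufilter" using ufilter_ultra by blast
    then show "eventually (\<lambda>T. inverse (f T) * f T = 1) ufilter"
      by (rule eventually_mono) simp
  qed
qed

end

lemma cls_eq_0_iff: "cls f = 0 \<longleftrightarrow> eventually (\<lambda>T. f T = 0) ufilter"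
  unfolding zero_upower_def by (simp add: upower.abs_eq_iff)

lemma cls_add: "cls f + cls g = cls (\<lambda>T. f T + g T)"
  by (rule plus_upower.abs_eq)

lemma cls_mult: "cls f * cls g = cls (\<lambda>T. f T * g T)"
  by (rule times_upower.abs_eq)

lemma cls_sum: "(\<Sum>i\<in>A. cls (f i)) = cls (\<lambda>T. \<Sum>i\<in>A. f i T)"
  by (induction A rule: infinite_finite_induct) (simp_all add: cls_add zero_upower_def)

lemma cls_prod: "(\<Prod>i\<in>A. cls (f i)) = cls (\<lambda>T. \<Prod>i\<in>A. f i T)"
  by (induction A rule: infinite_finite_induct) (simp_all add: cls_mult one_upower_def)

lemma cls_power: "cls f ^ k = cls (\<lambda>T. f T ^ k)"
  by (induction k) (simp_all add: cls_mult one_upower_def)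

section \<open>Points and generic points\<close>

lemma pt_eq_iff:
  fixes x y :: "'b::field ^ 'n::finite"
  assumes "x \<noteq> 0" "y \<noteq> 0"
  shows "pt x = pt y \<longleftrightarrow> (\<exists>c. c \<noteq> 0 \<and> y = c *s x)"
proof -
  have r: "z \<noteq> 0 \<Longrightarrow> \<exists>c. c \<noteq> 0 \<and> z = c *s z" for z :: "'b ^ 'n"
    by (intro exI[of _ 1]) simp
  show ?thesis
    using Quotient_rel[OF Quotient_proj, of x y] assms r[of x] r[of y] by blast
qed

lemma proj_cases:
  obtains x where "x \<noteq> 0" "P = pt x"
  using Quotient_abs_rep[OF Quotient_proj, of P] Quotient_rep_reflp[OF Quotient_proj, of P]
  by metis

lemma zero_at_pt:
  assumes "form d p" "x \<noteq> 0"
  shows "zero_at p (pt x) \<longleftrightarrow> mp_eval p x = 0"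
proof
  assume *: "mp_eval p x = 0"
  show "zero_at p (pt x)"
    unfolding zero_at_def
  proof (intro allI impI)
    fix y assume y: "y \<noteq> 0 \<and> pt y = pt x"
    then have "\<exists>c. c \<noteq> 0 \<and> y = c *s x" using pt_eq_iff[OF assms(2), of y] by simp
    then obtain c where "y = c *s x" by blast
    then show "mp_eval p y = 0"
      using * field_embedding.poly_at_smult[OF field_embedding_id assms(1), of c x]
      by (simp only: mp_eval_eq_poly_at mult_zero_right)
  qed
qed (use assms in \<open>simp add: zero_at_def\<close>)

lemma zero_at_to_ac:
  assumes "form d p" "x \<noteq> 0"
  shows "zero_at (to_ac_poly p) (pt x) \<longleftrightarrow> poly_at to_ac x p = 0"
  using zero_at_pt[of d "to_ac_poly p" x] assms by (simp add: form_to_ac_poly mp_eval_to_ac_poly)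

interpretation to_ac: field_embedding to_ac
  by (rule field_embedding_to_ac)

lemma vanishing_idealD:
  assumes "p \<in> vanishing_ideal V" "x \<noteq> 0" "pt x \<in> V"
  shows "poly_at to_ac x p = 0"
  using assms by (auto simp: vanishing_ideal_def zero_at_def mp_eval_to_ac_poly)

lemma vanishing_idealI:
  assumes "form d p" "\<And>x. x \<noteq> 0 \<Longrightarrow> pt x \<in> V \<Longrightarrow> poly_at to_ac x p = 0"
  shows "p \<in> vanishing_ideal V"
  unfolding vanishing_ideal_def
proof (intro CollectI ballI)
  fix P assume "P \<in> V"
  then show "zero_at (to_ac_poly p) P"
    using assms zero_at_to_ac by (cases P rule: proj_cases) auto
qed

text \<open>
  If a product of two forms vanishes on the variety, then the variety is covered by their zero loci.
\<close>

lemma vanishing_ideal_prime: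
  assumes V: "geometrically_irreducible V" and p: "form d p" and q: "form e q"
    and pq: "p * q \<in> vanishing_ideal V"
  shows "p \<in> vanishing_ideal V \<or> q \<in> vanishing_ideal V"
proof -
  have cl: "zariski_closed (zero_locus {to_ac_poly p})" if "form d p" for d and p :: "('a, 'b) mpoly"
    unfolding zariski_closed_def
    by (rule exI[of _ "{to_ac_poly p}"]) (use that in \<open>auto simp: form_to_ac_poly\<close>)
  have "V \<subseteq> zero_locus {to_ac_poly p} \<union> zero_locus {to_ac_poly q}"
  proof
    fix P assume "P \<in> V"
    then show "P \<in> zero_locus {to_ac_poly p} \<union> zero_locus {to_ac_poly q}"
      using vanishing_idealD[OF pq] p q
      by (cases P rule: proj_cases) (auto simp: zero_locus_def zero_at_to_ac to_ac.poly_at_mult)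
  qed
  then have "V \<subseteq> zero_locus {to_ac_poly p} \<or> V \<subseteq> zero_locus {to_ac_poly q}"
    using V cl[OF p] cl[OF q] unfolding geometrically_irreducible_def by blast
  then show ?thesis by (auto simp: zero_locus_def vanishing_ideal_def)
qed

lemma avoid_zeros:
  assumes V: "geometrically_irreducible V" and "finite T"
    and T: "\<And>p. p \<in> T \<Longrightarrow> \<exists>d. form d p" "T \<inter> vanishing_ideal V = {}"
  shows "\<exists>x. x \<noteq> 0 \<and> pt x \<in> V \<and> (\<forall>p\<in>T. poly_at to_ac x p \<noteq> 0)"
proof -
  have "(\<exists>d. form d (\<Prod>T)) \<and> \<Prod>T \<notin> vanishing_ideal V"
    using \<open>finite T\<close> T
  proof (induction T rule: finite_induct)
    case empty
    have "1 \<notin> vanishing_ideal V"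
    proof
      assume *: "1 \<in> vanishing_ideal V"
      obtain P where "P \<in> V" using V by (auto simp: geometrically_irreducible_def)
      then show False
        using vanishing_idealD[OF *] by (cases P rule: proj_cases) auto
    qed
    then show ?case by (auto intro: exI[of _ 0])
  next
    case (insert p T)
    then obtain d where d: "form d p" by auto
    obtain e where e: "form e (\<Prod>T)" using insert by auto
    have "p * \<Prod>T \<notin> vanishing_ideal V"
      using vanishing_ideal_prime[OF V d e] insert by auto
    then show ?case using insert form_mult[OF d e] by auto
  qed
  then obtain d where d: "form d (\<Prod>T)" "\<Prod>T \<notin> vanishing_ideal V" by blast
  then obtain x where x: "x \<noteq> 0" "pt x \<in> V" "poly_at to_ac x (\<Prod>T) \<noteq> 0"
    using vanishing_idealI[OF d(1)] by blast
  have "poly_at to_ac x (\<Prod>T) = (\<Prod>p\<in>T. poly_at to_ac x p)"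
    using to_ac.poly_at_prod[of x "\<lambda>p. p" T] by simp
  then have "\<forall>p\<in>T. poly_at to_ac x p \<noteq> 0" using x(3) \<open>finite T\<close> by auto
  then show ?thesis using x by blast
qed

text \<open>
  A point with coordinates in an extension field that satisfies exactly the homogeneous equations of the
  variety. It turns statements modulo the vanishing ideal into equations in a field.
\<close>

locale generic_point = field_embedding \<iota>
  for \<iota> :: "'a::field \<Rightarrow> 'e::field" +
  fixes V :: "('a alg_closure, 'n::finite) proj set" and \<xi> :: "'e ^ 'n"
  assumes generic: "form d p \<Longrightarrow> poly_at \<iota> \<xi> p = 0 \<longleftrightarrow> p \<in> vanishing_ideal V"

text \<open>
  The constant families; the index type will be the type of polynomials.
\<close>

definition const_embedding :: "'a::field \<Rightarrow> ('i, 'a alg_closure) upower" where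
  "const_embedding c = cls (\<lambda>_. to_ac c)"

text \<open>
  For each finite set \<open>T\<close> of forms, irreducibility provides a geometric point of the variety that avoids
  the zeros of all members of \<open>T\<close> that do not vanish identically on it. The class of this family of points
  in the ultrapower is generic, since each form belongs to almost all \<open>T\<close>.
\<close>

lemma generic_point_exists:
  fixes V :: "('a::field alg_closure, 'n::finite) proj set"
  assumes V: "geometrically_irreducible V"
  shows "\<exists>\<xi>. generic_point (const_embedding :: 'a \<Rightarrow> (('a, 'n) mpoly, 'a alg_closure) upower) V \<xi>"
proof -
  define good where "good T x \<longleftrightarrow> x \<noteq> 0 \<and> pt x \<in> V \<and>
    (\<forall>p\<in>T. (\<exists>d. form d p) \<longrightarrow> p \<notin> vanishing_ideal V \<longrightarrow> poly_at to_ac x p \<noteq> 0)"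
    for T :: "('a, 'n) mpoly set" and x
  have "\<exists>x. finite T \<longrightarrow> good T x" for T
  proof (cases "finite T")
    case True
    then have "\<exists>x. x \<noteq> 0 \<and> pt x \<in> V \<and>
        (\<forall>p\<in>{p \<in> T. (\<exists>d. form d p) \<and> p \<notin> vanishing_ideal V}. poly_at to_ac x p \<noteq> 0)"
      by (intro avoid_zeros[OF V]) auto
    then show ?thesis unfolding good_def by blast
  qed simp
  then have "\<forall>T. \<exists>x. finite T \<longrightarrow> good T x" ..
  from choice[OF this] obtain x where good: "\<forall>T. finite T \<longrightarrow> good T (x T)" ..
  then have x: "x T \<noteq> 0" "pt (x T) \<in> V"
    "p \<in> T \<Longrightarrow> form d p \<Longrightarrow> p \<notin> vanishing_ideal V \<Longrightarrow> poly_at to_ac (x T) p \<noteq> 0"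
    if "finite T" for T p d
    using that unfolding good_def by blast+
  define \<xi> :: "(('a, 'n) mpoly, 'a alg_closure) upower ^ 'n" where "\<xi> = (\<chi> i. cls (\<lambda>T. x T $ i))"
  let ?\<iota> = "const_embedding :: 'a \<Rightarrow> (('a, 'n) mpoly, 'a alg_closure) upower"
  interpret field_embedding ?\<iota>
    by unfold_locales (simp_all add: const_embedding_def cls_add cls_mult one_upower_def)
  have ev: "poly_at ?\<iota> \<xi> p = cls (\<lambda>T. poly_at to_ac (x T) p)" for p
    by (simp add: poly_at_def monom_at_def \<xi>_def const_embedding_def cls_power cls_prod cls_mult
        cls_sum)
  have "generic_point ?\<iota> V \<xi>"
  proof
    fix d and p :: "('a, 'n) mpoly"
    assume p: "form d p"
    have fin: "eventually (\<lambda>T. finite T \<and> p \<in> T) ufilter"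
      using ufilter_le by (rule filter_leD)
        (auto simp: eventually_finite_subsets_at_top intro!: exI[of _ "{p}"])
    show "poly_at ?\<iota> \<xi> p = 0 \<longleftrightarrow> p \<in> vanishing_ideal V"
    proof
      assume "p \<in> vanishing_ideal V"
      then have "eventually (\<lambda>T. poly_at to_ac (x T) p = 0) ufilter"
        by (intro eventually_mono[OF fin] vanishing_idealD) (auto simp: x)
      then show "poly_at ?\<iota> \<xi> p = 0" by (simp add: ev cls_eq_0_iff)
    next
      assume "poly_at ?\<iota> \<xi> p = 0"
      then have *: "eventually (\<lambda>T. poly_at to_ac (x T) p = 0) ufilter"
        by (simp add: ev cls_eq_0_iff)
      show "p \<in> vanishing_ideal V"
      proof (rule ccontr)
        assume np: "p \<notin> vanishing_ideal V"
        obtain T where "poly_at to_ac (x T) p = 0" "finite T" "p \<in> T"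
          using eventually_happens'[OF ufilter_not_bot eventually_conj[OF * fin]] by blast
        then show False using x(3)[OF _ _ p np] by blast
      qed
    qed
  qed
  then show ?thesis ..
qed

section \<open>Local rings of the curve inside the field of its generic point\<close>

locale curve_model = generic_point \<iota> V \<xi>
  for \<iota> :: "'a::field \<Rightarrow> 'e::field" and V :: "('a alg_closure, 'n::finite) proj set"
    and \<xi> :: "'e ^ 'n" +
  assumes irreducible: "geometrically_irreducible V"
    and closed: "closed_over_base V"
begin

abbreviation ev :: "('a, 'n) mpoly \<Rightarrow> 'e" where
  "ev \<equiv> poly_at \<iota> \<xi>"

abbreviation at_pt :: "'a alg_closure ^ 'n \<Rightarrow> ('a, 'n) mpoly \<Rightarrow> 'a alg_closure" where
  "at_pt \<equiv> poly_at to_ac"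

text \<open>
  The function field, the local ring at the point with homogeneous coordinates \<open>x\<close>, and its maximal
  ideal, as subsets of the field of the generic point.
\<close>

definition fun_field :: "'e set" where
  "fun_field = {ev g / ev h | g h d. form d g \<and> form d h \<and> ev h \<noteq> 0}"

definition regular_at :: "'a alg_closure ^ 'n \<Rightarrow> 'e set" where
  "regular_at x = {ev g / ev h | g h d. form d g \<and> form d h \<and> at_pt x h \<noteq> 0}"

definition zero_in :: "'a alg_closure ^ 'n \<Rightarrow> 'e set" where
  "zero_in x = {ev g / ev h | g h d. form d g \<and> form d h \<and> at_pt x h \<noteq> 0 \<and> at_pt x g = 0}"

definition on_curve :: "'a alg_closure ^ 'n \<Rightarrow> bool" where
  "on_curve x \<longleftrightarrow> x \<noteq> 0 \<and> pt x \<in> V"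

lemma ev_nonzero:
  assumes "on_curve x" "form d h" "at_pt x h \<noteq> 0"
  shows "ev h \<noteq> 0"
  using assms generic[OF assms(2)] vanishing_idealD[of h V x] by (auto simp: on_curve_def)

lemma value_unique:
  assumes x: "on_curve x" and f: "form d g" "form d h" "form e g'" "form e h'"
    and h: "at_pt x h \<noteq> 0" "at_pt x h' \<noteq> 0" and eq: "ev g / ev h = ev g' / ev h'"
  shows "at_pt x g / at_pt x h = at_pt x g' / at_pt x h'"
proof -
  have "ev h \<noteq> 0" "ev h' \<noteq> 0" using ev_nonzero x f h by blast+
  then have "ev (g * h' - g' * h) = 0"
    using eq by (simp add: poly_at_diff poly_at_mult frac_eq_eq)
  moreover have "form (d + e) (g * h' - g' * h)"
    using form_diff[OF form_mult[OF f(1,4)], of "g' * h"] form_mult[OF f(3,2)] by (simp add: add.commute)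
  ultimately have "g * h' - g' * h \<in> vanishing_ideal V" using generic by blast
  then have "at_pt x (g * h' - g' * h) = 0" using x vanishing_idealD by (auto simp: on_curve_def)
  then show ?thesis using h by (simp add: to_ac.poly_at_diff to_ac.poly_at_mult frac_eq_eq)
qed

lemma regular_subring:
  assumes x: "on_curve x"
  shows "subring_of (regular_at x)"
  unfolding subring_of_def
proof (intro conjI ballI)
  show "1 \<in> regular_at x"
    unfolding regular_at_def by (intro CollectI exI[of _ 1] exI[of _ 0]) simp
  fix f f' assume "f \<in> regular_at x" "f' \<in> regular_at x"
  then obtain g h d g' h' d' where f: "f = ev g / ev h" "form d g" "form d h" "at_pt x h \<noteq> 0"
    and f': "f' = ev g' / ev h'" "form d' g'" "form d' h'" "at_pt x h' \<noteq> 0"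
    unfolding regular_at_def by blast
  have h: "ev h \<noteq> 0" "ev h' \<noteq> 0" using ev_nonzero x f f' by blast+
  have hh: "form (d + d') (h * h')" "at_pt x (h * h') \<noteq> 0"
    using f f' by (simp_all add: form_mult to_ac.poly_at_mult)
  have "f - f' = ev (g * h' - g' * h) / ev (h * h')"
    using h by (simp add: f f' poly_at_diff poly_at_mult diff_frac_eq)
  moreover have "form (d + d') (g * h' - g' * h)"
    using form_diff[OF form_mult[OF f(2) f'(3)], of "g' * h"] form_mult[OF f'(2) f(3)]
    by (simp add: add.commute)
  ultimately show "f - f' \<in> regular_at x" unfolding regular_at_def using hh by blast
  have "f * f' = ev (g * g') / ev (h * h')" by (simp add: f f' poly_at_mult)
  moreover have "form (d + d') (g * g')" using f f' by (intro form_mult)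
  ultimately show "f * f' \<in> regular_at x" unfolding regular_at_def using hh by blast
qed

lemma const_regular: "\<iota> c \<in> regular_at x"
  unfolding regular_at_def
  by (intro CollectI exI[of _ "Poly_Mapping.single 0 c"] exI[of _ 1] exI[of _ 0]) simp

lemma zero_in_subset: "zero_in x \<subseteq> regular_at x"
  unfolding zero_in_def regular_at_def by blast

lemma zero_in_iff:
  assumes "on_curve x" "form d g" "form d h" "at_pt x h \<noteq> 0"
  shows "ev g / ev h \<in> zero_in x \<longleftrightarrow> at_pt x g = 0"
proof
  assume "ev g / ev h \<in> zero_in x"
  then obtain g' h' e where "ev g / ev h = ev g' / ev h'" "form e g'" "form e h'"
    "at_pt x h' \<noteq> 0" "at_pt x g' = 0"
    unfolding zero_in_def by blast
  then show "at_pt x g = 0" using value_unique[OF assms(1-3) _ _ assms(4)] assms(4) by fastforce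
next
  assume "at_pt x g = 0"
  then show "ev g / ev h \<in> zero_in x" unfolding zero_in_def using assms by blast
qed

lemma zero_in_ideal:
  assumes x: "on_curve x"
  shows "ideal_in (regular_at x) (zero_in x)"
  unfolding ideal_in_def
proof (intro conjI ballI)
  show "subring_of (regular_at x)" by (rule regular_subring[OF x])
  show "zero_in x \<subseteq> regular_at x" by (rule zero_in_subset)
  show "0 \<in> zero_in x"
    unfolding zero_in_def by (intro CollectI exI[of _ 0] exI[of _ 1]) simp
  fix f f' assume f': "f' \<in> zero_in x"
  then obtain g' h' d' where f': "f' = ev g' / ev h'" "form d' g'" "form d' h'" "at_pt x h' \<noteq> 0"
    "at_pt x g' = 0"
    unfolding zero_in_def by blast
  show "f + f' \<in> zero_in x" if fz: "f \<in> zero_in x"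
  proof -
    obtain g h d where f: "f = ev g / ev h" "form d g" "form d h" "at_pt x h \<noteq> 0" "at_pt x g = 0"
      using fz unfolding zero_in_def by blast
    have h: "ev h \<noteq> 0" "ev h' \<noteq> 0" using ev_nonzero x f f' by blast+
    have "f + f' = ev (g * h' + g' * h) / ev (h * h')"
      using h by (simp add: f f' poly_at_add poly_at_mult add_frac_eq)
    moreover have "form (d + d') (g * h' + g' * h)"
      using form_add[OF form_mult[OF f(2) f'(3)], of "g' * h"] form_mult[OF f'(2) f(3)]
      by (simp add: add.commute)
    moreover have "form (d + d') (h * h')" "at_pt x (h * h') \<noteq> 0" "at_pt x (g * h' + g' * h) = 0"
      using f f' by (simp_all add: form_mult to_ac.poly_at_mult to_ac.poly_at_add)
    ultimately show ?thesis unfolding zero_in_def by blast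
  qed
  show "f * f' \<in> zero_in x" if fr: "f \<in> regular_at x"
  proof -
    obtain g h d where f: "f = ev g / ev h" "form d g" "form d h" "at_pt x h \<noteq> 0"
      using fr unfolding regular_at_def by blast
    have "f * f' = ev (g * g') / ev (h * h')" by (simp add: f f' poly_at_mult)
    moreover have "form (d + d') (g * g')" "form (d + d') (h * h')" "at_pt x (h * h') \<noteq> 0"
      "at_pt x (g * g') = 0"
      using f f' by (simp_all add: form_mult to_ac.poly_at_mult)
    ultimately show ?thesis unfolding zero_in_def by blast
  qed
qed

lemma const_not_zero_in: "on_curve x \<Longrightarrow> c \<noteq> 0 \<Longrightarrow> \<iota> c \<notin> zero_in x"
  using zero_in_iff[of x 0 "Poly_Mapping.single 0 c" 1] by simp

lemma inverse_regular:
  assumes "on_curve x" "f \<in> regular_at x" "f \<notin> zero_in x"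
  shows "inverse f \<in> regular_at x"
proof -
  obtain g h d where f: "f = ev g / ev h" "form d g" "form d h" "at_pt x h \<noteq> 0"
    using assms(2) unfolding regular_at_def by blast
  then have "at_pt x g \<noteq> 0" using zero_in_iff assms by blast
  then show ?thesis using f unfolding regular_at_def by (auto simp: inverse_eq_divide)
qed

lemma ev_scaled:
  assumes "form d p"
  shows "poly_at \<iota> (c *s \<xi>) p = c ^ d * ev p"
  by (rule poly_at_smult[OF assms])

lemma curve_nonempty: "\<exists>x. on_curve x"
proof -
  obtain P where "P \<in> V" using irreducible by (auto simp: geometrically_irreducible_def)
  then show ?thesis by (cases P rule: proj_cases) (auto simp: on_curve_def)
qed

lemma coordinate_nonzero: "\<exists>i. \<xi> $ i \<noteq> 0"
proof -
  obtain x where x: "on_curve x" using curve_nonempty ..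
  then obtain i where "x $ i \<noteq> 0" by (auto simp: on_curve_def vec_eq_iff)
  then have "ev (mvar i) \<noteq> 0" using ev_nonzero[OF x form_mvar, of i] by simp
  then show ?thesis by auto
qed

text \<open>
  The center of a place on a projective variety. Among the nonzero coordinates of \<open>\<xi>\<close> there is one,
  \<open>\<xi> $ i\<close>, that divides all others in the valuation ring \<open>B\<close>; the values of the quotients
  \<open>\<xi> $ j / \<xi> $ i\<close> are coordinates of a point. It satisfies the equations of the curve because \<open>\<xi>\<close> does,
  and a fraction whose denominator does not vanish at it lies in \<open>B\<close>.
\<close>

lemma center_exists:
  assumes B: "hom_on B \<psi>" and const: "\<And>c. \<iota> c \<in> B" "\<And>c. \<psi> (\<iota> c) = to_ac c"
    and local: "\<And>f. f \<in> B \<Longrightarrow> \<psi> f \<noteq> 0 \<Longrightarrow> inverse f \<in> B"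
    and total: "\<And>f. f \<in> B \<or> inverse f \<in> B"
  shows "\<exists>y. on_curve y \<and> regular_at y \<subseteq> B"
proof -
  note sub = hom_on_subring[OF B]
  have "\<exists>i. \<xi> $ i \<noteq> 0 \<and> (\<forall>j\<in>S. \<xi> $ j / \<xi> $ i \<in> B)" if "finite S" for S
    using that
  proof (induction S rule: finite_induct)
    case empty
    then show ?case using coordinate_nonzero by auto
  next
    case (insert j S)
    then obtain i where i: "\<xi> $ i \<noteq> 0" "\<And>k. k \<in> S \<Longrightarrow> \<xi> $ k / \<xi> $ i \<in> B" by blast
    show ?case
    proof (cases "\<xi> $ j / \<xi> $ i \<in> B")
      case True
      then show ?thesis using i by (intro exI[of _ i]) auto
    next
      case False
      then have j: "\<xi> $ j \<noteq> 0" using subring_zero[OF sub] by auto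
      have ij: "\<xi> $ i / \<xi> $ j \<in> B" using total[of "\<xi> $ j / \<xi> $ i"] False by simp
      have "\<xi> $ k / \<xi> $ j \<in> B" if "k \<in> S" for k
        using subring_mult[OF sub i(2)[OF that] ij] i(1) by simp
      then show ?thesis using j subring_one[OF sub] by (intro exI[of _ j]) auto
    qed
  qed
  from this[of UNIV] obtain i where i: "\<xi> $ i \<noteq> 0" "\<And>j. \<xi> $ j / \<xi> $ i \<in> B" by auto
  define \<eta> where "\<eta> = inverse (\<xi> $ i) *s \<xi>"
  have \<eta>: "\<eta> $ j \<in> B" for j using i(2)[of j] by (simp add: \<eta>_def divide_inverse mult.commute)
  define y where "y = (\<chi> j. \<psi> (\<eta> $ j))"
  have const': "range \<iota> \<subseteq> B" using const(1) by auto
  have \<psi>: "\<psi> (poly_at \<iota> \<eta> p) = at_pt y p" for p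
    using hom_on_poly_at[OF B const' \<eta>, of p] by (simp add: const(2) y_def)
  have in_B: "poly_at \<iota> \<eta> p \<in> B" for p
    by (rule poly_at_in_subring[OF sub const' \<eta>])
  have ev: "poly_at \<iota> \<eta> p = inverse (\<xi> $ i) ^ d * ev p" if "form d p" for p d
    unfolding \<eta>_def by (rule ev_scaled[OF that])
  have "y $ i = 1" using i(1) hom_on_one[OF B] by (simp add: y_def \<eta>_def)
  then have y: "y \<noteq> 0" by auto
  obtain S :: "('a, 'n) mpoly set" where S: "\<And>p. p \<in> S \<Longrightarrow> \<exists>d. form d p"
    "V = zero_locus (to_ac_poly ` S)"
    using closed unfolding closed_over_base_def by blast
  have "zero_at (to_ac_poly p) (pt y)" if p: "p \<in> S" for p
  proof -
    obtain d where d: "form d p" using S(1)[OF p] by blast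
    have "p \<in> vanishing_ideal V"
      using p S(2) by (auto simp: vanishing_ideal_def zero_locus_def)
    then have "poly_at \<iota> \<eta> p = 0" using generic[OF d] ev[OF d] by simp
    then have "at_pt y p = 0" using \<psi>[of p] hom_on_zero[OF B] by simp
    then show ?thesis using zero_at_to_ac[OF d y] by simp
  qed
  then have "pt y \<in> V" unfolding S(2) zero_locus_def by blast
  then have "on_curve y" using y by (simp add: on_curve_def)
  moreover have "regular_at y \<subseteq> B"
  proof
    fix f assume "f \<in> regular_at y"
    then obtain g h d where f: "f = ev g / ev h" "form d g" "form d h" "at_pt y h \<noteq> 0"
      unfolding regular_at_def by blast
    have "f = poly_at \<iota> \<eta> g * inverse (poly_at \<iota> \<eta> h)"
      using i(1) by (simp add: f(1) ev[OF f(2)] ev[OF f(3)] field_simps)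
    moreover have "inverse (poly_at \<iota> \<eta> h) \<in> B"
      using local in_B \<psi> f(4) by simp
    ultimately show "f \<in> B" using subring_mult[OF sub in_B] by simp
  qed
  ultimately show ?thesis by blast
qed

text \<open>
  If \<open>f \<noteq> 0\<close> lies in the maximal ideal of some point, then \<open>1/f\<close> is transcendental over the base field:
  multiplying a relation of degree \<open>n\<close> by \<open>f ^ n\<close> would put its leading coefficient into that ideal. So
  there is a homomorphism with \<open>1/f \<mapsto> 0\<close>. At the center of a place extending it, \<open>f\<close> is regular, hence
  in the valuation ring, and \<open>f * (1/f) = 1\<close> would have the value \<open>0\<close>.
\<close>

theorem regular_everywhere_zero_somewhere:
  assumes reg: "\<And>x. on_curve x \<Longrightarrow> f \<in> regular_at x" and x0: "on_curve x0" "f \<in> zero_in x0"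
  shows "f = 0"
proof (rule ccontr)
  assume "f \<noteq> 0"
  define P where "P p = poly (map_poly \<iota> p) (inverse f)" for p
  have P_add: "P (p + q) = P p + P q" and P_mult: "P (p * q) = P p * P q" for p q
  proof -
    have "map_poly \<iota> (p + q) = map_poly \<iota> p + map_poly \<iota> q"
      by (rule poly_eqI) (simp add: coeff_map_poly emb_add)
    then show "P (p + q) = P p + P q" by (simp add: P_def)
    have "map_poly \<iota> (p * q) = map_poly \<iota> p * map_poly \<iota> q"
      by (rule poly_eqI) (simp add: coeff_map_poly coeff_mult emb_sum emb_mult)
    then show "P (p * q) = P p * P q" by (simp add: P_def)
  qed
  have P_const: "P [:c:] = \<iota> c" for c by (simp add: P_def map_poly_pCons)
  have P_X: "P [:0, 1:] = inverse f" by (simp add: P_def map_poly_pCons)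
  have P_eq_0: "p = 0" if "P p = 0" for p
  proof (rule ccontr)
    assume "p \<noteq> 0"
    define n where "n = degree p"
    have "(\<Sum>i\<le>n. \<iota> (coeff p i) * f ^ (n - i)) = f ^ n * P p"
    proof -
      have "degree (map_poly \<iota> p) \<le> n" 
        by (intro degree_le) (simp add: coeff_map_poly coeff_eq_0 n_def)
      then have "P p = (\<Sum>i\<le>n. coeff (map_poly \<iota> p) i * inverse f ^ i)"
        unfolding P_def poly_altdef
        by (intro sum.mono_neutral_left) (auto simp: coeff_eq_0)
      also have "f ^ n * \<dots> = (\<Sum>i\<le>n. \<iota> (coeff p i) * f ^ (n - i))"
        unfolding sum_distrib_left
      proof (rule sum.cong)
        fix i assume "i \<in> {..n}"
        then have "f ^ n = f ^ (n - i) * f ^ i" by (simp flip: power_add)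
        then show "f ^ n * (coeff (map_poly \<iota> p) i * inverse f ^ i) = \<iota> (coeff p i) * f ^ (n - i)"
          using \<open>f \<noteq> 0\<close> by (simp add: coeff_map_poly power_inverse)
      qed simp
      finally show ?thesis by simp
    qed
    then have "(\<Sum>i<n. \<iota> (coeff p i) * f ^ (n - i)) + \<iota> (lead_coeff p) = 0"
      using that by (simp add: n_def flip: lessThan_Suc_atMost)
    then have "\<iota> (lead_coeff p) = - (\<Sum>i<n. \<iota> (coeff p i) * f ^ (n - i))"
      by (simp add: eq_neg_iff_add_eq_0 add.commute)
    moreover note I = zero_in_ideal[OF x0(1)]
    have "\<iota> (coeff p i) * f ^ (n - i) \<in> zero_in x0" if "i < n" for i
    proof -
      have "f ^ (n - i) = f ^ (n - Suc i) * f"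
        using that by (simp flip: power_Suc2 add: Suc_diff_Suc)
      then show ?thesis
        using x0 zero_in_subset
        by (auto intro!: ideal_in_mult[OF I] const_regular subring_power[OF regular_subring])
    qed
    ultimately have "\<iota> (lead_coeff p) \<in> zero_in x0"
      by (auto intro!: ideal_in_uminus[OF I] ideal_in_sum[OF I])
    then show False using const_not_zero_in[OF x0(1), of "lead_coeff p"] \<open>p \<noteq> 0\<close> by simp
  qed
  have P_inj: "p = q" if "P p = P q" for p q
    using P_eq_0[of "p - q"] P_add[of "p - q" q] that by simp
  \<comment> \<open>The homomorphism \<open>1/f \<mapsto> 0\<close>: a polynomial in \<open>1/f\<close> is sent to its constant coefficient.\<close>
  define \<phi> where "\<phi> a = to_ac (coeff (THE p. P p = a) 0)" for a
  have \<phi>: "\<phi> (P p) = to_ac (coeff p 0)" for p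
  proof -
    have "(THE q. P q = P p) = p" by (rule the_equality) (auto intro: P_inj)
    then show ?thesis by (simp add: \<phi>_def)
  qed
  have "hom_on (range P) \<phi>"
    unfolding hom_on_def subring_of_def
  proof (intro conjI ballI)
    show "1 \<in> range P" using P_const[of 1] by (metis emb_1 rangeI)
    show "\<phi> 1 = 1" using \<phi>[of "[:1:]"] P_const[of 1] by simp
    fix a b assume "a \<in> range P" "b \<in> range P"
    then obtain p q where pq: "a = P p" "b = P q" by auto
    have "a - b = P (p - q)" using P_add[of "p - q" q] by (simp add: pq)
    then show "a - b \<in> range P" by simp
    show "a * b \<in> range P" by (simp add: pq flip: P_mult)
    show "\<phi> (a + b) = \<phi> a + \<phi> b" by (simp add: pq \<phi> flip: P_add)
    show "\<phi> (a * b) = \<phi> a * \<phi> b" by (simp add: pq \<phi> coeff_mult flip: P_mult)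
  qed
  from place_extension[OF this] obtain B \<psi> where B: "hom_on B \<psi>" "range P \<subseteq> B"
    "\<And>a. a \<in> range P \<Longrightarrow> \<psi> a = \<phi> a" "\<And>a. a \<in> B \<Longrightarrow> \<psi> a \<noteq> 0 \<Longrightarrow> inverse a \<in> B"
    "\<And>a. a \<in> B \<or> inverse a \<in> B"
    by blast
  have PB: "P p \<in> B" "\<psi> (P p) = to_ac (coeff p 0)" for p
    using B(2,3) \<phi> by auto
  have "\<exists>y. on_curve y \<and> regular_at y \<subseteq> B"
  proof (rule center_exists[OF B(1) _ _ B(4,5)])
    show "\<iota> c \<in> B" "\<psi> (\<iota> c) = to_ac c" for c using PB[of "[:c:]"] by (simp_all add: P_const)
  qed
  then have f: "f \<in> B" using reg by blast
  have s: "inverse f \<in> B" "\<psi> (inverse f) = 0" using PB[of "[:0, 1:]"] by (simp_all add: P_X)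
  have "\<psi> (f * inverse f) = 0" using hom_on_mult[OF B(1) f s(1)] s(2) by simp
  then show False using \<open>f \<noteq> 0\<close> hom_on_one[OF B(1)] by simp
qed

end

section \<open>The local ring at a nonsingular rational point\<close>

text \<open>
  The rank of a system of vectors over the base field does not grow in the algebraic closure. This
  brings the Jacobian criterion, which speaks of geometric points, down to the base field.
\<close>

lemma dim_to_ac_image:
  fixes G :: "('a::field ^ 'n::finite) set"
  shows "vec.dim ((\<lambda>w. \<chi> i. to_ac (w $ i)) ` G) \<le> vec.dim G"
proof -
  let ?f = "\<lambda>w :: 'a ^ 'n. (\<chi> i. to_ac (w $ i))"
  obtain B where B: "B \<subseteq> G" "vec.independent B" "G \<subseteq> vec.span B" "card B = vec.dim G"
    using vec.basis_exists[of G] by blast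
  have fin: "finite B" using B(2) by (rule vec.finiteI_independent)
  have "?f w \<in> vec.span (?f ` B)" if "w \<in> vec.span B" for w
    using that
  proof (induction rule: vec.span_induct_alt)
    case base
    have "?f 0 = 0" by (simp add: vec_eq_iff)
    then show ?case by (simp add: vec.span_zero)
  next
    case (step c b w)
    have "?f (c *s b + w) = to_ac c *s ?f b + ?f w" by (simp add: vec_eq_iff)
    then show ?case
      using step by (auto intro!: vec.span_add vec.span_scale intro: vec.span_base)
  qed
  then have "?f ` G \<subseteq> vec.span (?f ` B)" using B(3) by blast
  then have "vec.dim (?f ` G) \<le> card (?f ` B)" using fin by (intro vec.dim_le_card) auto
  also have "\<dots> \<le> card B" by (rule card_image_le[OF fin])
  finally show ?thesis using B(4) by simp
qed

text \<open>
  A rational point of the curve, with homogeneous coordinates \<open>a\<close> normalised at the index \<open>i0\<close>.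
\<close>

locale rational_point = curve_model \<iota> V \<xi>
  for \<iota> :: "'a::field \<Rightarrow> 'e::field" and V :: "('a alg_closure, 'n::finite) proj set"
    and \<xi> :: "'e ^ 'n" +
  fixes a :: "'a ^ 'n" and i0 :: 'n and x :: "'a alg_closure ^ 'n"
  assumes a_1: "a $ i0 = 1"
    and x_eq: "x = (\<chi> i. to_ac (a $ i))"
    and x_on: "on_curve x"
begin

abbreviation "A \<equiv> regular_at x"
abbreviation "M \<equiv> zero_in x"

lemmas A_sub = regular_subring[OF x_on]
lemmas M_ideal = zero_in_ideal[OF x_on]

text \<open>
  The coordinates of the generic point in the affine chart around the rational point, and the
  coordinate functions \<open>y $ j\<close> centered at it. The latter generate the maximal ideal.
\<close>

definition \<eta> :: "'e ^ 'n" where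
  "\<eta> = inverse (\<xi> $ i0) *s \<xi>"

definition y :: "'e ^ 'n" where
  "y = \<eta> - (\<chi> i. \<iota> (a $ i))"

lemma at_pt_a: "at_pt x p = to_ac (poly_at (\<lambda>c. c) a p)"
  unfolding x_eq by (rule to_ac.poly_at_emb)

lemma ev_i0: "\<xi> $ i0 \<noteq> 0"
proof -
  have "at_pt x (mvar i0) \<noteq> 0" by (simp add: x_eq a_1)
  then show ?thesis using ev_nonzero[OF x_on form_mvar, of i0] by simp
qed

lemma poly_at_\<eta>: "form d p \<Longrightarrow> poly_at \<iota> \<eta> p = ev p / ev (mvar i0 ^ d)"
  unfolding \<eta>_def by (simp add: ev_scaled poly_at_power power_inverse divide_inverse mult.commute)

lemma at_pt_i0: "at_pt x (mvar i0 ^ d) = 1"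
  by (simp add: to_ac.poly_at_power x_eq a_1)

lemma poly_at_\<eta>_regular: "form d p \<Longrightarrow> poly_at \<iota> \<eta> p \<in> A"
  unfolding regular_at_def
  by (intro CollectI exI[of _ p] exI[of _ "mvar i0 ^ d"] exI[of _ d])
    (simp add: poly_at_\<eta> at_pt_i0)

lemma poly_at_\<eta>_zero_iff:
  assumes "form d p"
  shows "poly_at \<iota> \<eta> p \<in> M \<longleftrightarrow> poly_at (\<lambda>c. c) a p = 0"
  using zero_in_iff[OF x_on assms form_mvar_power, of i0]
  unfolding poly_at_\<eta>[OF assms] at_pt_i0 by (simp add: at_pt_a[of p])

lemma y_zero_in: "y $ j \<in> M"
proof -
  let ?p = "mvar j - Poly_Mapping.single 0 (a $ j) * mvar i0 :: ('a, 'n) mpoly"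
  have p: "form 1 ?p" by (intro form_diff form_mvar form_cmult)
  have "\<eta> $ i0 = 1" using ev_i0 by (simp add: \<eta>_def)
  then have "poly_at \<iota> \<eta> ?p = y $ j" by (simp add: poly_at_diff poly_at_mult y_def)
  moreover have "poly_at (\<lambda>c. c) a ?p = 0"
    by (simp add: field_embedding.poly_at_diff[OF field_embedding_id]
        field_embedding.poly_at_mult[OF field_embedding_id]
        field_embedding.poly_at_mvar[OF field_embedding_id]
        field_embedding.poly_at_const[OF field_embedding_id] a_1)
  ultimately show ?thesis using poly_at_\<eta>_zero_iff[OF p] by simp
qed

lemma y_regular: "y $ j \<in> A"
  using y_zero_in zero_in_subset by blast

lemma y_i0: "y $ i0 = 0"
  using ev_i0 by (simp add: y_def \<eta>_def a_1)

text \<open>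
  Combinations of \<open>t\<close> and of the \<open>y $ j\<close> with \<open>j \<in> S\<close>, where the coefficients of the \<open>y $ j\<close> are taken
  from an ideal \<open>C\<close>. For \<open>t = 0\<close>, \<open>C = M\<close> and \<open>S = UNIV\<close> this is the square of the maximal ideal.
\<close>

definition comb :: "'e \<Rightarrow> 'e set \<Rightarrow> 'n set \<Rightarrow> 'e set" where
  "comb t C S = {b * t + (\<Sum>j\<in>S. c j * y $ j) | b c. b \<in> A \<and> (\<forall>j. c j \<in> C)}"

lemma combI: "b \<in> A \<Longrightarrow> (\<And>j. c j \<in> C) \<Longrightarrow> b * t + (\<Sum>j\<in>S. c j * y $ j) \<in> comb t C S"
  unfolding comb_def by blast

lemma comb_ideal:
  assumes C: "ideal_in A C" and t: "t \<in> A"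
  shows "ideal_in A (comb t C S)"
  unfolding ideal_in_def
proof (intro conjI ballI subsetI)
  show "subring_of A" by (rule A_sub)
  show "0 \<in> comb t C S"
    using combI[of 0 "\<lambda>_. 0" C t S] ideal_in_zero[OF C] subring_zero[OF A_sub] by simp
  fix u assume "u \<in> comb t C S"
  then obtain b c where u: "u = b * t + (\<Sum>j\<in>S. c j * y $ j)" "b \<in> A" "\<And>j. c j \<in> C"
    unfolding comb_def by blast
  show "u \<in> A"
    unfolding u(1) using u(2,3) ideal_in_subset[OF C] t y_regular
    by (intro subring_add[OF A_sub] subring_mult[OF A_sub] subring_sum[OF A_sub]) auto
  show "u + v \<in> comb t C S" if v: "v \<in> comb t C S" for v
  proof -
    obtain b' c' where v: "v = b' * t + (\<Sum>j\<in>S. c' j * y $ j)" "b' \<in> A" "\<And>j. c' j \<in> C"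
      using v unfolding comb_def by blast
    have "u + v = (b + b') * t + (\<Sum>j\<in>S. (c j + c' j) * y $ j)"
      by (simp add: u(1) v(1) distrib_right sum.distrib)
    then show ?thesis
      using u v combI[of "b + b'" "\<lambda>j. c j + c' j" C t S]
      by (simp add: subring_add[OF A_sub] ideal_in_add[OF C])
  qed
next
  fix r v assume r: "r \<in> A" and "v \<in> comb t C S"
  then obtain b c where v: "v = b * t + (\<Sum>j\<in>S. c j * y $ j)" "b \<in> A" "\<And>j. c j \<in> C"
    unfolding comb_def by blast
  have "r * v = (r * b) * t + (\<Sum>j\<in>S. (r * c j) * y $ j)"
    by (simp add: v(1) distrib_left sum_distrib_left mult.assoc)
  then show "r * v \<in> comb t C S"
    using r v combI[of "r * b" "\<lambda>j. r * c j" C t S]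
    by (simp add: subring_mult[OF A_sub] ideal_in_mult[OF C])
qed

lemma A_ideal: "ideal_in A A"
  using A_sub by (simp add: ideal_in_def subring_zero subring_add subring_mult)

lemma y_in_comb:
  assumes "j \<in> S" "c \<in> C" "ideal_in A C"
  shows "c * y $ j \<in> comb t C S"
proof -
  have "(\<Sum>k\<in>S. (if k = j then c else 0) * y $ k) = c * y $ j"
    using assms(1) by (simp add: if_distrib[of "\<lambda>z. z * _"] cong: if_cong)
  then show ?thesis
    using combI[of 0 "\<lambda>k. if k = j then c else 0" C t S] assms ideal_in_zero[OF assms(3)]
      subring_zero[OF A_sub] by auto
qed

lemma taylor:
  assumes C: "ideal_in A C" and "\<And>i j. y $ i * y $ j \<in> C"
  shows "poly_at \<iota> \<eta> p - \<iota> (poly_at (\<lambda>c. c) a p)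
    - (\<Sum>j\<in>UNIV. \<iota> (poly_at (\<lambda>c. c) a (mp_deriv j p)) * y $ j) \<in> C"
proof -
  have "\<eta> = (\<chi> i. \<iota> (a $ i)) + y" by (simp add: y_def)
  from poly_taylor[OF C _ this, of p] show ?thesis
    using assms(2) const_regular y_regular by (auto simp: poly_at_emb)
qed

text \<open>
  By Taylor's formula to first order, a numerator that vanishes at \<open>a\<close> is a combination of the \<open>y $ j\<close>.
\<close>

lemma M_generated:
  assumes "f \<in> M"
  shows "f \<in> comb 0 A UNIV"
proof -
  let ?I = "comb 0 A UNIV"
  have I: "ideal_in A ?I" by (rule comb_ideal[OF A_ideal subring_zero[OF A_sub]])
  obtain g h d where f: "f = ev g / ev h" "form d g" "form d h" "at_pt x h \<noteq> 0" "at_pt x g = 0"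
    using assms unfolding zero_in_def by blast
  have g: "poly_at (\<lambda>c. c) a g = 0" using f(5) by (simp add: at_pt_a)
  have h: "poly_at \<iota> \<eta> h \<in> A" "poly_at \<iota> \<eta> h \<notin> M"
    using poly_at_\<eta>_regular[OF f(3)] poly_at_\<eta>_zero_iff[OF f(3)] f(4) by (auto simp: at_pt_a)
  have yC: "b * y $ j \<in> ?I" if "b \<in> A" for b j
    by (rule y_in_comb[OF _ that A_ideal]) simp
  have "poly_at \<iota> \<eta> g - (\<Sum>j\<in>UNIV. \<iota> (poly_at (\<lambda>c. c) a (mp_deriv j g)) * y $ j) \<in> ?I"
    using taylor[OF I, of g] yC y_regular g by simp
  moreover have "(\<Sum>j\<in>UNIV. \<iota> (poly_at (\<lambda>c. c) a (mp_deriv j g)) * y $ j) \<in> ?I"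
    by (intro ideal_in_sum[OF I] yC const_regular)
  ultimately have "poly_at \<iota> \<eta> g \<in> ?I" using ideal_in_add[OF I] by fastforce
  then have "inverse (poly_at \<iota> \<eta> h) * poly_at \<iota> \<eta> g \<in> ?I"
    using inverse_regular[OF x_on h] by (intro ideal_in_mult[OF I])
  also have "inverse (poly_at \<iota> \<eta> h) * poly_at \<iota> \<eta> g = f"
    using ev_i0 by (simp add: f(1) poly_at_\<eta>[OF f(2)] poly_at_\<eta>[OF f(3)] poly_at_power
        field_simps)
  finally show ?thesis .
qed

definition grad :: "('a, 'n) mpoly \<Rightarrow> 'a ^ 'n" where
  "grad p = (\<chi> j. poly_at (\<lambda>c. c) a (mp_deriv j p))"

text \<open>
  The rows of the Jacobian matrix at \<open>a\<close>. Each of them is the coefficient vector of a linear relation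
  between the classes of the \<open>y $ j\<close> in the cotangent space.
\<close>

definition cotangent_relations :: "('a ^ 'n) set" where
  "cotangent_relations = {grad p | p. p \<in> vanishing_ideal V \<and> (\<exists>d. form d p)}"

definition lin_y :: "'a ^ 'n \<Rightarrow> 'e" where
  "lin_y c = (\<Sum>j\<in>UNIV. \<iota> (c $ j) * y $ j)"

lemma lin_y_add: "lin_y (c + c') = lin_y c + lin_y c'"
  by (simp add: lin_y_def emb_add distrib_right sum.distrib)

lemma lin_y_scale: "lin_y (r *s c) = \<iota> r * lin_y c"
  by (simp add: lin_y_def emb_mult sum_distrib_left mult.assoc)

lemma lin_y_axis: "lin_y (axis j 1) = y $ j"
  by (simp add: lin_y_def axis_def if_distrib[of \<iota>] if_distrib[of "\<lambda>z. z * _"] cong: if_cong)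

lemma lin_y_zero_in: "lin_y c \<in> M"
  unfolding lin_y_def
  by (intro ideal_in_sum[OF M_ideal] ideal_in_mult[OF M_ideal] const_regular y_zero_in)

lemma vanishing_at_a:
  assumes "p \<in> vanishing_ideal V"
  shows "poly_at (\<lambda>c. c) a p = 0"
  using vanishing_idealD[OF assms, of x] x_on by (simp add: on_curve_def at_pt_a)

text \<open>
  A form \<open>p\<close> in the vanishing ideal is zero both at \<open>\<eta>\<close> and at \<open>a\<close>, so Taylor's formula reduces to its
  linear term.
\<close>

lemma relation_in_square:
  assumes "w \<in> cotangent_relations"
  shows "lin_y w \<in> comb 0 M UNIV"
proof -
  let ?J = "comb 0 M UNIV"
  have J: "ideal_in A ?J" by (rule comb_ideal[OF M_ideal subring_zero[OF A_sub]])
  obtain p d where p: "w = grad p" "p \<in> vanishing_ideal V" "form d p"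
    using assms unfolding cotangent_relations_def by blast
  have "poly_at \<iota> \<eta> p = 0" using generic[OF p(3)] p(2) by (simp add: poly_at_\<eta>[OF p(3)])
  moreover have "y $ i * y $ j \<in> ?J" for i j
    by (rule y_in_comb[OF _ y_zero_in M_ideal]) simp
  ultimately have "- lin_y w \<in> ?J"
    using taylor[OF J, of p] vanishing_at_a[OF p(2)] by (simp add: lin_y_def p(1) grad_def)
  then show ?thesis using ideal_in_uminus[OF J] by fastforce
qed

lemma cotangent_relations_dim:
  assumes "nonsingular_curve V"
  shows "CARD('n) \<le> vec.dim cotangent_relations + 2"
proof -
  have eq: "{gradient (to_ac_poly p) x | p. p \<in> vanishing_ideal V \<and> (\<exists>d. form d p)} =
      (\<lambda>w. \<chi> i. to_ac (w $ i)) ` cotangent_relations"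
  proof -
    have "gradient (to_ac_poly p) x = (\<chi> i. to_ac (grad p $ i))" for p :: "('a, 'n) mpoly"
    proof -
      have "mp_eval (mp_deriv j (to_ac_poly p)) x = at_pt x (mp_deriv j p)" for j
        unfolding mp_eval_eq_poly_at to_ac.poly_at_mp_deriv
          field_embedding.poly_at_mp_deriv[OF field_embedding_id]
          supp_to_ac_poly cf_to_ac_poly ..
      then show ?thesis by (simp add: gradient_def grad_def at_pt_a)
    qed
    then show ?thesis unfolding cotangent_relations_def by (auto simp: image_def)
  qed
  have "vec.dim {gradient (to_ac_poly p) x | p. p \<in> vanishing_ideal V \<and> (\<exists>d. form d p)} + 2 = CARD('n)"
    using assms x_on unfolding nonsingular_curve_def on_curve_def by blast
  then have "vec.dim ((\<lambda>w. \<chi> i. to_ac (w $ i)) ` cotangent_relations) + 2 = CARD('n)"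
    unfolding eq .
  then show ?thesis using dim_to_ac_image[of cotangent_relations] by linarith
qed

text \<open>
  The relations span a space of codimension at most two. By Euler's formula they are orthogonal to \<open>a\<close>,
  which the unit vector at \<open>i0\<close> is not, so adding this vector leaves codimension at most one, and one
  more vector \<open>c\<close> suffices.
\<close>

lemma spanning_direction:
  assumes "nonsingular_curve V"
  shows "\<exists>c. vec.span (insert c (insert (axis i0 1) cotangent_relations)) = UNIV"
proof -
  let ?G = cotangent_relations
  let ?H = "insert (axis i0 1) ?G"
  have euler: "(\<Sum>j\<in>UNIV. a $ j * w $ j) = 0" if "w \<in> vec.span ?G" for w
    using that
  proof (induction rule: vec.span_induct_alt)
    case (step c b w)
    obtain p d where p: "b = grad p" "p \<in> vanishing_ideal V" "form d p"
      using step(1) unfolding cotangent_relations_def by blast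
    have "(\<Sum>j\<in>UNIV. a $ j * b $ j) = 0"
      using field_embedding.euler_form[OF field_embedding_id p(3), of a] vanishing_at_a[OF p(2)]
      by (simp add: p(1) grad_def)
    moreover have "(\<Sum>j\<in>UNIV. a $ j * (c *s b + w) $ j) =
        c * (\<Sum>j\<in>UNIV. a $ j * b $ j) + (\<Sum>j\<in>UNIV. a $ j * w $ j)"
      by (simp add: distrib_left sum.distrib sum_distrib_left mult.left_commute)
    ultimately show ?case using step by simp
  qed simp
  have "axis i0 1 \<notin> vec.span ?G"
  proof
    assume "axis i0 1 \<in> vec.span ?G"
    from euler[OF this] show False
      by (simp add: axis_def a_1 if_distrib[of "\<lambda>z. _ * z"] cong: if_cong)
  qed
  then have H: "CARD('n) \<le> vec.dim ?H + 1"
    using cotangent_relations_dim[OF assms] by (simp add: vec.dim_insert)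
  show ?thesis
  proof (cases "vec.span ?H = UNIV")
    case True
    then show ?thesis using vec.span_mono[of ?H "insert c ?H" for c] by blast
  next
    case False
    then obtain c where c: "c \<notin> vec.span ?H" by blast
    then have "CARD('n) \<le> vec.dim (insert c ?H)" using H by (simp add: vec.dim_insert)
    then have "vec.dim (insert c ?H) = CARD('n)"
      by (intro order_antisym dim_subset_UNIV_cart_gen)
    then have "vec.span (insert c ?H) = UNIV"
      using vec.dim_eq_full[of "insert c ?H"] by (simp add: vec.dimension_def card_cart_basis)
    then show ?thesis by blast
  qed
qed

text \<open>
  The linear map \<open>lin_y\<close> sends the Jacobian relations into the square of the maximal ideal and the unit
  vector at \<open>i0\<close> to \<open>y $ i0 = 0\<close>. So modulo this square its image is spanned by the image \<open>t\<close> of the one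
  remaining direction.
\<close>

lemma maximal_ideal_modulo_square:
  assumes "nonsingular_curve V"
  shows "\<exists>t\<in>M. \<forall>j. y $ j \<in> comb t M UNIV"
proof -
  obtain c0 where c0: "vec.span (insert c0 (insert (axis i0 1) cotangent_relations)) = UNIV"
    using spanning_direction[OF assms] by blast
  define t where "t = lin_y c0"
  have t: "t \<in> M" "t \<in> A" unfolding t_def using lin_y_zero_in zero_in_subset by blast+
  let ?T = "{c. lin_y c \<in> comb t M UNIV}"
  have I: "ideal_in A (comb t M UNIV)" by (rule comb_ideal[OF M_ideal t(2)])
  have "vec.subspace ?T"
    unfolding vec.subspace_def
    using ideal_in_zero[OF I] ideal_in_add[OF I] ideal_in_mult[OF I const_regular]
    by (auto simp: lin_y_add lin_y_scale) (simp add: lin_y_def)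
  moreover have "insert c0 (insert (axis i0 1) cotangent_relations) \<subseteq> ?T"
  proof -
    have "lin_y c0 \<in> comb t M UNIV"
      using combI[of 1 "\<lambda>_. 0" M t UNIV] subring_one[OF A_sub] ideal_in_zero[OF M_ideal]
      by (simp add: t_def)
    moreover have "lin_y (axis i0 1) \<in> comb t M UNIV"
      using ideal_in_zero[OF I] by (simp add: lin_y_axis y_i0)
    moreover have "lin_y w \<in> comb t M UNIV" if w: "w \<in> cotangent_relations" for w
    proof -
      obtain c where "lin_y w = (\<Sum>j\<in>UNIV. c j * y $ j)" "\<And>j. c j \<in> M"
        using relation_in_square[OF w] unfolding comb_def by auto
      then show ?thesis using combI[of 0 c M t UNIV] subring_zero[OF A_sub] by simp
    qed
    ultimately show ?thesis by blast
  qed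
  ultimately have "vec.span (insert c0 (insert (axis i0 1) cotangent_relations)) \<subseteq> ?T"
    by (intro vec.span_minimal)
  then have "lin_y (axis j 1) \<in> comb t M UNIV" for j using c0 by auto
  then show ?thesis using t(1) by (auto simp: lin_y_axis)
qed

text \<open>
  Nakayama's lemma by removing the generators \<open>y $ k\<close> one at a time: in an expression of \<open>y $ k\<close> by \<open>t\<close>
  and the remaining generators, with coefficients of the latter in the maximal ideal, the term with
  \<open>y $ k\<close> can be moved to the left-hand side, where \<open>1 - c k\<close> is a unit.
\<close>

lemma nakayama:
  assumes t: "t \<in> M" and y: "\<And>j. y $ j \<in> comb t M UNIV" and "finite S"
  shows "\<forall>j. y $ j \<in> comb t A (UNIV - S)"
  using \<open>finite S\<close>
proof (induction S rule: finite_induct)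
  case empty
  have "comb t M UNIV \<subseteq> comb t A UNIV" unfolding comb_def using zero_in_subset by blast
  then show ?case using y by auto
next
  case (insert k S)
  have tA: "t \<in> A" using t zero_in_subset by blast
  let ?S = "UNIV - S"
  let ?S' = "UNIV - insert k S"
  have I: "ideal_in A (comb t M ?S)" by (rule comb_ideal[OF M_ideal tA])
  have I': "ideal_in A (comb t A ?S')" by (rule comb_ideal[OF A_ideal tA])
  have MT: "b * u \<in> comb t M ?S" if bu: "b \<in> M" "u \<in> comb t A ?S" for b u
  proof -
    obtain r c where u: "u = r * t + (\<Sum>j\<in>?S. c j * y $ j)" "r \<in> A" "\<And>j. c j \<in> A"
      using bu(2) unfolding comb_def by blast
    have bA: "b \<in> A" using bu(1) zero_in_subset by blast
    have "b * u = (b * r) * t + (\<Sum>j\<in>?S. (c j * b) * y $ j)"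
      by (simp add: u(1) distrib_left sum_distrib_left ac_simps)
    then show ?thesis
      using combI[of "b * r" "\<lambda>j. c j * b" M t ?S] u bu(1) bA
      by (simp add: subring_mult[OF A_sub] ideal_in_mult[OF M_ideal])
  qed
  have tI: "r * t \<in> comb t C X'" if "r \<in> A" "ideal_in A C" for r C X'
    using combI[of r "\<lambda>_. 0" C t X'] that ideal_in_zero[OF that(2)] by simp
  have "y $ k \<in> comb t M ?S"
  proof -
    obtain r c where u: "y $ k = r * t + (\<Sum>j\<in>UNIV. c j * y $ j)" "r \<in> A" "\<And>j. c j \<in> M"
      using y[of k] unfolding comb_def by blast
    show ?thesis
      unfolding u(1)
      by (intro ideal_in_add[OF I] ideal_in_sum[OF I] MT tI M_ideal u insert.IH[rule_format])
  qed
  then obtain r c where u: "y $ k = r * t + (\<Sum>j\<in>?S. c j * y $ j)" "r \<in> A" "\<And>j. c j \<in> M"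
    unfolding comb_def by blast
  have "(\<Sum>j\<in>?S. c j * y $ j) = c k * y $ k + (\<Sum>j\<in>?S'. c j * y $ j)"
  proof -
    have "?S = insert k ?S'" using insert.hyps by auto
    then show ?thesis by (metis (no_types, lifting) DiffE finite insertI1 sum.insert)
  qed
  then have "(1 - c k) * y $ k = r * t + (\<Sum>j\<in>?S'. c j * y $ j)"
    using u(1) by (simp add: algebra_simps)
  moreover have "\<dots> \<in> comb t A ?S'"
    using u zero_in_subset by (intro combI) blast+
  ultimately have *: "(1 - c k) * y $ k \<in> comb t A ?S'" by simp
  have ck: "c k \<in> A" using u(3) zero_in_subset by blast
  have "1 - c k \<notin> M"
  proof
    assume "1 - c k \<in> M"
    then have "1 \<in> M" using ideal_in_add[OF M_ideal _ u(3)[of k], of "1 - c k"] by simp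
    then show False using const_not_zero_in[OF x_on, of 1] by simp
  qed
  then have inv: "inverse (1 - c k) \<in> A" and nz: "1 - c k \<noteq> 0"
    using inverse_regular[OF x_on] ck subring_diff[OF A_sub subring_one[OF A_sub]]
      ideal_in_zero[OF M_ideal] by auto
  have "inverse (1 - c k) * ((1 - c k) * y $ k) \<in> comb t A ?S'"
    by (rule ideal_in_mult[OF I' inv *])
  then have yk: "y $ k \<in> comb t A ?S'" using nz by (simp flip: mult.assoc)
  show ?case
  proof
    fix j
    obtain r c where u: "y $ j = r * t + (\<Sum>j\<in>?S. c j * y $ j)" "r \<in> A" "\<And>j. c j \<in> A"
      using insert.IH unfolding comb_def by blast
    have "c l * y $ l \<in> comb t A ?S'" if "l \<in> ?S" for l
    proof (cases "l = k")
      case True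
      then show ?thesis using ideal_in_mult[OF I' u(3) yk] by simp
    next
      case False
      then show ?thesis using that u(3) A_ideal by (intro y_in_comb) auto
    qed
    then show "y $ j \<in> comb t A ?S'"
      unfolding u(1) by (intro ideal_in_add[OF I'] ideal_in_sum[OF I'] tI A_ideal u)
  qed
qed

lemma maximal_ideal_principal:
  assumes "nonsingular_curve V"
  shows "\<exists>t\<in>A. M = (\<lambda>z. t * z) ` A"
proof -
  obtain t where t: "t \<in> M" "\<And>j. y $ j \<in> comb t M UNIV"
    using maximal_ideal_modulo_square[OF assms] by blast
  have yt: "\<exists>r\<in>A. y $ j = t * r" for j
    using nakayama[OF t finite[of UNIV]] by (auto simp: comb_def mult.commute)
  then obtain r where r: "\<And>j. r j \<in> A" "\<And>j. y $ j = t * r j" by metis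
  have "M = (\<lambda>z. t * z) ` A"
  proof (intro equalityI subsetI)
    fix f assume "f \<in> M"
    then obtain c where c: "f = (\<Sum>j\<in>UNIV. c j * y $ j)" "\<And>j. c j \<in> A"
      using M_generated[of f] unfolding comb_def by auto
    then have "f = t * (\<Sum>j\<in>UNIV. c j * r j)"
      by (simp add: r(2) sum_distrib_left ac_simps)
    moreover have "(\<Sum>j\<in>UNIV. c j * r j) \<in> A"
      using c r by (intro subring_sum[OF A_sub] subring_mult[OF A_sub])
    ultimately show "f \<in> (\<lambda>z. t * z) ` A" by blast
  next
    fix f assume "f \<in> (\<lambda>z. t * z) ` A"
    then show "f \<in> M" using ideal_in_mult[OF M_ideal _ t(1)] by (auto simp: mult.commute)
  qed
  then show ?thesis using t(1) zero_in_subset by blast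
qed

lemma fun_field_quotients: "fun_field = {u / w | u w. u \<in> A \<and> w \<in> A \<and> w \<noteq> 0}"
proof (intro equalityI subsetI)
  fix f assume "f \<in> fun_field"
  then obtain g h d where f: "f = ev g / ev h" "form d g" "form d h" "ev h \<noteq> 0"
    unfolding fun_field_def by blast
  have nz: "ev (mvar i0 ^ d) \<noteq> 0" using ev_i0 by (simp add: poly_at_power)
  have "f = poly_at \<iota> \<eta> g / poly_at \<iota> \<eta> h" "poly_at \<iota> \<eta> h \<noteq> 0"
    unfolding poly_at_\<eta>[OF f(2)] poly_at_\<eta>[OF f(3)] f(1) using nz f(4) by simp_all
  then show "f \<in> {u / w | u w. u \<in> A \<and> w \<in> A \<and> w \<noteq> 0}"
    using poly_at_\<eta>_regular f by blast
next
  fix f assume "f \<in> {u / w | u w. u \<in> A \<and> w \<in> A \<and> w \<noteq> 0}"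
  then obtain u w where uw: "f = u / w" "u \<in> A" "w \<in> A" "w \<noteq> 0" by blast
  obtain g h d where u: "u = ev g / ev h" "form d g" "form d h" "at_pt x h \<noteq> 0"
    using uw(2) unfolding regular_at_def by blast
  obtain g' h' d' where w: "w = ev g' / ev h'" "form d' g'" "form d' h'" "at_pt x h' \<noteq> 0"
    using uw(3) unfolding regular_at_def by blast
  have nz: "ev h \<noteq> 0" "ev h' \<noteq> 0" "ev g' \<noteq> 0"
    using ev_nonzero[OF x_on] u w uw(4) by auto
  have "f = ev (g * h') / ev (h * g')" by (simp add: uw(1) u(1) w(1) poly_at_mult)
  moreover have "form (d + d') (g * h')" "form (d + d') (h * g')" "ev (h * g') \<noteq> 0"
    using u w nz by (simp_all add: form_mult poly_at_mult)
  ultimately show "f \<in> fun_field" unfolding fun_field_def by blast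
qed

lemma residue_rational:
  assumes "f \<in> A"
  shows "\<exists>c. f - \<iota> c \<in> M"
proof -
  obtain g h d where f: "f = ev g / ev h" "form d g" "form d h" "at_pt x h \<noteq> 0"
    using assms unfolding regular_at_def by blast
  define c where "c = poly_at (\<lambda>c. c) a g / poly_at (\<lambda>c. c) a h"
  let ?g = "g - Poly_Mapping.single 0 c * h"
  have h: "poly_at (\<lambda>c. c) a h \<noteq> 0" using f(4) by (simp add: at_pt_a)
  have "f - \<iota> c = ev ?g / ev h"
    using ev_nonzero[OF x_on f(3,4)] by (simp add: f(1) poly_at_diff poly_at_mult diff_divide_distrib)
  moreover have "form d ?g" using f by (intro form_diff form_cmult)
  moreover have "at_pt x ?g = 0"
    using h by (simp add: to_ac.poly_at_diff to_ac.poly_at_mult at_pt_a c_def)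
  ultimately show ?thesis using f unfolding zero_in_def by blast
qed

text \<open>
  The generator \<open>t\<close> of the maximal ideal is nonzero: otherwise the local ring, and with it the function
  field, would consist of constants.
\<close>

theorem local_ring_dvr:
  assumes nonsing: "nonsingular_curve V"
    and dep: "\<And>f g. f \<in> fun_field \<Longrightarrow> g \<in> fun_field \<Longrightarrow> alg_dependent f g"
    and nonconst: "s \<in> fun_field" "s \<notin> range \<iota>"
  shows "\<exists>t. dvr \<iota> A M t"
proof -
  obtain t where t: "t \<in> A" "M = (\<lambda>z. t * z) ` A" using maximal_ideal_principal[OF nonsing] by blast
  have "t \<noteq> 0"
  proof
    assume "t = 0"
    then have "M \<subseteq> {0}" using t(2) by auto
    then have const: "f \<in> range \<iota>" if "f \<in> A" for f
      using residue_rational[OF that] by auto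
    obtain u w where "s = u / w" "u \<in> A" "w \<in> A"
      using nonconst(1) unfolding fun_field_quotients by blast
    then obtain b c where "s = \<iota> b / \<iota> c" using const by blast
    then have "s = \<iota> (b / c)" by (simp add: emb_divide)
    then show False using nonconst(2) by blast
  qed
  have AK: "A \<subseteq> fun_field"
  proof
    fix f assume "f \<in> A"
    then have "f = f / 1 \<and> f \<in> A \<and> 1 \<in> A \<and> (1::'e) \<noteq> 0" using subring_one[OF A_sub] by simp
    then show "f \<in> fun_field" unfolding fun_field_quotients by blast
  qed
  have "dvr \<iota> A M t"
  proof
    show "1 \<notin> M" using const_not_zero_in[OF x_on, of 1] by simp
    show "subring_of A" by (rule A_sub)
    show "\<iota> c \<in> A" for c by (rule const_regular)
    show "inverse f \<in> A" if "f \<in> A" "f \<notin> M" for f using inverse_regular[OF x_on that] .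
    show "\<exists>c. f - \<iota> c \<in> M" if "f \<in> A" for f using residue_rational[OF that] .
    show "alg_dependent f t" if "f \<in> A" for f using dep AK that t(1) by blast
  qed (use t \<open>t \<noteq> 0\<close> in auto)
  then show ?thesis ..
qed

end

section \<open>The function field of the curve as a subfield\<close>

context curve_model
begin

abbreviation FF where "FF \<equiv> function_field V"

text \<open>
  An element of the function field of \<open>V\<close> is a class of pairs of forms with the same value at the
  generic point; \<open>\<Phi>\<close> maps it to this value. This is an isomorphism onto \<open>fun_field\<close>.
\<close>

definition quot :: "('a, 'n) mpoly \<times> ('a, 'n) mpoly \<Rightarrow> 'e" where
  "quot p = ev (fst p) / ev (snd p)"

definition \<Phi> :: "(('a, 'n) mpoly \<times> ('a, 'n) mpoly) set \<Rightarrow> 'e" where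
  "\<Phi> f = quot (SOME p. p \<in> f)"

lemma fractions_iff: "p \<in> fractions V \<longleftrightarrow> (\<exists>d. form d (fst p) \<and> form d (snd p)) \<and> ev (snd p) \<noteq> 0"
  by (cases p) (auto simp: fractions_def generic)

lemma frac_rel_iff: "(p, q) \<in> frac_rel V \<longleftrightarrow> p \<in> fractions V \<and> q \<in> fractions V \<and> quot p = quot q"
proof (cases "p \<in> fractions V \<and> q \<in> fractions V")
  case True
  obtain g h g' h' where pq: "p = (g, h)" "q = (g', h')" by (metis surj_pair)
  obtain d d' where d: "form d g" "form d h" "form d' g'" "form d' h'" "ev h \<noteq> 0" "ev h' \<noteq> 0"
    using True by (auto simp: fractions_iff pq)
  have "form (d + d') (g * h' - g' * h)"
    using form_diff[OF form_mult[OF d(1,4)], of "g' * h"] form_mult[OF d(3,2)] by (simp add: add.commute)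
  then have "g * h' - g' * h \<in> vanishing_ideal V \<longleftrightarrow> ev (g * h' - g' * h) = 0"
    using generic by blast
  also have "\<dots> \<longleftrightarrow> quot p = quot q"
    using d by (simp add: quot_def pq poly_at_diff poly_at_mult frac_eq_eq)
  finally show ?thesis using True by (simp add: frac_rel_def pq)
qed (auto simp: frac_rel_def)

lemma frac_eq: "(g, h) \<in> fractions V \<Longrightarrow> frac V g h = {q \<in> fractions V. quot q = ev g / ev h}"
  by (auto simp: frac_def frac_rel_iff quot_def)

lemma carrier_FF: "carrier FF = (\<lambda>p. {q \<in> fractions V. quot q = quot p}) ` fractions V"
proof -
  have "frac_rel V `` {p} = {q \<in> fractions V. quot q = quot p}" if "p \<in> fractions V" for p
    using that by (auto simp: frac_rel_iff)
  then show ?thesis by (auto simp: function_field_def quotient_def)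
qed

lemma frac_in_carrier: "(g, h) \<in> fractions V \<Longrightarrow> frac V g h \<in> carrier FF"
  unfolding carrier_FF by (rule image_eqI[of _ _ "(g, h)"]) (simp_all add: frac_eq quot_def)

lemma mem_iff:
  assumes "f \<in> carrier FF"
  shows "p \<in> f \<longleftrightarrow> p \<in> fractions V \<and> quot p = \<Phi> f"
proof -
  obtain p0 where p0: "p0 \<in> fractions V" "f = {q \<in> fractions V. quot q = quot p0}"
    using assms unfolding carrier_FF by blast
  have "(SOME p. p \<in> f) \<in> f" by (rule someI[of _ p0]) (use p0 in simp)
  then have "\<Phi> f = quot p0" unfolding \<Phi>_def p0(2) by simp
  then show ?thesis by (simp add: p0(2))
qed

lemma carrier_obtain:
  assumes "f \<in> carrier FF"
  obtains g h where "(g, h) \<in> f" "(g, h) \<in> fractions V" "\<Phi> f = ev g / ev h"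
proof -
  obtain g h where p0: "(g, h) \<in> fractions V" "f = {q \<in> fractions V. quot q = quot (g, h)}"
    using assms unfolding carrier_FF by auto
  then have "(g, h) \<in> f" by simp
  then show ?thesis using that mem_iff[OF assms] by (auto simp: quot_def)
qed

lemma \<Phi>_frac: "(g, h) \<in> fractions V \<Longrightarrow> \<Phi> (frac V g h) = ev g / ev h"
  using mem_iff[OF frac_in_carrier, of g h "(g, h)"] by (auto simp: frac_eq quot_def)

lemma \<Phi>_inj: "f \<in> carrier FF \<Longrightarrow> f' \<in> carrier FF \<Longrightarrow> \<Phi> f = \<Phi> f' \<longleftrightarrow> f = f'"
  by (auto simp: mem_iff)

lemma \<Phi>_image: "\<Phi> ` carrier FF = fun_field"
proof (intro equalityI subsetI)
  fix e assume "e \<in> \<Phi> ` carrier FF"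
  then obtain f where "f \<in> carrier FF" "e = \<Phi> f" by blast
  then show "e \<in> fun_field"
    by (elim carrier_obtain) (auto simp: fun_field_def fractions_iff)
next
  fix e assume "e \<in> fun_field"
  then obtain g h d where "e = ev g / ev h" "form d g" "form d h" "ev h \<noteq> 0"
    unfolding fun_field_def by blast
  moreover from this have "(g, h) \<in> fractions V" by (auto simp: fractions_iff)
  ultimately show "e \<in> \<Phi> ` carrier FF"
    using \<Phi>_frac frac_in_carrier by (intro image_eqI[of _ _ "frac V g h"]) auto
qed

lemma \<Phi>_lift:
  assumes "e \<in> fun_field"
  obtains f where "f \<in> carrier FF" "\<Phi> f = e"
  using assms unfolding \<Phi>_image[symmetric] by blast

lemma FF_mult:
  assumes A: "f \<in> carrier FF" and B: "f' \<in> carrier FF"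
  shows "f \<otimes>\<^bsub>FF\<^esub> f' \<in> carrier FF \<and> \<Phi> (f \<otimes>\<^bsub>FF\<^esub> f') = \<Phi> f * \<Phi> f'"
proof -
  have fr: "(g * g', h * h') \<in> fractions V" if "(g, h) \<in> f" "(g', h') \<in> f'" for g h g' h'
    using that form_mult by (fastforce simp: mem_iff[OF A] mem_iff[OF B] fractions_iff poly_at_mult)
  have eq: "frac V (g * g') (h * h') = {q \<in> fractions V. quot q = \<Phi> f * \<Phi> f'}"
    if "(g, h) \<in> f" "(g', h') \<in> f'" for g h g' h'
    using that fr[OF that] by (simp add: frac_eq mem_iff[OF A] mem_iff[OF B] poly_at_mult quot_def
        flip: times_divide_times_eq)
  obtain g h where gh: "(g, h) \<in> f" using A by (rule carrier_obtain)
  obtain g' h' where gh': "(g', h') \<in> f'" using B by (rule carrier_obtain)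
  have "f \<otimes>\<^bsub>FF\<^esub> f' = (\<Union>(g, h)\<in>f. \<Union>(g', h')\<in>f'. frac V (g * g') (h * h'))"
    by (simp add: function_field_def)
  also have "\<dots> = (\<Union>(g, h)\<in>f. \<Union>(g', h')\<in>f'. {q \<in> fractions V. quot q = \<Phi> f * \<Phi> f'})"
    using eq by (intro SUP_cong refl) auto
  also have "\<dots> = frac V (g * g') (h * h')"
    using gh gh' eq[OF gh gh'] by auto
  finally have eq': "f \<otimes>\<^bsub>FF\<^esub> f' = frac V (g * g') (h * h')" .
  have "\<Phi> f = ev g / ev h" "\<Phi> f' = ev g' / ev h'"
    using gh gh' by (simp_all add: mem_iff[OF A] mem_iff[OF B] quot_def)
  then show ?thesis
    unfolding eq' using frac_in_carrier[OF fr[OF gh gh']] \<Phi>_frac[OF fr[OF gh gh']]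
    by (simp add: poly_at_mult)
qed

lemma FF_add:
  assumes A: "f \<in> carrier FF" and B: "f' \<in> carrier FF"
  shows "f \<oplus>\<^bsub>FF\<^esub> f' \<in> carrier FF \<and> \<Phi> (f \<oplus>\<^bsub>FF\<^esub> f') = \<Phi> f + \<Phi> f'"
proof -
  have fr: "(g * h' + g' * h, h * h') \<in> fractions V \<and>
      ev (g * h' + g' * h) / ev (h * h') = \<Phi> f + \<Phi> f'"
    if ghf: "(g, h) \<in> f" "(g', h') \<in> f'" for g h g' h'
  proof -
    obtain d d' where d: "form d g" "form d h" "ev h \<noteq> 0" "form d' g'" "form d' h'" "ev h' \<noteq> 0"
      and \<Phi>: "\<Phi> f = ev g / ev h" "\<Phi> f' = ev g' / ev h'"
      using ghf unfolding mem_iff[OF A] mem_iff[OF B] fractions_iff quot_def fst_conv snd_conv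
      by metis
    have "form (d + d') (g * h' + g' * h)"
      using form_add[OF form_mult[OF d(1,5)], of "g' * h"] form_mult[OF d(4,2)]
      by (simp add: add.commute)
    moreover have "form (d + d') (h * h')" by (rule form_mult[OF d(2,5)])
    ultimately show ?thesis
      using d by (auto simp: fractions_iff \<Phi> poly_at_mult poly_at_add add_frac_eq)
  qed
  have eq: "frac V (g * h' + g' * h) (h * h') = {q \<in> fractions V. quot q = \<Phi> f + \<Phi> f'}"
    if "(g, h) \<in> f" "(g', h') \<in> f'" for g h g' h'
    using fr[OF that] by (simp add: frac_eq)
  obtain g h where gh: "(g, h) \<in> f" using A by (rule carrier_obtain)
  obtain g' h' where gh': "(g', h') \<in> f'" using B by (rule carrier_obtain)
  have "f \<oplus>\<^bsub>FF\<^esub> f' = (\<Union>(g, h)\<in>f. \<Union>(g', h')\<in>f'. frac V (g * h' + g' * h) (h * h'))"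
    by (simp add: function_field_def)
  also have "\<dots> = (\<Union>(g, h)\<in>f. \<Union>(g', h')\<in>f'. {q \<in> fractions V. quot q = \<Phi> f + \<Phi> f'})"
    using eq by (intro SUP_cong refl) auto
  also have "\<dots> = frac V (g * h' + g' * h) (h * h')"
    using gh gh' eq[OF gh gh'] by auto
  finally show ?thesis
    using frac_in_carrier \<Phi>_frac fr[OF gh gh'] by simp
qed

lemma FF_one: "\<one>\<^bsub>FF\<^esub> \<in> carrier FF \<and> \<Phi> \<one>\<^bsub>FF\<^esub> = 1"
proof -
  have fr: "(1, 1) \<in> fractions V" by (auto simp: fractions_iff intro!: exI[of _ 0])
  show ?thesis
    using frac_in_carrier[OF fr] \<Phi>_frac[OF fr] by (simp add: function_field_def)
qed

lemma FF_zero: "\<zero>\<^bsub>FF\<^esub> \<in> carrier FF \<and> \<Phi> \<zero>\<^bsub>FF\<^esub> = 0"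
proof -
  have fr: "(0, 1) \<in> fractions V" by (auto simp: fractions_iff intro!: exI[of _ 0])
  show ?thesis
    using frac_in_carrier[OF fr] \<Phi>_frac[OF fr] by (simp add: function_field_def)
qed

lemma FF_const:
  "frac V (Poly_Mapping.single 0 c) 1 \<in> carrier FF \<and> \<Phi> (frac V (Poly_Mapping.single 0 c) 1) = \<iota> c"
proof -
  have fr: "(Poly_Mapping.single 0 c, 1) \<in> fractions V"
    by (auto simp: fractions_iff intro!: exI[of _ 0])
  show ?thesis using frac_in_carrier[OF fr] \<Phi>_frac[OF fr] by simp
qed

lemma fun_field_uminus: "e \<in> fun_field \<Longrightarrow> - e \<in> fun_field"
proof -
  assume "e \<in> fun_field"
  then obtain g h d where "e = ev g / ev h" "form d g" "form d h" "ev h \<noteq> 0"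
    unfolding fun_field_def by blast
  then have "- e = ev (- g) / ev h \<and> form d (- g) \<and> form d h \<and> ev h \<noteq> 0"
    by (simp add: poly_at_uminus form_uminus)
  then show ?thesis unfolding fun_field_def by blast
qed

lemma fun_field_inverse: "e \<in> fun_field \<Longrightarrow> inverse e \<in> fun_field"
proof (cases "e = 0")
  case False
  assume "e \<in> fun_field"
  then obtain g h d where "e = ev g / ev h" "form d g" "form d h" "ev h \<noteq> 0"
    unfolding fun_field_def by blast
  moreover from this False have "inverse e = ev h / ev g" "ev g \<noteq> 0" by auto
  ultimately show ?thesis unfolding fun_field_def by blast
qed simp

lemma \<Phi>_in: "f \<in> carrier FF \<Longrightarrow> \<Phi> f \<in> fun_field"
  using \<Phi>_image by blast

lemma FF_field: "field FF"
proof -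
  have eqI: "f = f'" if "f \<in> carrier FF" "f' \<in> carrier FF" "\<Phi> f = \<Phi> f'" for f f'
    using that \<Phi>_inj by blast
  have "abelian_group FF"
  proof (rule abelian_groupI)
    fix x assume x: "x \<in> carrier FF"
    obtain z where "z \<in> carrier FF" "\<Phi> z = - \<Phi> x"
      using \<Phi>_lift[OF fun_field_uminus[OF \<Phi>_in[OF x]]] .
    then show "\<exists>z\<in>carrier FF. z \<oplus>\<^bsub>FF\<^esub> x = \<zero>\<^bsub>FF\<^esub>"
      using x \<open>z \<in> carrier FF\<close> by (intro bexI[of _ z] eqI) (simp_all add: FF_add FF_zero)
  qed ((rule eqI)?; simp add: FF_add FF_zero algebra_simps)+
  moreover have "comm_monoid FF"
    by (rule comm_monoidI) ((rule eqI)?; simp add: FF_mult FF_one algebra_simps)+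
  ultimately have cring: "cring FF"
    by (rule cringI) ((rule eqI)?; simp add: FF_mult FF_add algebra_simps)+
  interpret R: cring FF by (rule cring)
  show ?thesis
  proof (rule R.cring_fieldI, intro equalityI subsetI)
    fix u assume u: "u \<in> Units FF"
    then obtain w where w: "u \<in> carrier FF" "w \<in> carrier FF" "w \<otimes>\<^bsub>FF\<^esub> u = \<one>\<^bsub>FF\<^esub>"
      by (auto simp: Units_def)
    then have "\<Phi> w * \<Phi> u = 1" using FF_mult[OF w(2,1)] FF_one by simp
    then have "u \<noteq> \<zero>\<^bsub>FF\<^esub>" using FF_zero by auto
    then show "u \<in> carrier FF - {\<zero>\<^bsub>FF\<^esub>}" using w by simp
  next
    fix u assume u: "u \<in> carrier FF - {\<zero>\<^bsub>FF\<^esub>}"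
    then have nz: "\<Phi> u \<noteq> 0" using \<Phi>_inj[of u "\<zero>\<^bsub>FF\<^esub>"] FF_zero by auto
    obtain w where w: "w \<in> carrier FF" "\<Phi> w = inverse (\<Phi> u)"
      using \<Phi>_lift[OF fun_field_inverse[OF \<Phi>_in]] u by blast
    have "w \<otimes>\<^bsub>FF\<^esub> u = \<one>\<^bsub>FF\<^esub>"
      by (rule eqI) (use w u nz in \<open>simp_all add: FF_mult FF_one\<close>)
    moreover have "u \<otimes>\<^bsub>FF\<^esub> w = \<one>\<^bsub>FF\<^esub>"
      by (rule eqI) (use w u nz in \<open>simp_all add: FF_mult FF_one\<close>)
    ultimately show "u \<in> Units FF" using u w by (auto simp: Units_def)
  qed
qed

sublocale FF: field FF
  by (rule FF_field)

lemma \<Phi>_zero_iff: "f \<in> carrier FF \<Longrightarrow> \<Phi> f = 0 \<longleftrightarrow> f = \<zero>\<^bsub>FF\<^esub>"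
  using \<Phi>_inj[of f "\<zero>\<^bsub>FF\<^esub>"] FF_zero by simp

lemma \<Phi>_minus: "f \<in> carrier FF \<Longrightarrow> \<Phi> (\<ominus>\<^bsub>FF\<^esub> f) = - \<Phi> f"
  using FF_add[of "\<ominus>\<^bsub>FF\<^esub> f" f] FF_zero by (simp add: FF.l_neg eq_neg_iff_add_eq_0)

lemma \<Phi>_inv:
  assumes "f \<in> carrier FF" "f \<noteq> \<zero>\<^bsub>FF\<^esub>"
  shows "inv\<^bsub>FF\<^esub> f \<in> carrier FF \<and> \<Phi> (inv\<^bsub>FF\<^esub> f) = inverse (\<Phi> f)"
proof -
  have u: "f \<in> Units FF" using assms FF.field_Units by simp
  then have c: "inv\<^bsub>FF\<^esub> f \<in> carrier FF" by (rule FF.Units_inv_closed)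
  have "\<Phi> (inv\<^bsub>FF\<^esub> f) * \<Phi> f = 1"
    using FF_mult[OF c assms(1)] FF.Units_l_inv[OF u] FF_one by simp
  then show ?thesis using c by (metis inverse_unique mult.commute)
qed

lemma \<Phi>_nat_pow: "f \<in> carrier FF \<Longrightarrow> \<Phi> (f [^]\<^bsub>FF\<^esub> (k::nat)) = \<Phi> f ^ k"
  by (induction k) (simp_all add: FF_one FF_mult FF.nat_pow_closed)

lemma \<Phi>_int_pow:
  assumes "f \<in> carrier FF" "f \<noteq> \<zero>\<^bsub>FF\<^esub>"
  shows "f [^]\<^bsub>FF\<^esub> (k::int) \<in> carrier FF \<and> \<Phi> (f [^]\<^bsub>FF\<^esub> k) = \<Phi> f powi k"
proof (cases "k < 0")
  case False
  then have eq: "f [^]\<^bsub>FF\<^esub> k = f [^]\<^bsub>FF\<^esub> nat k" by (simp only: int_pow_def2 if_False)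
  show ?thesis
    unfolding eq using False assms(1) FF.nat_pow_closed[OF assms(1)] \<Phi>_nat_pow[OF assms(1)]
    by (simp only: power_int_def not_less if_True simp_thms)
next
  case True
  let ?g = "f [^]\<^bsub>FF\<^esub> nat (- k)"
  have eq: "f [^]\<^bsub>FF\<^esub> k = inv\<^bsub>FF\<^esub> ?g" using True by (simp only: int_pow_def2 if_True)
  have g: "?g \<in> carrier FF" by (rule FF.nat_pow_closed[OF assms(1)])
  have "\<Phi> f \<noteq> 0" using \<Phi>_zero_iff[OF assms(1)] assms(2) by simp
  then have "\<Phi> ?g \<noteq> 0" unfolding \<Phi>_nat_pow[OF assms(1)] by simp
  then have "?g \<noteq> \<zero>\<^bsub>FF\<^esub>" using \<Phi>_zero_iff[OF g] by blast
  then have inv: "inv\<^bsub>FF\<^esub> ?g \<in> carrier FF \<and> \<Phi> (inv\<^bsub>FF\<^esub> ?g) = inverse (\<Phi> ?g)"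
    by (rule \<Phi>_inv[OF g])
  have "inverse (\<Phi> ?g) = \<Phi> f powi k"
    unfolding \<Phi>_nat_pow[OF assms(1)] using True by (simp add: power_int_def power_inverse)
  then show ?thesis unfolding eq using inv by simp
qed

end

context curve_model
begin

subsection \<open>Local rings and valuations\<close>

lemma local_ring_iff:
  assumes x: "on_curve x" and f: "f \<in> carrier FF"
  shows "f \<in> carrier (local_ring V (pt x)) \<longleftrightarrow> \<Phi> f \<in> regular_at x"
proof
  assume "f \<in> carrier (local_ring V (pt x))"
  then obtain g h where gh: "(g, h) \<in> f" "\<not> zero_at (to_ac_poly h) (pt x)"
    by (auto simp: local_ring_def)
  then obtain d where "form d g" "form d h" "\<Phi> f = ev g / ev h"
    using mem_iff[OF f] by (auto simp: fractions_iff quot_def)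
  then show "\<Phi> f \<in> regular_at x"
    using gh(2) zero_at_to_ac[of d h x] x unfolding regular_at_def on_curve_def by blast
next
  assume "\<Phi> f \<in> regular_at x"
  then obtain g h d where gh: "\<Phi> f = ev g / ev h" "form d g" "form d h" "at_pt x h \<noteq> 0"
    unfolding regular_at_def by blast
  then have "(g, h) \<in> f"
    using mem_iff[OF f] ev_nonzero[OF x] by (auto simp: fractions_iff quot_def)
  moreover have "\<not> zero_at (to_ac_poly h) (pt x)"
    using zero_at_to_ac[of d h x] gh x by (simp add: on_curve_def)
  ultimately show "f \<in> carrier (local_ring V (pt x))"
    using f by (auto simp: local_ring_def)
qed

lemma max_ideal_iff:
  assumes x: "on_curve x" and f: "f \<in> carrier FF"
  shows "f \<in> max_ideal V (pt x) \<longleftrightarrow> \<Phi> f \<in> zero_in x"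
proof
  assume "f \<in> max_ideal V (pt x)"
  then obtain g h where gh: "(g, h) \<in> f" "\<not> zero_at (to_ac_poly h) (pt x)"
    "zero_at (to_ac_poly g) (pt x)"
    by (auto simp: max_ideal_def)
  then obtain d where "form d g" "form d h" "\<Phi> f = ev g / ev h"
    using mem_iff[OF f] by (auto simp: fractions_iff quot_def)
  then show "\<Phi> f \<in> zero_in x"
    using gh zero_at_to_ac[of d h x] zero_at_to_ac[of d g x] x
    unfolding zero_in_def on_curve_def by blast
next
  assume "\<Phi> f \<in> zero_in x"
  then obtain g h d where gh: "\<Phi> f = ev g / ev h" "form d g" "form d h" "at_pt x h \<noteq> 0" "at_pt x g = 0"
    unfolding zero_in_def by blast
  then have "(g, h) \<in> f"
    using mem_iff[OF f] ev_nonzero[OF x] by (auto simp: fractions_iff quot_def)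
  moreover have "\<not> zero_at (to_ac_poly h) (pt x)" "zero_at (to_ac_poly g) (pt x)"
    using zero_at_to_ac[of d h x] zero_at_to_ac[of d g x] gh x by (simp_all add: on_curve_def)
  ultimately show "f \<in> max_ideal V (pt x)"
    using f by (auto simp: max_ideal_def)
qed

lemma regular_subset_fun_field: "on_curve x \<Longrightarrow> regular_at x \<subseteq> fun_field"
  unfolding regular_at_def fun_field_def using ev_nonzero by blast

lemma local_ring_carrier: "f \<in> carrier (local_ring V P) \<Longrightarrow> f \<in> carrier FF"
  by (simp add: local_ring_def)

text \<open>
  Equality of the two ideals may be tested on their images because \<open>\<Phi>\<close> is injective on the function
  field.
\<close>

lemma uniformizer_iff:
  assumes x: "on_curve x" and t: "t \<in> carrier FF"
  shows "uniformizer V (pt x) t \<longleftrightarrow>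
    \<Phi> t \<in> regular_at x \<and> zero_in x = (\<lambda>z. \<Phi> t * z) ` regular_at x"
proof -
  have "max_ideal V (pt x) = PIdl\<^bsub>local_ring V (pt x)\<^esub> t \<longleftrightarrow>
      zero_in x = (\<lambda>z. \<Phi> t * z) ` regular_at x" (is "?L \<longleftrightarrow> ?R")
  proof -
    let ?P = "PIdl\<^bsub>local_ring V (pt x)\<^esub> t"
    have P: "?P = {z \<otimes>\<^bsub>FF\<^esub> t | z. z \<in> carrier (local_ring V (pt x))}"
      by (simp add: cgenideal_def local_ring_def)
    have PFF: "?P \<subseteq> carrier FF" unfolding P using FF_mult t local_ring_carrier by blast
    have MFF: "max_ideal V (pt x) \<subseteq> carrier FF" by (auto simp: max_ideal_def)
    have \<Phi>P: "\<Phi> ` ?P = (\<lambda>z. \<Phi> t * z) ` regular_at x"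
    proof (intro equalityI subsetI)
      fix e assume "e \<in> \<Phi> ` ?P"
      then obtain z where z: "z \<in> carrier (local_ring V (pt x))" "e = \<Phi> (z \<otimes>\<^bsub>FF\<^esub> t)"
        unfolding P by blast
      then have "z \<in> carrier FF" by (blast intro: local_ring_carrier)
      then show "e \<in> (\<lambda>z. \<Phi> t * z) ` regular_at x"
        using z local_ring_iff[OF x, of z] FF_mult[of z t] t by (auto simp: mult.commute)
    next
      fix e assume "e \<in> (\<lambda>z. \<Phi> t * z) ` regular_at x"
      then obtain w where w: "w \<in> regular_at x" "e = \<Phi> t * w" by blast
      then obtain z where z: "z \<in> carrier FF" "\<Phi> z = w"
        using regular_subset_fun_field[OF x] \<Phi>_lift by blast
      then have "z \<otimes>\<^bsub>FF\<^esub> t \<in> ?P" unfolding P using local_ring_iff[OF x z(1)] w by blast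
      moreover have "\<Phi> (z \<otimes>\<^bsub>FF\<^esub> t) = e" using FF_mult[OF z(1) t] w z by (simp add: mult.commute)
      ultimately show "e \<in> \<Phi> ` ?P" by blast
    qed
    have \<Phi>M: "\<Phi> ` max_ideal V (pt x) = zero_in x"
    proof (intro equalityI subsetI)
      fix e assume "e \<in> zero_in x"
      then obtain z where z: "z \<in> carrier FF" "\<Phi> z = e"
        using zero_in_subset regular_subset_fun_field[OF x] \<Phi>_lift by blast
      then show "e \<in> \<Phi> ` max_ideal V (pt x)" using max_ideal_iff[OF x z(1)] \<open>e \<in> zero_in x\<close> by blast
    qed (use max_ideal_iff[OF x] MFF in blast)
    have "inj_on \<Phi> (carrier FF)" using \<Phi>_inj by (auto simp: inj_on_def)
    then have "max_ideal V (pt x) = ?P \<longleftrightarrow> \<Phi> ` max_ideal V (pt x) = \<Phi> ` ?P"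
      using inj_on_image_eq_iff MFF PFF by metis
    then show ?thesis unfolding \<Phi>P \<Phi>M .
  qed
  then show ?thesis using local_ring_iff[OF x t] by (simp add: uniformizer_def)
qed

lemma local_units_iff:
  assumes x: "on_curve x" and u: "u \<in> carrier FF"
  shows "u \<in> Units (local_ring V (pt x)) \<longleftrightarrow> \<Phi> u \<in> regular_at x \<and> \<Phi> u \<notin> zero_in x"
proof
  assume "u \<in> Units (local_ring V (pt x))"
  then obtain w where w: "w \<in> carrier (local_ring V (pt x))" "u \<in> carrier (local_ring V (pt x))"
    "w \<otimes>\<^bsub>FF\<^esub> u = \<one>\<^bsub>FF\<^esub>"
    by (auto simp: Units_def local_ring_def)
  have wF: "w \<in> carrier FF" using w by (blast intro: local_ring_carrier)
  have reg: "\<Phi> u \<in> regular_at x" "\<Phi> w \<in> regular_at x"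
    using w local_ring_iff[OF x] u wF by auto
  have "\<Phi> w * \<Phi> u = 1" using FF_mult[OF wF u] w FF_one by simp
  then have "\<Phi> u \<notin> zero_in x"
    using ideal_in_mult[OF zero_in_ideal[OF x] reg(2)] const_not_zero_in[OF x, of 1] by fastforce
  then show "\<Phi> u \<in> regular_at x \<and> \<Phi> u \<notin> zero_in x" using reg by blast
next
  assume reg: "\<Phi> u \<in> regular_at x \<and> \<Phi> u \<notin> zero_in x"
  then have inv: "inverse (\<Phi> u) \<in> regular_at x" using inverse_regular[OF x] by blast
  have "\<Phi> u \<noteq> 0" using reg ideal_in_zero[OF zero_in_ideal[OF x]] by auto
  obtain w where w: "w \<in> carrier FF" "\<Phi> w = inverse (\<Phi> u)"
    using inv regular_subset_fun_field[OF x] \<Phi>_lift by blast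
  have "w \<otimes>\<^bsub>FF\<^esub> u = \<one>\<^bsub>FF\<^esub>" "u \<otimes>\<^bsub>FF\<^esub> w = \<one>\<^bsub>FF\<^esub>"
    using \<Phi>_inj[of _ "\<one>\<^bsub>FF\<^esub>"] FF_one FF_mult[OF w(1) u] FF_mult[OF u w(1)] w \<open>\<Phi> u \<noteq> 0\<close> by auto
  moreover have "u \<in> carrier (local_ring V (pt x))" "w \<in> carrier (local_ring V (pt x))"
    using local_ring_iff[OF x] u w inv reg by auto
  ultimately show "u \<in> Units (local_ring V (pt x))"
    by (auto simp: Units_def local_ring_def)
qed

text \<open>
  Any other uniformizer \<open>t\<close> differs from \<open>t0\<close> by a unit \<open>a\<close>, and \<open>a powi k\<close> is absorbed in the unit part,
  so the exponent does not depend on the uniformizer in the definition of the valuation.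
\<close>

lemma valuation_eq_val:
  assumes x: "on_curve x" and dvr: "dvr \<iota> (regular_at x) (zero_in x) t0"
    and K: "dvr.K (regular_at x) = fun_field"
    and f: "f \<in> carrier FF" "f \<noteq> \<zero>\<^bsub>FF\<^esub>"
  shows "valuation V (pt x) f = dvr.val (regular_at x) (zero_in x) t0 (\<Phi> f)"
proof -
  interpret D: dvr \<iota> "regular_at x" "zero_in x" t0 by (rule dvr)
  define P where "P k \<longleftrightarrow> (\<exists>t u. uniformizer V (pt x) t \<and> u \<in> Units (local_ring V (pt x)) \<and>
     f = t [^]\<^bsub>FF\<^esub> (k::int) \<otimes>\<^bsub>FF\<^esub> u)" for k
  have "\<Phi> f \<in> D.K" "\<Phi> f \<noteq> 0" using f \<Phi>_in K \<Phi>_zero_iff by auto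
  then obtain w where w: "D.is_unit w" "\<Phi> f = t0 powi (D.val (\<Phi> f)) * w"
    by (rule D.val_decompose)
  have ex: "P k" if "k = D.val (\<Phi> f)" for k
  proof -
    obtain t where t: "t \<in> carrier FF" "\<Phi> t = t0"
      using D.t_in regular_subset_fun_field[OF x] \<Phi>_lift by blast
    obtain u where u: "u \<in> carrier FF" "\<Phi> u = w"
      using w(1) regular_subset_fun_field[OF x] \<Phi>_lift unfolding D.is_unit_def by blast
    have tnz: "t \<noteq> \<zero>\<^bsub>FF\<^esub>" using t D.t_nz FF_zero by auto
    note pw = \<Phi>_int_pow[OF t(1) tnz, of k]
    have "\<Phi> f = \<Phi> (t [^]\<^bsub>FF\<^esub> k \<otimes>\<^bsub>FF\<^esub> u)"
      using FF_mult[of "t [^]\<^bsub>FF\<^esub> k" u] pw u t w(2) that by simp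
    then have "f = t [^]\<^bsub>FF\<^esub> k \<otimes>\<^bsub>FF\<^esub> u"
      using \<Phi>_inj[OF f(1)] FF_mult[of "t [^]\<^bsub>FF\<^esub> k" u] pw u by blast
    moreover have "uniformizer V (pt x) t"
      using uniformizer_iff[OF x t(1)] D.t_in D.M_eq t(2) by simp
    moreover have "u \<in> Units (local_ring V (pt x))"
      using local_units_iff[OF x u(1)] w(1) u(2) unfolding D.is_unit_def by simp
    ultimately show "P k" unfolding P_def by blast
  qed
  have unique: "k = D.val (\<Phi> f)" if P: "P k" for k
  proof -
    obtain t u where tu: "uniformizer V (pt x) t" "u \<in> Units (local_ring V (pt x))"
      "f = t [^]\<^bsub>FF\<^esub> k \<otimes>\<^bsub>FF\<^esub> u" using P unfolding P_def by blast
    have t: "t \<in> carrier FF" using tu(1) unfolding uniformizer_def by (blast intro: local_ring_carrier)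
    have u: "u \<in> carrier FF" using tu(2) unfolding Units_def by (blast intro: local_ring_carrier)
    have tM: "\<Phi> t \<in> regular_at x" "zero_in x = (\<lambda>z. \<Phi> t * z) ` regular_at x"
      using uniformizer_iff[OF x t] tu(1) by auto
    have uu: "D.is_unit (\<Phi> u)" using local_units_iff[OF x u] tu(2) by (simp add: D.is_unit_def)
    have one: "1 \<in> regular_at x" by (rule subring_one[OF D.sub])
    have "\<Phi> t \<in> zero_in x" unfolding tM(2) using one by (intro image_eqI[of _ _ 1]) auto
    then obtain a where a: "a \<in> regular_at x" "\<Phi> t = t0 * a" by (auto simp: D.M_iff)
    have "t0 \<in> zero_in x" unfolding D.M_iff using one by (intro bexI[of _ 1]) auto
    then obtain b where b: "b \<in> regular_at x" "t0 = \<Phi> t * b" unfolding tM(2) by blast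
    have "a * b = 1"
    proof -
      have "t0 * (a * b) = t0 * 1" using a b by (metis mult.assoc mult_1_right)
      then show ?thesis using D.t_nz by simp
    qed
    have ua: "D.is_unit a"
      unfolding D.is_unit_def
    proof
      show "a \<notin> zero_in x"
      proof
        assume "a \<in> zero_in x"
        then have "b * a \<in> zero_in x" by (rule ideal_in_mult[OF D.M_ideal b(1)])
        then show False using \<open>a * b = 1\<close> D.one_notin by (simp add: mult.commute)
      qed
    qed (rule a(1))
    have pow: "D.is_unit (a powi k)"
    proof -
      have n: "D.is_unit (a ^ n)" for n
        by (induction n) (use D.unit_const[of 1] ua in \<open>auto intro: D.unit_mult\<close>)
      then show ?thesis using D.unit_inverse[OF n] by (simp add: power_int_def power_inverse)
    qed
    have tnz: "t \<noteq> \<zero>\<^bsub>FF\<^esub>" using b D.t_nz FF_zero by auto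
    have "\<Phi> f = (t0 * a) powi k * \<Phi> u"
      using \<Phi>_int_pow[OF t tnz, of k] FF_mult[of "t [^]\<^bsub>FF\<^esub> k" u] u tu(3) a(2) by simp
    also have "\<dots> = t0 powi k * (a powi k * \<Phi> u)" by (simp add: power_int_mult_distrib)
    finally show ?thesis using D.val_eq[OF D.unit_mult[OF pow uu]] by simp
  qed
  have "(THE k. P k) = D.val (\<Phi> f)" by (rule the_equality) (fact ex[OF refl], fact unique)
  then show ?thesis unfolding valuation_def P_def .
qed

end

section \<open>Dimension one\<close>

context field_embedding
begin

text \<open>
  Polynomials in \<open>s\<close> of degree at most \<open>e\<close>, and their quotients. The degree bound is carried along
  because \<open>algebraic_over_gen\<close> asks for a common bound on all coefficients.
\<close>

definition gen_ring :: "'e \<Rightarrow> nat \<Rightarrow> 'e set" where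
  "gen_ring s e = lin (\<lambda>l. s ^ l) {..e}"

lemma gen_ring_mono:
  assumes "e \<le> e'"
  shows "gen_ring s e \<subseteq> gen_ring s e'"
proof
  fix u assume "u \<in> gen_ring s e"
  then obtain c where "u = (\<Sum>l\<in>{..e}. \<iota> (c l) * s ^ l)" by (auto simp: gen_ring_def lin_def)
  also have "\<dots> = (\<Sum>l\<in>{..e'}. \<iota> (if l \<le> e then c l else 0) * s ^ l)"
    by (rule sum.mono_neutral_cong_left) (use assms in auto)
  finally show "u \<in> gen_ring s e'"
    using linI[of "\<lambda>l. if l \<le> e then c l else 0" "\<lambda>l. s ^ l" "{..e'}"] by (simp add: gen_ring_def)
qed

lemma gen_ring_mult: "u \<in> gen_ring s e \<Longrightarrow> w \<in> gen_ring s e' \<Longrightarrow> u * w \<in> gen_ring s (e + e')"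
  unfolding gen_ring_def
proof (erule (1) lin_mult)
  fix i j assume "i \<in> {..e}" "j \<in> {..e'}"
  then have "i + j \<in> {..e + e'}" by simp
  then show "s ^ i * s ^ j \<in> lin (\<lambda>l. s ^ l) {..e + e'}"
    using lin_base[of "{..e + e'}" "i + j" "\<lambda>l. s ^ l"] by (simp add: power_add)
qed

lemma gen_ring_add:
  assumes "u \<in> gen_ring s e" "w \<in> gen_ring s e'"
  shows "u + w \<in> gen_ring s (e + e')"
proof -
  have "u \<in> gen_ring s (e + e')" "w \<in> gen_ring s (e + e')"
    using assms gen_ring_mono[of e "e + e'" s] gen_ring_mono[of e' "e + e'" s] by auto
  then show ?thesis by (simp add: gen_ring_def lin_add)
qed

lemma gen_ring_const: "\<iota> c \<in> gen_ring s 0"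
  unfolding gen_ring_def using lin_scale[OF lin_base[of "{..0}" 0 "\<lambda>l. s ^ l"], of c] by simp

lemma gen_ring_gen: "s \<in> gen_ring s 1"
  unfolding gen_ring_def using lin_base[of "{..1}" 1 "\<lambda>l. s ^ l"] by simp

lemma gen_ring_uminus: "u \<in> gen_ring s e \<Longrightarrow> - u \<in> gen_ring s e"
  by (simp add: gen_ring_def lin_minus)

definition gen_field :: "'e \<Rightarrow> 'e set" where
  "gen_field s = {u / w | u w e. u \<in> gen_ring s e \<and> w \<in> gen_ring s e \<and> w \<noteq> 0}"

lemma gen_fieldI:
  assumes "u \<in> gen_ring s e" "w \<in> gen_ring s e'" "w \<noteq> 0"
  shows "u / w \<in> gen_field s"
proof -
  have "u \<in> gen_ring s (e + e')" "w \<in> gen_ring s (e + e')"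
    using assms gen_ring_mono[of e "e + e'" s] gen_ring_mono[of e' "e + e'" s] by auto
  then show ?thesis unfolding gen_field_def using assms(3) by blast
qed

lemma gen_field_ring: "u \<in> gen_ring s e \<Longrightarrow> u \<in> gen_field s"
  using gen_fieldI[OF _ gen_ring_const[of 1], of u s e] by simp

lemma gen_field_closed:
  assumes "u \<in> gen_field s"
  shows "- u \<in> gen_field s" "inverse u \<in> gen_field s"
    and "w \<in> gen_field s \<Longrightarrow> u + w \<in> gen_field s" "w \<in> gen_field s \<Longrightarrow> u * w \<in> gen_field s"
proof -
  obtain a b e where u: "u = a / b" "a \<in> gen_ring s e" "b \<in> gen_ring s e" "b \<noteq> 0"
    using assms unfolding gen_field_def by blast
  have "- u = (- a) / b" using u by simp
  then show "- u \<in> gen_field s" using gen_fieldI[OF gen_ring_uminus[OF u(2)] u(3,4)] by simp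
  show "inverse u \<in> gen_field s"
  proof (cases "a = 0")
    case True
    then show ?thesis using gen_field_ring[OF gen_ring_const[of 0]] by (simp add: u(1))
  next
    case False
    then show ?thesis using gen_fieldI[OF u(3,2)] by (simp add: u(1))
  qed
  have "u + w \<in> gen_field s \<and> u * w \<in> gen_field s" if ws: "w \<in> gen_field s"
  proof -
    obtain a' b' e' where w: "w = a' / b'" "a' \<in> gen_ring s e'" "b' \<in> gen_ring s e'" "b' \<noteq> 0"
      using ws unfolding gen_field_def by blast
    have bb: "b * b' \<in> gen_ring s (e + e')" "b * b' \<noteq> 0" using u w gen_ring_mult by auto
    have "u + w = (a * b' + a' * b) / (b * b')" using u w by (simp add: add_frac_eq)
    moreover have "a * b' + a' * b \<in> gen_ring s ((e + e') + (e' + e))"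
      by (intro gen_ring_add gen_ring_mult u w)
    ultimately have add: "u + w \<in> gen_field s" using gen_fieldI bb by metis
    have "u * w = (a * a') / (b * b')" using u w by simp
    moreover have "a * a' \<in> gen_ring s (e + e')" by (intro gen_ring_mult u w)
    ultimately show ?thesis using gen_fieldI bb add by metis
  qed
  then show "w \<in> gen_field s \<Longrightarrow> u + w \<in> gen_field s" "w \<in> gen_field s \<Longrightarrow> u * w \<in> gen_field s"
    by blast+
qed

lemma common_denominator:
  assumes "set p \<subseteq> gen_field s"
  shows "\<exists>w e. w \<noteq> 0 \<and> w \<in> gen_ring s e \<and> (\<forall>k\<in>set p. w * k \<in> gen_ring s e)"
  using assms
proof (induction p)
  case Nil
  then show ?case using gen_ring_const[of 1 s] by (intro exI[of _ 1] exI[of _ 0]) simp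
next
  case (Cons k p)
  then obtain w e where w: "w \<noteq> 0" "w \<in> gen_ring s e" "\<And>k. k \<in> set p \<Longrightarrow> w * k \<in> gen_ring s e"
    by auto
  obtain a b e' where k: "k = a / b" "a \<in> gen_ring s e'" "b \<in> gen_ring s e'" "b \<noteq> 0"
    using Cons.prems unfolding gen_field_def by auto
  have "w * b * k = w * a" using k by simp
  then have "w * b * k \<in> gen_ring s (e + e')" using gen_ring_mult w k by metis
  moreover have "w * b * l \<in> gen_ring s (e + e')" if "l \<in> set p" for l
    using gen_ring_mult[OF w(3)[OF that] k(3)] by (simp add: ac_simps)
  ultimately show ?case
    using w k gen_ring_mult[OF w(2) k(3)] by (intro exI[of _ "w * b"] exI[of _ "e + e'"]) auto
qed

lemma algebraic_over_genI:
  assumes p: "set p \<subseteq> gen_field s" "p \<noteq> []" "last p \<noteq> 0"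
    and root: "(\<Sum>i<length p. p ! i * f ^ i) = 0"
  shows "algebraic_over_gen s f"
proof -
  obtain w e where w: "w \<noteq> 0" "\<And>k. k \<in> set p \<Longrightarrow> w * k \<in> gen_ring s e"
    using common_denominator[OF p(1)] by blast
  define r where "r = length p - 1"
  have len: "length p = Suc r" using p(2) by (simp add: r_def)
  define a where "a i = (if i < length p then w * p ! i else 0)" for i
  have "a i \<in> lin (\<lambda>l. s ^ l) {..e}" for i
    using w(2) by (simp add: a_def lin_zero gen_ring_def)
  moreover have "a r \<noteq> 0" using w(1) p(2,3) by (simp add: a_def r_def last_conv_nth)
  moreover have "(\<Sum>i\<le>r. a i * f ^ i) = 0"
  proof -
    have "(\<Sum>i\<le>r. a i * f ^ i) = (\<Sum>i<length p. w * (p ! i * f ^ i))"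
      by (rule sum.cong) (auto simp: a_def len mult.assoc)
    also have "\<dots> = 0" using root by (simp flip: sum_distrib_left)
    finally show ?thesis .
  qed
  ultimately show ?thesis unfolding algebraic_over_gen_def by blast
qed

end

context curve_model
begin

lemma constants_in_carrier: "constant_functions V \<subseteq> carrier FF"
  using FF_const by (auto simp: constant_functions_def)

lemma \<Phi>_constants: "c \<in> constant_functions V \<Longrightarrow> \<Phi> c \<in> range \<iota>"
  using FF_const by (auto simp: constant_functions_def)

text \<open>
  A constant \<open>c\<close> is a root of the polynomial \<open>X - c\<close> over the constants.
\<close>

lemma transcendental_not_const:
  assumes t: "t \<in> carrier FF" and tr: "ring.transcendental FF (constant_functions V) t"
  shows "\<Phi> t \<notin> range \<iota>"
proof
  assume "\<Phi> t \<in> range \<iota>"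
  then obtain c where c: "\<Phi> t = \<iota> c" by blast
  define k where "k = frac V (Poly_Mapping.single 0 (- c)) 1"
  have k: "k \<in> carrier FF" "\<Phi> k = - \<iota> c" using FF_const by (auto simp: k_def emb_minus)
  have one: "\<one>\<^bsub>FF\<^esub> \<in> constant_functions V"
    by (auto simp: constant_functions_def function_field_def intro!: range_eqI[of _ _ 1])
  have kc: "k \<in> constant_functions V" by (auto simp: constant_functions_def k_def)
  let ?p = "[\<one>\<^bsub>FF\<^esub>, k]"
  have p: "?p \<in> carrier (univ_poly FF (constant_functions V))"
    using one kc by (simp add: univ_poly_def polynomial_def)
  have n: "[] \<in> carrier (univ_poly FF (constant_functions V))"
    by (simp add: univ_poly_def polynomial_def)
  have "FF.eval ?p t = t \<oplus>\<^bsub>FF\<^esub> k" using t k by simp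
  also have "\<dots> = \<zero>\<^bsub>FF\<^esub>"
    using \<Phi>_inj[of "t \<oplus>\<^bsub>FF\<^esub> k" "\<zero>\<^bsub>FF\<^esub>"] FF_add[OF t k(1)] FF_zero k c by simp
  finally have "FF.eval ?p t = FF.eval [] t" by simp
  then have "?p = []" using tr p n unfolding FF.transcendental_def inj_on_def by blast
  then show False by simp
qed

text \<open>
  The list of coefficients is reversed because evaluation takes the leading coefficient first.
\<close>

lemma \<Phi>_eval:
  assumes "set p \<subseteq> carrier FF" and f: "f \<in> carrier FF"
  shows "FF.eval p f \<in> carrier FF \<and>
    \<Phi> (FF.eval p f) = (\<Sum>i<length p. map \<Phi> (rev p) ! i * \<Phi> f ^ i)"
  using assms(1)
proof (induction p)
  case Nil
  then show ?case using FF_zero by simp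
next
  case (Cons a p)
  let ?m = "a \<otimes>\<^bsub>FF\<^esub> (f [^]\<^bsub>FF\<^esub> length p)"
  have pw: "f [^]\<^bsub>FF\<^esub> length p \<in> carrier FF" by (rule FF.nat_pow_closed[OF f])
  have m: "?m \<in> carrier FF" "\<Phi> ?m = \<Phi> a * \<Phi> f ^ length p"
    using FF_mult[OF _ pw, of a] Cons.prems \<Phi>_nat_pow[OF f] by simp_all
  have IH: "FF.eval p f \<in> carrier FF"
    "\<Phi> (FF.eval p f) = (\<Sum>i<length p. map \<Phi> (rev p) ! i * \<Phi> f ^ i)"
    using Cons by simp_all
  have "FF.eval (a # p) f = ?m \<oplus>\<^bsub>FF\<^esub> FF.eval p f" by simp
  then have "FF.eval (a # p) f \<in> carrier FF"
    "\<Phi> (FF.eval (a # p) f) = \<Phi> a * \<Phi> f ^ length p + (\<Sum>i<length p. map \<Phi> (rev p) ! i * \<Phi> f ^ i)"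
    using FF_add[OF m(1) IH(1)] m IH by simp_all
  moreover have "(\<Sum>i<length (a # p). map \<Phi> (rev (a # p)) ! i * \<Phi> f ^ i) =
      \<Phi> a * \<Phi> f ^ length p + (\<Sum>i<length p. map \<Phi> (rev p) ! i * \<Phi> f ^ i)"
    by (simp add: nth_append add.commute)
  ultimately show ?case by simp
qed

lemma \<Phi>_generate_field:
  assumes t: "t \<in> carrier FF"
    and k: "k \<in> generate_field FF (insert t (constant_functions V))"
  shows "k \<in> carrier FF \<and> \<Phi> k \<in> gen_field (\<Phi> t)"
  using k
proof (induction rule: generate_field.induct)
  case one
  then show ?case using FF_one gen_field_ring[OF gen_ring_const[of 1]] by simp
next
  case (incl h)
  show ?case
  proof (cases "h = t")
    case True
    then show ?thesis using t gen_field_ring[OF gen_ring_gen] by simp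
  next
    case False
    then have h: "h \<in> constant_functions V" using incl by simp
    then obtain c where "\<Phi> h = \<iota> c" using \<Phi>_constants by blast
    then show ?thesis
      using h constants_in_carrier gen_field_ring[OF gen_ring_const, of c] by auto
  qed
next
  case (a_inv h)
  then show ?case using \<Phi>_minus gen_field_closed(1) FF.a_inv_closed by simp
next
  case (m_inv h)
  then show ?case using \<Phi>_inv[of h] gen_field_closed(2) by simp
next
  case (eng_add h1 h2)
  then show ?case using FF_add[of h1 h2] gen_field_closed(3) by simp
next
  case (eng_mult h1 h2)
  then show ?case using FF_mult[of h1 h2] gen_field_closed(4) by simp
qed

lemma algebraic_imp_algebraic_over_gen:
  assumes t: "t \<in> carrier FF" and f: "f \<in> carrier FF"
    and alg: "ring.algebraic FF (generate_field FF (insert t (constant_functions V))) f"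
  shows "algebraic_over_gen (\<Phi> t) (\<Phi> f)"
proof -
  let ?K = "generate_field FF (insert t (constant_functions V))"
  have "subfield ?K FF"
    using FF.generate_field_is_subfield t constants_in_carrier by blast
  then have "subring ?K FF" by (rule subfieldE)
  then obtain p where p: "p \<in> carrier (univ_poly FF ?K)" "p \<noteq> []" "FF.eval p f = \<zero>\<^bsub>FF\<^esub>"
    using FF.algebraicE[OF _ f] alg unfolding over_def by blast
  have pK: "set p \<subseteq> ?K" "hd p \<noteq> \<zero>\<^bsub>FF\<^esub>"
    using p by (auto simp: univ_poly_def polynomial_def)
  then have pc: "set p \<subseteq> carrier FF" "\<Phi> ` set p \<subseteq> gen_field (\<Phi> t)"
    using \<Phi>_generate_field[OF t] by blast+
  have "hd p \<in> carrier FF" using pc p(2) by auto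
  then have hd: "\<Phi> (hd p) \<noteq> 0" using \<Phi>_zero_iff pK(2) by blast
  show ?thesis
  proof (rule algebraic_over_genI[of "map \<Phi> (rev p)"])
    show "set (map \<Phi> (rev p)) \<subseteq> gen_field (\<Phi> t)" using pc by simp
    show "last (map \<Phi> (rev p)) \<noteq> 0" using hd p(2) by (simp add: last_map last_rev)
    show "(\<Sum>i<length (map \<Phi> (rev p)). map \<Phi> (rev p) ! i * \<Phi> f ^ i) = 0"
      using \<Phi>_eval[OF pc(1) f] p(3) FF_zero by simp
  qed (use p in simp)
qed

text \<open>
  All functions are algebraic over the field generated by one of them, so any two of them are
  algebraically dependent.
\<close>

lemma one_dimensional_consequences:
  assumes fin: "finite (UNIV :: 'a set)" and dim: "one_dimensional V"
  shows "\<exists>s\<in>fun_field. s \<notin> range \<iota>"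
    and "f \<in> fun_field \<Longrightarrow> g \<in> fun_field \<Longrightarrow> alg_dependent f g"
proof -
  obtain t where t: "t \<in> carrier FF" "ring.transcendental FF (constant_functions V) t"
    "\<And>f. f \<in> carrier FF \<Longrightarrow>
      ring.algebraic FF (generate_field FF (insert t (constant_functions V))) f"
    using dim unfolding one_dimensional_def by blast
  show "\<exists>s\<in>fun_field. s \<notin> range \<iota>"
    using transcendental_not_const[OF t(1,2)] \<Phi>_in[OF t(1)] by blast
  have alg: "algebraic_over_gen (\<Phi> t) e" if "e \<in> fun_field" for e
    using algebraic_imp_algebraic_over_gen[OF t(1) _ t(3)] \<Phi>_lift[OF that] by metis
  show "alg_dependent f g" if "f \<in> fun_field" "g \<in> fun_field"
    using alg_dependent_of_algebraic[OF fin alg[OF that(1)] alg[OF that(2)]] .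
qed

end

section \<open>Generalized Weierstrass semigroups of curves\<close>

context curve_model
begin

lemma on_curve_same_point:
  assumes "on_curve x" "x' \<noteq> 0" "pt x' = pt x"
  shows "on_curve x'" "regular_at x' = regular_at x"
proof -
  show "on_curve x'" using assms by (simp add: on_curve_def)
  have x: "x \<noteq> 0" using assms(1) by (simp add: on_curve_def)
  obtain c where c: "c \<noteq> 0" "x' = c *s x" using pt_eq_iff[OF x assms(2)] assms(3) by auto
  have "at_pt x' h \<noteq> 0 \<longleftrightarrow> at_pt x h \<noteq> 0" if "form d h" for d h
    unfolding c(2) to_ac.poly_at_smult[OF that] using c(1) by simp
  then show "regular_at x' = regular_at x" unfolding regular_at_def by blast
qed

lemma rational_representative:
  assumes "P \<in> rational_points V"
  shows "\<exists>a i0. a $ i0 = 1 \<and> on_curve (\<chi> i. to_ac (a $ i)) \<and> pt (\<chi> i. to_ac (a $ i)) = P"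
proof -
  obtain b :: "'a ^ 'n" where b: "b \<noteq> 0" "P = pt (\<chi> i. to_ac (b $ i))" "P \<in> V"
    using assms unfolding rational_points_def by blast
  obtain i0 where i0: "b $ i0 \<noteq> 0" using b(1) by (auto simp: vec_eq_iff)
  define a where "a = inverse (b $ i0) *s b"
  have a1: "a $ i0 = 1" using i0 by (simp add: a_def)
  have nz: "(\<chi> i. to_ac (a $ i)) \<noteq> (0 :: 'a alg_closure ^ 'n)"
    using a1 by (metis to_ac_1 vec_lambda_beta zero_index zero_neq_one)
  have nz': "(\<chi> i. to_ac (b $ i)) \<noteq> (0 :: 'a alg_closure ^ 'n)"
    using i0 by (metis to_ac_eq_0_iff vec_lambda_beta zero_index)
  have "(\<chi> i. to_ac (a $ i)) = to_ac (inverse (b $ i0)) *s (\<chi> i. to_ac (b $ i))"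
    by (simp add: a_def vec_eq_iff)
  then have "pt (\<chi> i. to_ac (b $ i)) = pt (\<chi> i. to_ac (a $ i))"
    using i0 by (intro pt_eq_iff[OF nz' nz, THEN iffD2] exI[of _ "to_ac (inverse (b $ i0))"]) simp
  then show ?thesis using a1 nz b by (intro exI[of _ a] exI[of _ i0]) (simp add: on_curve_def)
qed

end

text \<open>
  The four properties of \<open>pole_order_space\<close> are verified for \<open>R\<close>, the image of the ring of functions
  regular outside the \<open>Q\<^sub>i\<close>, and the valuations of the local rings at the \<open>Q\<^sub>i\<close>. A function in \<open>R\<close> with
  positive valuation at every \<open>Q\<^sub>i\<close> is regular at these points too, hence everywhere, and it vanishes
  somewhere.
\<close>

theorem theorem3p4:
  fixes V :: "('a::{field,finite} alg_closure, 'n::finite) proj set"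
    and Q :: "'m::finite \<Rightarrow> ('a alg_closure, 'n) proj"
  assumes "geom_irreducible_projective_curve V"
    and "nonsingular_curve V"
    and "CARD('m) \<ge> 2"
    and "CARD('a) \<ge> CARD('m)"
    and "inj Q"
    and "range Q \<subseteq> rational_points V"
  shows "gen_weierstrass_semigroup V Q =
    {lub \<beta> | \<beta> :: 'm \<Rightarrow> int ^ 'm. \<forall>k. \<beta> k \<in> absolute_maximal V Q}"
proof -
  have V: "closed_over_base V" "geometrically_irreducible V" "one_dimensional V"
    using assms(1) by (auto simp: geom_irreducible_projective_curve_def)
  let ?\<iota> = "const_embedding :: 'a \<Rightarrow> (('a, 'n) mpoly, 'a alg_closure) upower"
  obtain \<xi> where "generic_point ?\<iota> V \<xi>" using generic_point_exists[OF V(2)] by blast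
  then interpret C: curve_model ?\<iota> V \<xi>
    using V by (auto simp: curve_model_def curve_model_axioms_def)
  have fin: "finite (UNIV :: 'a set)" by simp
  note dim = C.one_dimensional_consequences[OF fin V(3)]
  have "\<forall>i. \<exists>x t. C.on_curve x \<and> pt x = Q i \<and> dvr ?\<iota> (C.regular_at x) (C.zero_in x) t \<and>
      dvr.K (C.regular_at x) = C.fun_field"
  proof
    fix i
    have "Q i \<in> rational_points V" using assms(6) by blast
    from C.rational_representative[OF this] obtain a i0 where a: "a $ i0 = 1"
      "C.on_curve (\<chi> i. to_ac (a $ i))" "pt (\<chi> i. to_ac (a $ i)) = Q i" by blast
    interpret P: rational_point ?\<iota> V \<xi> a i0 "\<chi> i. to_ac (a $ i)"
      by unfold_locales (use a in simp_all)
    obtain s where s: "s \<in> C.fun_field" "s \<notin> range ?\<iota>" using dim(1) by blast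
    obtain t where t: "dvr ?\<iota> P.A P.M t"
      using P.local_ring_dvr[OF assms(2) dim(2) s] by blast
    then have "dvr.K P.A = C.fun_field"
      using dvr.K_def[OF t] P.fun_field_quotients by simp
    then show "\<exists>x t. C.on_curve x \<and> pt x = Q i \<and> dvr ?\<iota> (C.regular_at x) (C.zero_in x) t \<and>
      dvr.K (C.regular_at x) = C.fun_field"
      using a t by blast
  qed
  then obtain x t where x: "\<And>i. C.on_curve (x i)" "\<And>i. pt (x i) = Q i"
    and dvr: "\<And>i. dvr ?\<iota> (C.regular_at (x i)) (C.zero_in (x i)) (t i)"
    and K: "\<And>i. dvr.K (C.regular_at (x i)) = C.fun_field"
    by metis
  define v where "v i = dvr.val (C.regular_at (x i)) (C.zero_in (x i)) (t i)" for i
  define R where "R = C.\<Phi> ` regular_outside V Q"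
  have R_iff: "e \<in> R \<longleftrightarrow> e \<in> C.fun_field \<and>
      (\<forall>z. C.on_curve z \<longrightarrow> pt z \<notin> range Q \<longrightarrow> e \<in> C.regular_at z)" for e
  proof
    assume "e \<in> R"
    then obtain f where f: "f \<in> regular_outside V Q" "e = C.\<Phi> f" unfolding R_def by blast
    then have fc: "f \<in> carrier C.FF" by (simp add: regular_outside_def)
    have "e \<in> C.regular_at z" if "C.on_curve z" "pt z \<notin> range Q" for z
      using C.local_ring_iff[OF that(1) fc] f that by (auto simp: regular_outside_def C.on_curve_def)
    then show "e \<in> C.fun_field \<and> (\<forall>z. C.on_curve z \<longrightarrow> pt z \<notin> range Q \<longrightarrow> e \<in> C.regular_at z)"
      using C.\<Phi>_in[OF fc] f(2) by blast
  next
    assume e: "e \<in> C.fun_field \<and> (\<forall>z. C.on_curve z \<longrightarrow> pt z \<notin> range Q \<longrightarrow> e \<in> C.regular_at z)"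
    then obtain f where f: "f \<in> carrier C.FF" "C.\<Phi> f = e" using C.\<Phi>_lift by blast
    have "f \<in> carrier (local_ring V P)" if P: "P \<in> V - range Q" for P
    proof -
      obtain z where z: "z \<noteq> 0" "P = pt z" by (rule proj_cases)
      then have "C.on_curve z" using P by (simp add: C.on_curve_def)
      then show ?thesis using C.local_ring_iff[of z f] f e P z by blast
    qed
    then have "f \<in> regular_outside V Q" using f(1) by (simp add: regular_outside_def)
    then show "e \<in> R" unfolding R_def using f(2) by blast
  qed
  have R_sub: "R \<subseteq> C.fun_field" using R_iff by blast
  have fun_sub: "subring_of C.fun_field"
  proof -
    have "e - e' \<in> C.fun_field \<and> e * e' \<in> C.fun_field"
      if e: "e \<in> C.fun_field" "e' \<in> C.fun_field" for e e'
    proof -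
      have m: "- e' \<in> C.fun_field" by (rule C.fun_field_uminus[OF e(2)])
      obtain f g h where "f \<in> carrier C.FF" "C.\<Phi> f = e" "g \<in> carrier C.FF" "C.\<Phi> g = e'"
        "h \<in> carrier C.FF" "C.\<Phi> h = - e'"
        using C.\<Phi>_lift e m by metis
      then show ?thesis
        using C.FF_add[of f h] C.FF_mult[of f g] C.\<Phi>_in by (metis diff_conv_add_uminus)
    qed
    then show ?thesis
      unfolding subring_of_def using C.FF_one C.\<Phi>_in by metis
  qed
  have const_fun: "?\<iota> c \<in> C.fun_field" for c
    using C.FF_const[of c] C.\<Phi>_in by metis
  have R_diff: "f - g \<in> R" if "f \<in> R" "g \<in> R" for f g
    using that subring_diff[OF fun_sub] subring_diff[OF C.regular_subring] unfolding R_iff by blast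
  have R_scale: "?\<iota> c * f \<in> R" if "f \<in> R" for f c
    using that subring_mult[OF fun_sub const_fun] subring_mult[OF C.regular_subring C.const_regular]
    unfolding R_iff by blast
  interpret S: pole_order_space ?\<iota> R v
  proof
    fix f g i
    assume fg: "f \<in> R" "g \<in> R"
    interpret D: dvr ?\<iota> "C.regular_at (x i)" "C.zero_in (x i)" "t i" by (rule dvr)
    have DK: "f \<in> D.K" "g \<in> D.K" "f - ?\<iota> c * g \<in> D.K" "f + g \<in> D.K" for c
      unfolding K using fg R_sub R_diff[OF fg(1) R_scale[OF fg(2)], of c]
        subring_add[OF fun_sub] by blast+
    show "f - g \<in> R" by (rule R_diff[OF fg])
    show "min (v i f) (v i g) \<le> v i (f + g)" if "f \<noteq> 0" "g \<noteq> 0" "f + g \<noteq> 0"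
      unfolding v_def using D.val_add DK that by blast
    show "\<exists>c. c \<noteq> 0 \<and> (f - ?\<iota> c * g = 0 \<or> v i f < v i (f - ?\<iota> c * g))"
      if "f \<noteq> 0" "g \<noteq> 0" "v i f = v i g"
      using D.val_residue[OF DK(1,2) that(1,2)] DK(3) that(3) unfolding v_def by blast
  next
    fix f c i assume f: "f \<in> R"
    interpret D: dvr ?\<iota> "C.regular_at (x i)" "C.zero_in (x i)" "t i" by (rule dvr)
    show "?\<iota> c * f \<in> R" by (rule R_scale[OF f])
    show "v i (?\<iota> c * f) = v i f" if "f \<noteq> 0" "c \<noteq> 0"
      unfolding v_def using D.val_scale that f R_sub K by blast
  next
    fix f assume f: "f \<in> R" "\<forall>i. 1 \<le> v i f"
    show "f = 0"
    proof (rule ccontr)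
      assume nz: "f \<noteq> 0"
      have zero: "f \<in> C.zero_in (x i)" for i
        using dvr.one_le_val[OF dvr, of f i] f nz R_sub K[of i] unfolding v_def by blast
      have "f \<in> C.regular_at z" if z: "C.on_curve z" for z
      proof (cases "pt z \<in> range Q")
        case True
        then obtain i where "pt z = pt (x i)" using x(2) by auto
        then have "C.regular_at z = C.regular_at (x i)"
          using C.on_curve_same_point(2)[OF x(1)] z by (simp add: C.on_curve_def)
        then show ?thesis using zero[of i] C.zero_in_subset by blast
      next
        case False
        then show ?thesis using f(1) z R_iff by blast
      qed
      then have "f = 0" by (rule C.regular_everywhere_zero_somewhere[OF _ x(1) zero])
      then show False using nz by blast
    qed
  qed
  have H: "gen_weierstrass_semigroup V Q = S.H"
  proof -
    have out: "f \<in> carrier C.FF" if "f \<in> regular_outside V Q" for f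
      using that by (simp add: regular_outside_def)
    let ?D = "regular_outside V Q - {\<zero>\<^bsub>C.FF\<^esub>}"
    have "pole_vector V Q f = S.poles (C.\<Phi> f)" if f: "f \<in> ?D" for f
    proof -
      have fc: "f \<in> carrier C.FF" "f \<noteq> \<zero>\<^bsub>C.FF\<^esub>" using f out by auto
      have "valuation V (Q i) f = v i (C.\<Phi> f)" for i
        using C.valuation_eq_val[OF x(1)[of i] dvr K fc] unfolding v_def x(2) .
      then show ?thesis by (simp add: pole_vector_def S.poles_def)
    qed
    then have "pole_vector V Q ` ?D = (\<lambda>f. S.poles (C.\<Phi> f)) ` ?D" by (rule image_cong[OF refl])
    also have "\<dots> = S.poles ` C.\<Phi> ` ?D" by (simp only: image_image)
    also have "C.\<Phi> ` ?D = R - {0}"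
    proof (intro equalityI subsetI)
      fix e assume "e \<in> C.\<Phi> ` ?D"
      then obtain f where f: "f \<in> ?D" "e = C.\<Phi> f" by blast
      then have "C.\<Phi> f \<noteq> 0" using C.\<Phi>_zero_iff[OF out, of f] by blast
      moreover have "e \<in> R" unfolding R_def f(2) by (rule imageI) (use f(1) in blast)
      ultimately show "e \<in> R - {0}" using f(2) by simp
    next
      fix e assume e: "e \<in> R - {0}"
      then obtain f where f: "f \<in> regular_outside V Q" "e = C.\<Phi> f" unfolding R_def by blast
      then have "f \<noteq> \<zero>\<^bsub>C.FF\<^esub>" using C.\<Phi>_zero_iff[OF out, of f] e by blast
      then show "e \<in> C.\<Phi> ` ?D" using f by blast
    qed
    finally show ?thesis unfolding gen_weierstrass_semigroup_def S.H_def .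
  qed
  have "S.maximal \<beta> \<longleftrightarrow> \<beta> \<in> absolute_maximal V Q" for \<beta>
    unfolding S.maximal_def absolute_maximal_def nabla_def H by blast
  then show ?thesis using S.H_eq_lubs[OF assms(4)] H by simp
qed

end
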